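(* For any morphism of marked surfaces $f:\Sigma\to\Sigma'$, the assignments $t_\gamma\mapsto t_{f(\gamma)}$ (resp. $x_\gamma\mapsto x_{f(\gamma)}$), $\gamma\in[\Gamma(\Sigma)]$, define a homomorphism of groups $f_\star:\mathbb{T}_\Sigma\to\mathbb{T}_{\Sigma'}$ (resp. of algebras $f_*:{\mathcal A}_\Sigma\to{\mathcal A}_{\Sigma'}$), and the square formed by $f_\star$, $f_*$ and the canonical multiplicative maps $\mathbb{T}_\Sigma\to{\mathcal A}_\Sigma$, $\mathbb{T}_{\Sigma'}\to{\mathcal A}_{\Sigma'}$ (given by $t_\gamma\mapsto x_\gamma$) commutes, i.e. the composition $\mathbb{T}_\Sigma\to{\mathcal A}_\Sigma\xrightarrow{f_*}{\mathcal A}_{\Sigma'}$ equals $\mathbb{T}_\Sigma\xrightarrow{f_\star}\mathbb{T}_{\Sigma'}\to{\mathcal A}_{\Sigma'}$.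
   Context: Marked surfaces. A marked surface $\Sigma$ is a connected compact smooth surface $\underline\Sigma$, possibly with boundary, equipped with a nonempty finite set $I=I(\Sigma)=I_b\sqcup I_p$ of marked points ($I_b$ on the boundary, $I_p$ the ordinary punctures, in the interior) and a finite set $I_s=I_s(\Sigma)$ of special punctures (in the interior, disjoint from $I$); each boundary component contains at least one point of $I_b$. Curves. Consider directed curves from a marked point to a marked point whose interiors avoid $I_p\cup I_s$; two such curves are equivalent if they are homotopic with fixed endpoints through such curves. $\Gamma(\Sigma)$ is the set of classes; $s(\gamma),t(\gamma)$ are source and target, $\overline\gamma$ is the reversed class. $[\Gamma(\Sigma)]$ is the set of classes of $\Gamma(\Sigma)$ modulo the equivalence relation generated by the crossing resolutions: if a curve $C$ has a self-intersection point $p$ such that the simple loop $C_0\subset C$ based at $p$ encloses exactly one special puncture (bounds a disk containing that special puncture and no other special puncture or marked point), then $C$ is equivalent to the curve obtained by reversing the direction of $C_0$. (These classes are called reduced.) A class is trivial if it is the class of a constant loop at a marked point. Morphisms. A morphism $f:\Sigma\to\Sigma'$ is a continuous map $f:\underline\Sigma\to\underline\Sigma'$ with discrete fibers such that: $f^{-1}(I(\Sigma'))=I(\Sigma)$ and $f(I_s(\Sigma))\subset I_s(\Sigma')$; with $I^f:=f^{-1}(I_s(\Sigma'))\setminus I_s(\Sigma)$, each point $p\in\underline\Sigma\setminus I^f$ has a neighborhood (half-neighborhood if $p\in\partial\underline\Sigma$) on which $f$ is injective; each $p\in I^f$ has a neighborhood $O_p$ such that $f|_{O_p}$ is a two-fold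 cover of $f(O_p)$ ramified at $f(p)$. For $\gamma\in[\Gamma(\Sigma)]$, $f(\gamma)\in[\Gamma(\Sigma')]$ is the class of $f(C)$ for any generic representative $C$ of $\gamma$ (it is well defined). Polygons. $P_n$ is the disk with $n$ marked boundary points $1,\dots,n$ in cyclic order and no punctures; $(i,j)$ is the chord from $i$ to $j$; $i^+=i+1$ for $i<n$, $n^+=1$. A sequence $(\gamma_1,\dots,\gamma_n)$ in $[\Gamma(\Sigma)]$ is an $n$-gon in $\Sigma$ if there is a morphism $g:P_n\to\Sigma$ with $g(i,i^+)=\gamma_i$ for all $i$; put $\gamma_{ij}:=g(i,j)$ for $i\ne j$. Triangles are 3-gons, quadrilaterals are 4-gons. Algebra and group. ${\mathcal A}_\Sigma$ is the $\mathbb{Q}$-algebra generated by $x_\gamma^{\pm1}$, $\gamma\in[\Gamma(\Sigma)]$, subject to: $x_\gamma=1$ if $\gamma$ is trivial; $x_{\gamma_1}x_{\overline\gamma_2}^{-1}x_{\gamma_3}=x_{\overline\gamma_3}x_{\gamma_2}^{-1}x_{\overline\gamma_1}$ for every triangle $(\gamma_1,\gamma_2,\gamma_3)$ in $\Sigma$; $x_{\gamma_{24}}=x_{\gamma_{21}}x_{\gamma_{31}}^{-1}x_{\gamma_{34}}+x_{\gamma_{23}}x_{\gamma_{13}}^{-1}x_{\gamma_{14}}$ for every quadrilateral $(\gamma_1,\gamma_2,\gamma_3,\gamma_4)$ in $\Sigma$. The big triangle group $\mathbb{T}_\Sigma$ is generated by $t_\gamma$, $\gamma\in[\Gamma(\Sigma)]$,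 subject to $t_\gamma=1$ for trivial $\gamma$ and $t_{\gamma_1}t_{\overline\gamma_2}^{-1}t_{\gamma_3}=t_{\overline\gamma_3}t_{\gamma_2}^{-1}t_{\overline\gamma_1}$ for every triangle in $\Sigma$. *)

theory Defs
  imports
    "HOL-Analysis.Analysis"
    "HOL-Algebra.Module"
    "HOL-Algebra.QuotRing"
    "HOL-Library.Poly_Mapping"
begin

section \<open>Smooth surfaces with boundary\<close>

abbreviation half_plane :: "complex set" where
  "half_plane \<equiv> {z. 0 \<le> Im z}"

fun Ck_on :: "nat \<Rightarrow> complex set \<Rightarrow> (complex \<Rightarrow> complex) \<Rightarrow> bool" where
  "Ck_on 0 W g \<longleftrightarrow> continuous_on W g"
| "Ck_on (Suc k) W g \<longleftrightarrow>
     (\<exists>g'. (\<forall>z\<in>W. (g has_derivative g' z) (at z)) \<and> (\<forall>v. Ck_on k W (\<lambda>z. g' z v)))"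

text \<open>Smoothness, in the real sense, on a subset of the half-plane that may meet its boundary:
  locally the restriction of a smooth map defined on an open set of the plane.\<close>

definition smooth_map_on :: "complex set \<Rightarrow> (complex \<Rightarrow> complex) \<Rightarrow> bool" where
  "smooth_map_on A h \<longleftrightarrow>
     (\<forall>z\<in>A. \<exists>W g. open W \<and> z \<in> W \<and> (\<forall>k. Ck_on k W g) \<and> (\<forall>y\<in>W \<inter> A. g y = h y))"

definition surface_chart :: "'a topology \<Rightarrow> 'a set \<Rightarrow> ('a \<Rightarrow> complex) \<Rightarrow> bool" where
  "surface_chart X U \<phi> \<longleftrightarrow>
     openin X U \<and>
     openin (top_of_set half_plane) (\<phi> ` U) \<and>
     homeomorphic_map (subtopology X U) (top_of_set (\<phi> ` U)) \<phi>"

definition smooth_atlas :: "'a topology \<Rightarrow> ('a set \<times> ('a \<Rightarrow> complex)) set \<Rightarrow> bool" where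
  "smooth_atlas X \<A> \<longleftrightarrow>
     (\<forall>(U, \<phi>)\<in>\<A>. surface_chart X U \<phi>) \<and>
     (\<Union>(U, \<phi>)\<in>\<A>. U) = topspace X \<and>
     (\<forall>(U, \<phi>)\<in>\<A>. \<forall>(V, \<psi>)\<in>\<A>. smooth_map_on (\<phi> ` (U \<inter> V)) (\<psi> \<circ> inv_into U \<phi>))"

text \<open>Curves, homotopies and morphisms are only required to be continuous, so no later notion
  depends on which smooth structure is chosen; a smooth surface is therefore recorded as a space
  that carries one.\<close>

definition smooth_surface :: "'a topology \<Rightarrow> bool" where
  "smooth_surface X \<longleftrightarrow>
     Hausdorff_space X \<and> second_countable X \<and> (\<exists>\<A>. smooth_atlas X \<A>)"

definition surface_boundary :: "'a topology \<Rightarrow> 'a set" where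
  "surface_boundary X = {p. \<exists>U \<phi>. surface_chart X U \<phi> \<and> p \<in> U \<and> Im (\<phi> p) = 0}"

section \<open>Marked surfaces\<close>

record 'a marked_surface =
  surface_space :: "'a topology"
  boundary_marked :: "'a set"
  ordinary_punctures :: "'a set"
  special_punctures :: "'a set"

definition marked_points :: "'a marked_surface \<Rightarrow> 'a set" where
  "marked_points \<Sigma> = boundary_marked \<Sigma> \<union> ordinary_punctures \<Sigma>"

definition is_marked_surface :: "'a marked_surface \<Rightarrow> bool" where
  "is_marked_surface \<Sigma> \<longleftrightarrow>
     (let X = surface_space \<Sigma>; bd = surface_boundary X in
       smooth_surface X \<and> compact_space X \<and> connected_space X \<and>
       finite (marked_points \<Sigma>) \<and> marked_points \<Sigma> \<noteq> {} \<and>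
       finite (special_punctures \<Sigma>) \<and>
       boundary_marked \<Sigma> \<subseteq> bd \<and>
       ordinary_punctures \<Sigma> \<subseteq> topspace X - bd \<and>
       special_punctures \<Sigma> \<subseteq> topspace X - bd \<and>
       marked_points \<Sigma> \<inter> special_punctures \<Sigma> = {} \<and>
       (\<forall>K \<in> connected_components_of (subtopology X bd). K \<inter> boundary_marked \<Sigma> \<noteq> {}))"

section \<open>Curves and reduced classes\<close>

text \<open>Curves are parametrised by \<open>[0,1]\<close>; values outside \<open>[0,1]\<close> play no role. A constant curve at
  an ordinary puncture has to be admitted separately, since it does not leave the puncture.\<close>

definition curves :: "'a marked_surface \<Rightarrow> (real \<Rightarrow> 'a) set" where
  "curves \<Sigma> =
     {c. pathin (surface_space \<Sigma>) c \<and> c 0 \<in> marked_points \<Sigma> \<and> c 1 \<in> marked_points \<Sigma> \<and>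
         ((\<forall>t\<in>{0<..<1}. c t \<notin> ordinary_punctures \<Sigma> \<union> special_punctures \<Sigma>) \<or>
          (\<forall>t\<in>{0..1}. c t = c 0))}"

definition curve_homotopy :: "'a marked_surface \<Rightarrow> ((real \<Rightarrow> 'a) \<times> (real \<Rightarrow> 'a)) set" where
  "curve_homotopy \<Sigma> =
     {(c, d). homotopic_with (\<lambda>e. e \<in> curves \<Sigma> \<and> e 0 = c 0 \<and> e 1 = c 1)
                (top_of_set {0..1}) (surface_space \<Sigma>) c d}"

text \<open>The loop \<open>c\<close> on \<open>[a,b]\<close> is simple and bounds the embedded closed disk \<open>h ` cball 0 1\<close>, in whose
  interior the only marked point or special puncture is one special puncture. The base point of
  the loop may itself be a marked point, as when \<open>c\<close> is a whole loop: under \<open>z \<mapsto> z\<^sup>2\<close> the two sides of a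
  bigon, which are homotopic, become a loop around a special puncture and its reverse.\<close>

definition encloses_one_special ::
    "'a marked_surface \<Rightarrow> (real \<Rightarrow> 'a) \<Rightarrow> real \<Rightarrow> real \<Rightarrow> bool" where
  "encloses_one_special \<Sigma> c a b \<longleftrightarrow>
     0 \<le> a \<and> a < b \<and> b \<le> 1 \<and> c a = c b \<and> inj_on c {a..<b} \<and>
     (\<exists>h::complex \<Rightarrow> 'a. embedding_map (top_of_set (cball 0 1)) (surface_space \<Sigma>) h \<and>
        h ` sphere 0 1 = c ` {a..b} \<and>
        (\<exists>q\<in>special_punctures \<Sigma>.
           h ` ball 0 1 \<inter> (marked_points \<Sigma> \<union> special_punctures \<Sigma>) = {q}))"

definition reverse_loop :: "real \<Rightarrow> real \<Rightarrow> (real \<Rightarrow> 'a) \<Rightarrow> real \<Rightarrow> 'a" where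
  "reverse_loop a b c = (\<lambda>t. if t \<in> {a..b} then c (a + b - t) else c t)"

definition crossing_resolution :: "'a marked_surface \<Rightarrow> ((real \<Rightarrow> 'a) \<times> (real \<Rightarrow> 'a)) set" where
  "crossing_resolution \<Sigma> =
     {(c, reverse_loop a b c) | c a b. c \<in> curves \<Sigma> \<and> encloses_one_special \<Sigma> c a b}"

text \<open>Instead of first forming homotopy classes and then identifying these, reduced classes are
  formed in one step, by the equivalence relation that homotopies and resolutions generate
  together; a reduced class is the set of all curves representing it.\<close>

definition reduced_equiv :: "'a marked_surface \<Rightarrow> ((real \<Rightarrow> 'a) \<times> (real \<Rightarrow> 'a)) set" where
  "reduced_equiv \<Sigma> =
     (let R = curve_homotopy \<Sigma> \<union> crossing_resolution \<Sigma> in (R \<union> R\<inverse>)\<^sup>*)"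

type_synonym 'a curve_class = "(real \<Rightarrow> 'a) set"

definition reduced_class :: "'a marked_surface \<Rightarrow> (real \<Rightarrow> 'a) \<Rightarrow> 'a curve_class" where
  "reduced_class \<Sigma> c = reduced_equiv \<Sigma> `` {c}"

definition reduced_classes :: "'a marked_surface \<Rightarrow> 'a curve_class set" where
  "reduced_classes \<Sigma> = curves \<Sigma> // reduced_equiv \<Sigma>"

definition reversed_class :: "'a curve_class \<Rightarrow> 'a curve_class" where
  "reversed_class \<gamma> = (\<lambda>c t. c (1 - t)) ` \<gamma>"

definition trivial_classes :: "'a marked_surface \<Rightarrow> 'a curve_class set" where
  "trivial_classes \<Sigma> = {reduced_class \<Sigma> (\<lambda>t. p) | p. p \<in> marked_points \<Sigma>}"

section \<open>Morphisms\<close>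

definition branch_points ::
    "'a marked_surface \<Rightarrow> 'b marked_surface \<Rightarrow> ('a \<Rightarrow> 'b) \<Rightarrow> 'a set" where
  "branch_points \<Sigma> \<Sigma>' f =
     {p \<in> topspace (surface_space \<Sigma>). f p \<in> special_punctures \<Sigma>'} - special_punctures \<Sigma>"

text \<open>In suitable disk coordinates around \<open>p\<close> and \<open>f p\<close>, the map is the standard ramified double
  cover \<open>z \<mapsto> z\<^sup>2\<close>. Merely asking for a two-fold cover away from the fibre of \<open>f p\<close> would allow
  disconnected neighbourhoods, on whose component at \<open>p\<close> the map does not ramify.\<close>

definition ramified_double_cover_at ::
    "'a topology \<Rightarrow> 'b topology \<Rightarrow> ('a \<Rightarrow> 'b) \<Rightarrow> 'a \<Rightarrow> bool" where
  "ramified_double_cover_at X Y f p \<longleftrightarrow>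
     (\<exists>U \<phi> \<psi>. openin X U \<and> p \<in> U \<and>
        homeomorphic_map (subtopology X U) (top_of_set (ball (0::complex) 1)) \<phi> \<and> \<phi> p = 0 \<and>
        homeomorphic_map (subtopology Y (f ` U)) (top_of_set (ball (0::complex) 1)) \<psi> \<and>
        (\<forall>x\<in>U. \<psi> (f x) = (\<phi> x)\<^sup>2))"

text \<open>At a boundary point an open neighbourhood in the surface is a half-neighbourhood, so the
  injectivity condition needs no case distinction.\<close>

definition surface_morphism ::
    "'a marked_surface \<Rightarrow> 'b marked_surface \<Rightarrow> ('a \<Rightarrow> 'b) \<Rightarrow> bool" where
  "surface_morphism \<Sigma> \<Sigma>' f \<longleftrightarrow>
     (let X = surface_space \<Sigma>; Y = surface_space \<Sigma>' in
       continuous_map X Y f \<and>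
       (\<forall>y\<in>topspace Y. subtopology X {x \<in> topspace X. f x = y}
                        = discrete_topology {x \<in> topspace X. f x = y}) \<and>
       {x \<in> topspace X. f x \<in> marked_points \<Sigma>'} = marked_points \<Sigma> \<and>
       f ` special_punctures \<Sigma> \<subseteq> special_punctures \<Sigma>' \<and>
       (\<forall>p\<in>topspace X - branch_points \<Sigma> \<Sigma>' f. \<exists>U. openin X U \<and> p \<in> U \<and> inj_on f U) \<and>
       (\<forall>p\<in>branch_points \<Sigma> \<Sigma>' f. ramified_double_cover_at X Y f p))"

text \<open>A representative is generic for \<open>f\<close> if its image is a curve of the target, i.e. does not run
  through a puncture.\<close>

definition class_image ::
    "'a marked_surface \<Rightarrow> 'b marked_surface \<Rightarrow> ('a \<Rightarrow> 'b) \<Rightarrow> 'a curve_class \<Rightarrow> 'b curve_class" where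
  "class_image \<Sigma> \<Sigma>' f \<gamma> =
     (THE \<gamma>'. \<exists>c\<in>\<gamma>. f \<circ> c \<in> curves \<Sigma>' \<and> \<gamma>' = reduced_class \<Sigma>' (f \<circ> c))"

section \<open>Polygons\<close>

definition polygon_vertex :: "nat \<Rightarrow> nat \<Rightarrow> complex" where
  "polygon_vertex n i = cis (2 * pi * real i / real n)"

definition polygon :: "nat \<Rightarrow> complex marked_surface" where
  "polygon n =
     \<lparr>surface_space = top_of_set (cball 0 1), boundary_marked = polygon_vertex n ` {1..n},
      ordinary_punctures = {}, special_punctures = {}\<rparr>"

definition chord :: "nat \<Rightarrow> nat \<Rightarrow> nat \<Rightarrow> complex curve_class" where
  "chord n i j = reduced_class (polygon n) (linepath (polygon_vertex n i) (polygon_vertex n j))"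

definition next_vertex :: "nat \<Rightarrow> nat \<Rightarrow> nat" where
  "next_vertex n i = (if i < n then i + 1 else 1)"

definition chord_image :: "nat \<Rightarrow> 'a marked_surface \<Rightarrow> (complex \<Rightarrow> 'a) \<Rightarrow> nat \<Rightarrow> nat \<Rightarrow> 'a curve_class"
  where "chord_image n \<Sigma> g i j = class_image (polygon n) \<Sigma> g (chord n i j)"

definition polygon_via :: "'a marked_surface \<Rightarrow> (complex \<Rightarrow> 'a) \<Rightarrow> 'a curve_class list \<Rightarrow> bool" where
  "polygon_via \<Sigma> g \<gamma>s \<longleftrightarrow>
     (let n = length \<gamma>s in
       set \<gamma>s \<subseteq> reduced_classes \<Sigma> \<and> surface_morphism (polygon n) \<Sigma> g \<and>
       (\<forall>i\<in>{1..n}. chord_image n \<Sigma> g i (next_vertex n i) = \<gamma>s ! (i - 1)))"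

definition is_polygon :: "'a marked_surface \<Rightarrow> 'a curve_class list \<Rightarrow> bool" where
  "is_polygon \<Sigma> \<gamma>s \<longleftrightarrow> (\<exists>g. polygon_via \<Sigma> g \<gamma>s)"

section \<open>Groups and rational algebras given by generators and relations\<close>

datatype 'g letter = Gen 'g | Inv 'g

text \<open>Words get a type of their own, so that concatenation makes them a (non-commutative)
  \<open>monoid_add\<close>; the product of \<open>poly_mapping\<close> is then that of the monoid algebra of words.\<close>

datatype 'l free_word = Word (letters: "'l list")

instantiation free_word :: (type) monoid_add
begin

definition zero_free_word :: "'a free_word" where
  "zero_free_word = Word []"

definition plus_free_word :: "'a free_word \<Rightarrow> 'a free_word \<Rightarrow> 'a free_word" where
  "plus_free_word u v = Word (letters u @ letters v)"

instance
  by standard (simp_all add: zero_free_word_def plus_free_word_def)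

end

definition words_over :: "'g set \<Rightarrow> 'g letter free_word set" where
  "words_over G = {w. set (letters w) \<subseteq> Gen ` G \<union> Inv ` G}"

inductive word_cong ::
    "'g set \<Rightarrow> ('g letter free_word \<times> 'g letter free_word) set \<Rightarrow>
     'g letter free_word \<Rightarrow> 'g letter free_word \<Rightarrow> bool"
  for G R where
  refl: "w \<in> words_over G \<Longrightarrow> word_cong G R w w"
| sym: "word_cong G R u v \<Longrightarrow> word_cong G R v u"
| trans: "word_cong G R u v \<Longrightarrow> word_cong G R v w \<Longrightarrow> word_cong G R u w"
| concat: "word_cong G R u v \<Longrightarrow> word_cong G R u' v' \<Longrightarrow> word_cong G R (u + u') (v + v')"
| right_inverse: "s \<in> G \<Longrightarrow> word_cong G R (Word [Gen s, Inv s]) 0"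
| left_inverse: "s \<in> G \<Longrightarrow> word_cong G R (Word [Inv s, Gen s]) 0"
| relation: "(u, v) \<in> R \<Longrightarrow> word_cong G R u v"

definition word_class ::
    "'g set \<Rightarrow> ('g letter free_word \<times> 'g letter free_word) set \<Rightarrow>
     'g letter free_word \<Rightarrow> 'g letter free_word set" where
  "word_class G R w = {v. word_cong G R w v}"

definition presented_group ::
    "'g set \<Rightarrow> ('g letter free_word \<times> 'g letter free_word) set \<Rightarrow> 'g letter free_word set monoid"
  where
  "presented_group G R =
     \<lparr>carrier = word_class G R ` words_over G,
      monoid.mult = (\<lambda>A B. \<Union>u\<in>A. \<Union>v\<in>B. word_class G R (u + v)),
      one = word_class G R 0\<rparr>"

type_synonym 'g free_poly = "'g letter free_word \<Rightarrow>\<^sub>0 rat"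

definition monomial :: "'g letter list \<Rightarrow> 'g free_poly" where
  "monomial ls = Poly_Mapping.single (Word ls) 1"

definition free_algebra :: "'g set \<Rightarrow> (rat, 'g free_poly) module" where
  "free_algebra G =
     \<lparr>carrier = {p. Poly_Mapping.keys p \<subseteq> words_over G}, monoid.mult = (*), one = 1,
      ring.zero = 0, add = (+), smult = (\<lambda>q p. Poly_Mapping.single 0 q * p)\<rparr>"

definition presented_ideal :: "'g set \<Rightarrow> 'g free_poly set \<Rightarrow> 'g free_poly set" where
  "presented_ideal G R =
     genideal (free_algebra G)
       ({monomial [Gen s, Inv s] - 1 | s. s \<in> G} \<union> {monomial [Inv s, Gen s] - 1 | s. s \<in> G} \<union> R)"

definition poly_class :: "'g set \<Rightarrow> 'g free_poly set \<Rightarrow> 'g free_poly \<Rightarrow> 'g free_poly set" where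
  "poly_class G R p = a_r_coset (free_algebra G) (presented_ideal G R) p"

text \<open>The algebra generated by \<open>G\<close> and formal inverses, with the polynomials in \<open>R\<close> set to zero.\<close>

definition presented_algebra :: "'g set \<Rightarrow> 'g free_poly set \<Rightarrow> (rat, 'g free_poly set) module" where
  "presented_algebra G R =
     ring.extend (free_algebra G Quot presented_ideal G R)
       (module.fields (\<lambda>q A. \<Union>p\<in>A. poly_class G R (q \<odot>\<^bsub>free_algebra G\<^esub> p)))"

text \<open>The library's \<open>algebra\<close> locale is for commutative algebras only.\<close>

definition algebra_hom ::
    "('k, 'a) module \<Rightarrow> ('k, 'b) module \<Rightarrow> ('a \<Rightarrow> 'b) set" where
  "algebra_hom A B =
     {h \<in> ring_hom A B. \<forall>q. \<forall>x\<in>carrier A. h (q \<odot>\<^bsub>A\<^esub> x) = q \<odot>\<^bsub>B\<^esub> h x}"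

section \<open>The big triangle group and the noncommutative algebra of a marked surface\<close>

definition triangle_group_relations ::
    "'a marked_surface \<Rightarrow> ('a curve_class letter free_word \<times> 'a curve_class letter free_word) set"
  where
  "triangle_group_relations \<Sigma> =
     {(Word [Gen \<gamma>], 0) | \<gamma>. \<gamma> \<in> trivial_classes \<Sigma>} \<union>
     {(Word [Gen \<gamma>1, Inv (reversed_class \<gamma>2), Gen \<gamma>3],
       Word [Gen (reversed_class \<gamma>3), Inv \<gamma>2, Gen (reversed_class \<gamma>1)])
       | \<gamma>1 \<gamma>2 \<gamma>3. is_polygon \<Sigma> [\<gamma>1, \<gamma>2, \<gamma>3]}"

definition triangle_group :: "'a marked_surface \<Rightarrow> 'a curve_class letter free_word set monoid" where
  "triangle_group \<Sigma> = presented_group (reduced_classes \<Sigma>) (triangle_group_relations \<Sigma>)"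

definition t_elem :: "'a marked_surface \<Rightarrow> 'a curve_class \<Rightarrow> 'a curve_class letter free_word set" where
  "t_elem \<Sigma> \<gamma> = word_class (reduced_classes \<Sigma>) (triangle_group_relations \<Sigma>) (Word [Gen \<gamma>])"

definition surface_algebra_relations :: "'a marked_surface \<Rightarrow> 'a curve_class free_poly set" where
  "surface_algebra_relations \<Sigma> =
     {monomial [Gen \<gamma>] - 1 | \<gamma>. \<gamma> \<in> trivial_classes \<Sigma>} \<union>
     {monomial [Gen \<gamma>1, Inv (reversed_class \<gamma>2), Gen \<gamma>3]
        - monomial [Gen (reversed_class \<gamma>3), Inv \<gamma>2, Gen (reversed_class \<gamma>1)]
       | \<gamma>1 \<gamma>2 \<gamma>3. is_polygon \<Sigma> [\<gamma>1, \<gamma>2, \<gamma>3]} \<union>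
     {let \<gamma> = chord_image 4 \<Sigma> g in
        monomial [Gen (\<gamma> 2 4)]
        - (monomial [Gen (\<gamma> 2 1), Inv (\<gamma> 3 1), Gen (\<gamma> 3 4)]
           + monomial [Gen (\<gamma> 2 3), Inv (\<gamma> 1 3), Gen (\<gamma> 1 4)])
       | g \<gamma>1 \<gamma>2 \<gamma>3 \<gamma>4. polygon_via \<Sigma> g [\<gamma>1, \<gamma>2, \<gamma>3, \<gamma>4]}"

definition surface_algebra :: "'a marked_surface \<Rightarrow> (rat, 'a curve_class free_poly set) module" where
  "surface_algebra \<Sigma> = presented_algebra (reduced_classes \<Sigma>) (surface_algebra_relations \<Sigma>)"

definition x_elem :: "'a marked_surface \<Rightarrow> 'a curve_class \<Rightarrow> 'a curve_class free_poly set" where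
  "x_elem \<Sigma> \<gamma> = poly_class (reduced_classes \<Sigma>) (surface_algebra_relations \<Sigma>) (monomial [Gen \<gamma>])"

text \<open>The class of a word in the letters \<open>t\<^sub>\<gamma>\<close> and their inverses goes to the class of the same word in
  the letters \<open>x\<^sub>\<gamma>\<close> and their inverses.\<close>

definition canonical_map ::
    "'a marked_surface \<Rightarrow> 'a curve_class letter free_word set \<Rightarrow> 'a curve_class free_poly set" where
  "canonical_map \<Sigma> A =
     (THE a. \<exists>w\<in>A. a = poly_class (reduced_classes \<Sigma>) (surface_algebra_relations \<Sigma>)
                         (monomial (letters w)))"

end

theory Submission
  imports Defs
begin

text \<open>The relations of both presentations come from trivial classes and polygons, so everything follows from
  three facts: \<open>\<gamma> \<mapsto> f(\<gamma>)\<close> is well defined on reduced classes, it commutes with reversal, and it takes the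
  chords of a polygon in \<open>\<Sigma>\<close> to the chords of a polygon in \<open>\<Sigma>'\<close>.

  For the first fact, call a curve generic if it avoids all punctures and the preimages of the punctures
  of the target. Any two generic curves with common endpoints that are close to a given curve \<open>c\<close> have
  images in the same reduced class: this is a local matter, clear where \<open>f\<close> is injective, while near a
  branch point the two curves differ by full turns around it, and \<open>z \<mapsto> z\<^sup>2\<close> makes each of these two turns
  around a special puncture, which a crossing resolution undoes. Hence each curve has a limit class,
  which is locally constant along a homotopy and, because a loop around a special puncture can be
  shrunk towards it, does not change under crossing resolutions.

  If \<open>g\<close> is a polygon in \<open>\<Sigma>\<close>, then \<open>f \<circ> g\<close> need not be a morphism, as sides of the polygon may run through
  branch points of \<open>f\<close>; pulling the sides of the polygon inwards first repairs this.\<close>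

section \<open>Curves and reduced classes\<close>

text \<open>A homotopy in \<Sigma> cannot simply be pushed forward, because an intermediate curve
  may run through an obstacle. Apart from the punctures of \<Sigma> itself, an obstacle is either a
  branch point or a boundary marked point whose image is an ordinary puncture; a curve of \<Sigma>
  may touch the latter, its image may not. At such a point nothing can wind, since a half-disc
  without the midpoint of its diameter is contractible, and at a marked end point winding is undone
  by shrinking the path towards that end. Only branch points need crossing resolutions. Closeness to
  a curve c means lying in an open neighbourhood of the graph of c in [0,1] x X, and local
  comparisons are assembled over [0,1] by bisection. Turning is measured by continuous logarithms in
  punctured discs: logarithms with equal ends give a homotopy, ends that are 4 pi i apart give a
  crossing resolution. Applied to the identity, the same results show that every reduced class has
  representatives that avoid a given finite set at inner times.\<close>

abbreviation punctures :: "'a marked_surface \<Rightarrow> 'a set" where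
  "punctures \<Sigma> \<equiv> ordinary_punctures \<Sigma> \<union> special_punctures \<Sigma>"

lemma curvesD: "c \<in> curves S \<Longrightarrow> pathin (surface_space S) c \<and> c 0 \<in> marked_points S \<and> c 1 \<in> marked_points S"
  by (simp add: curves_def)

text \<open>The alternative for constant curves in \<open>curves\<close> is dropped on purpose:
  deforming the inner part of a curve off \<open>F\<close> makes sense only for these curves.
  Constant curves at a puncture return in \<open>limit_class_constant\<close>.\<close>

definition curves_avoiding :: "'a marked_surface \<Rightarrow> 'a set \<Rightarrow> (real \<Rightarrow> 'a) set" where
  "curves_avoiding \<Sigma> F =
     {c. pathin (surface_space \<Sigma>) c \<and> c 0 \<in> marked_points \<Sigma> \<and> c 1 \<in> marked_points \<Sigma> \<and>
         (\<forall>t\<in>{0<..<1}. c t \<notin> F)}"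

abbreviation proper_curves :: "'a marked_surface \<Rightarrow> (real \<Rightarrow> 'a) set" where
  "proper_curves \<Sigma> \<equiv> curves_avoiding \<Sigma> (punctures \<Sigma>)"

lemma proper_curves_subset: "proper_curves \<Sigma> \<subseteq> curves \<Sigma>"
  by (auto simp: curves_avoiding_def curves_def)

definition patch :: "real \<Rightarrow> real \<Rightarrow> (real \<Rightarrow> 'a) \<Rightarrow> (real \<Rightarrow> 'a) \<Rightarrow> real \<Rightarrow> 'a" where
  "patch a b d e = (\<lambda>t. if t \<in> {a..b} then d t else e t)"

lemma patch_inside [simp]: "a \<le> t \<Longrightarrow> t \<le> b \<Longrightarrow> patch a b d e t = d t"
  by (simp add: patch_def)

lemma patch_outside: "t \<notin> {a..b} \<Longrightarrow> patch a b d e t = e t"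
  unfolding patch_def by (rule if_not_P)

lemma continuous_map_comp:
  assumes "continuous_map X Y f" "continuous_map Y Z g"
  shows "continuous_map X Z (\<lambda>x. g (f x))"
  using continuous_map_compose[OF assms] by (simp add: o_def)

lemma continuous_map_patch:
  fixes p :: "'x \<Rightarrow> real"
  assumes p: "continuous_map X euclideanreal p"
    and f: "continuous_map (subtopology X {x \<in> topspace X. p x \<in> {a..b}}) Y f"
    and e: "continuous_map X Y e"
    and ends: "\<And>x. x \<in> topspace X \<Longrightarrow> p x = a \<or> p x = b \<Longrightarrow> f x = e x"
  shows "continuous_map X Y (\<lambda>x. if p x \<in> {a..b} then f x else e x)"
proof (rule continuous_map_cases_function [OF p])
  have "euclideanreal closure_of {a..b} = {a..b}"
    by simp
  then show "continuous_map (subtopology X {x \<in> topspace X. p x \<in> euclideanreal closure_of {a..b}}) Y f"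
    using f by simp
  show "continuous_map (subtopology X {x \<in> topspace X.
      p x \<in> euclideanreal closure_of (topspace euclideanreal - {a..b})}) Y e"
    using e by (rule continuous_map_from_subtopology)
  fix x assume "x \<in> topspace X" "p x \<in> euclideanreal frontier_of {a..b}"
  moreover have "frontier {a..b} \<subseteq> {a,b}"
    by (auto simp: frontier_def)
  ultimately show "f x = e x"
    using ends by (auto simp: frontier_of_def frontier_def)
qed

lemma pathin_patch:
  assumes "pathin Y e" "continuous_map (top_of_set {a..b}) Y d" "0 \<le> a" "b \<le> 1" "d a = e a" "d b = e b"
  shows "pathin Y (patch a b d e)"
proof -
  have "continuous_map (top_of_set {0..1}) Y (\<lambda>x. if x \<in> {a..b} then d x else e x)"
  proof (rule continuous_map_patch)
    have "{x \<in> topspace (top_of_set {0..1}). x \<in> {a..b}} = {a..b}"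
      using assms by auto
    then show "continuous_map (subtopology (top_of_set {0..1}) {x \<in> topspace (top_of_set {0..1}). x \<in> {a..b}}) Y d"
      using assms by (simp add: subtopology_subtopology Int_absorb1)
  qed (use assms in \<open>auto simp: pathin_def\<close>)
  then show ?thesis
    by (simp add: pathin_def patch_def)
qed

lemma pathin_cong: "pathin X c \<Longrightarrow> (\<And>t. t \<in> {0..1} \<Longrightarrow> c t = d t) \<Longrightarrow> pathin X d"
  by (auto simp: pathin_def intro: continuous_map_eq)

lemma curves_cong:
  assumes "c \<in> curves \<Sigma>" "\<And>t. t \<in> {0..1} \<Longrightarrow> c t = d t"
  shows "d \<in> curves \<Sigma>"
  using assms pathin_cong[of _ c d] by (simp add: curves_def)

text \<open>Agreement with \<open>c\<close> and \<open>d\<close> is required on [0,1] only. This is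
  legitimate because the property inside \<open>homotopic_with\<close> depends on the restriction to
  [0,1] alone, by \<open>curves_cong\<close>.\<close>

lemma curve_homotopyI:
  fixes h :: "real \<times> real \<Rightarrow> 'a"
  assumes "continuous_map (prod_topology (top_of_set {0..1}) (top_of_set {0..1})) (surface_space \<Sigma>) h"
    and "\<And>t. t \<in> {0..1} \<Longrightarrow> h (0, t) = c t" "\<And>t. t \<in> {0..1} \<Longrightarrow> h (1, t) = d t"
    and "\<And>s. s \<in> {0..1} \<Longrightarrow> (\<lambda>t. h (s, t)) \<in> curves \<Sigma> \<and> h (s, 0) = c 0 \<and> h (s, 1) = c 1"
  shows "(c, d) \<in> curve_homotopy \<Sigma>"
proof -
  have "homotopic_with (\<lambda>e. e \<in> curves \<Sigma> \<and> e 0 = c 0 \<and> e 1 = c 1)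
      (top_of_set {0..1}) (surface_space \<Sigma>) c d"
  proof (rule iffD2[OF homotopic_with])
    show "h \<in> curves \<Sigma> \<and> h 0 = c 0 \<and> h 1 = c 1 \<longleftrightarrow> k \<in> curves \<Sigma> \<and> k 0 = c 0 \<and> k 1 = c 1"
      if "\<And>x. x \<in> topspace (top_of_set {0..1}) \<Longrightarrow> h x = k x" for h k
    proof -
      have "h t = k t" if "t \<in> {0..1}" for t
        using that \<open>\<And>x. x \<in> topspace (top_of_set {0..1}) \<Longrightarrow> h x = k x\<close> by simp
      then show ?thesis
        using curves_cong[of h \<Sigma> k] curves_cong[of k \<Sigma> h] by auto
    qed
  qed (use assms in \<open>auto intro!: exI[of _ h]\<close>)
  then show ?thesis
    by (simp add: curve_homotopy_def)
qed

lemma curve_homotopyE: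
  assumes "(c, d) \<in> curve_homotopy \<Sigma>"
  obtains h :: "real \<times> real \<Rightarrow> 'a" where
    "continuous_map (prod_topology (top_of_set {0..1}) (top_of_set {0..1})) (surface_space \<Sigma>) h"
    "\<And>t. h (0, t) = c t" "\<And>t. h (1, t) = d t"
    "\<And>s. s \<in> {0..1} \<Longrightarrow> (\<lambda>t. h (s, t)) \<in> curves \<Sigma> \<and> h (s, 0) = c 0 \<and> h (s, 1) = c 1"
proof -
  have "\<exists>h :: real \<times> real \<Rightarrow> 'a. continuous_map (prod_topology (top_of_set {0..1}) (top_of_set {0..1})) (surface_space \<Sigma>) h \<and>
    (\<forall>t. h (0, t) = c t) \<and> (\<forall>t. h (1, t) = d t) \<and>
    (\<forall>s\<in>{0..1}. (\<lambda>t. h (s, t)) \<in> curves \<Sigma> \<and> h (s, 0) = c 0 \<and> h (s, 1) = c 1)"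
    using assms unfolding curve_homotopy_def homotopic_with_def mem_Collect_eq case_prod_conv .
  then show thesis using that by metis
qed

text \<open>The alternative in the last hypothesis is what allows a loop to be shrunk to a constant one.\<close>

lemma curve_homotopy_patch:
  fixes k :: "real \<Rightarrow> real \<Rightarrow> complex"
  assumes e: "e \<in> proper_curves \<Sigma>" and ab: "0 \<le> a" "a \<le> b" "b \<le> 1"
    and g: "continuous_map (top_of_set C) (surface_space \<Sigma>) g"
    and k: "continuous_on ({0..1} \<times> {a..b}) (\<lambda>(s, t). k s t)"
    and kC: "\<And>s t. s \<in> {0..1} \<Longrightarrow> t \<in> {a..b} \<Longrightarrow> k s t \<in> C"
    and ends: "\<And>s. s \<in> {0..1} \<Longrightarrow> g (k s a) = e a \<and> g (k s b) = e b"
    and e0: "\<And>t. t \<in> {a..b} \<Longrightarrow> g (k 0 t) = e t"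
    and e1: "\<And>t. t \<in> {a..b} \<Longrightarrow> g (k 1 t) = e' t"
    and eq: "\<And>t. t \<in> {0..1} - {a..b} \<Longrightarrow> e' t = e t"
    and avoid: "\<And>s. s \<in> {0..1} \<Longrightarrow> (\<forall>t\<in>{a..b} \<inter> {0<..<1}. g (k s t) \<notin> punctures \<Sigma>) \<or>
        a = 0 \<and> b = 1 \<and> (\<forall>t\<in>{0..1}. g (k s t) = g (k s 0))"
  shows "(e, e') \<in> curve_homotopy \<Sigma>"
proof (rule curve_homotopyI)
  let ?I = "top_of_set {0..1::real}"
  let ?h = "\<lambda>x::real \<times> real. if snd x \<in> {a..b} then g (k (fst x) (snd x)) else e (snd x)"
  have e': "pathin (surface_space \<Sigma>) e" "e 0 \<in> marked_points \<Sigma>" "e 1 \<in> marked_points \<Sigma>"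
      "\<And>t. t \<in> {0<..<1} \<Longrightarrow> e t \<notin> punctures \<Sigma>"
    using e by (auto simp: curves_avoiding_def)
  show cont: "continuous_map (prod_topology ?I ?I) (surface_space \<Sigma>) ?h"
  proof (rule continuous_map_patch)
    show "continuous_map (prod_topology ?I ?I) euclideanreal snd"
      using continuous_map_snd[of ?I ?I] continuous_map_in_subtopology by blast
    have eqs: "{x \<in> topspace (prod_topology ?I ?I). snd x \<in> {a..b}} = {0..1} \<times> {a..b}"
      using ab by (auto simp: mem_Times_iff)
    have "subtopology (prod_topology ?I ?I) ({0..1} \<times> {a..b}) = top_of_set ({0..1} \<times> {a..b})"
    proof -
      have "({0..1::real} \<times> {0..1::real}) \<inter> ({0..1} \<times> {a..b}) = {0..1} \<times> {a..b}"
        using ab by auto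
      then show ?thesis by (simp add: subtopology_subtopology)
    qed
    moreover have "continuous_map (top_of_set ({0..1} \<times> {a..b})) (top_of_set C) (\<lambda>x. k (fst x) (snd x))"
      using k kC by (auto simp: continuous_map_in_subtopology case_prod_unfold)
    ultimately show "continuous_map (subtopology (prod_topology ?I ?I)
        {x \<in> topspace (prod_topology ?I ?I). snd x \<in> {a..b}}) (surface_space \<Sigma>)
        (\<lambda>x. g (k (fst x) (snd x)))"
      unfolding eqs by (metis continuous_map_comp[OF _ g])
    show "continuous_map (prod_topology ?I ?I) (surface_space \<Sigma>) (\<lambda>x. e (snd x))"
      by (rule continuous_map_comp[OF continuous_map_snd e'(1)[unfolded pathin_def]])
  qed (use ends in auto)
  show "?h (0, t) = e t" for t
    using e0 by auto
  show "?h (1, t) = e' t" if "t \<in> {0..1}" for t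
    using e1 eq that by auto
  fix s :: real assume s: "s \<in> {0..1}"
  have en: "?h (s, 0) = e 0" "?h (s, 1) = e 1"
    using ends[OF s] ab by (auto simp: order_antisym_conv)
  have p: "pathin (surface_space \<Sigma>) (\<lambda>t. ?h (s, t))"
    using continuous_map_o_Pair[OF cont, of s] s by (simp add: pathin_def o_def)
  have "(\<forall>t\<in>{0<..<1}. ?h (s, t) \<notin> punctures \<Sigma>) \<or> (\<forall>t\<in>{0..1}. ?h (s, t) = ?h (s, 0))"
    using avoid[OF s] e'(4) by auto
  then show "(\<lambda>t. ?h (s, t)) \<in> curves \<Sigma> \<and> ?h (s, 0) = e 0 \<and> ?h (s, 1) = e 1"
    using e' en p by (simp add: curves_def)
qed

lemma reduced_equiv_refl: "(c, c) \<in> reduced_equiv \<Sigma>"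
  by (simp add: reduced_equiv_def Let_def)

lemma reduced_equiv_sym: "(c, d) \<in> reduced_equiv \<Sigma> \<Longrightarrow> (d, c) \<in> reduced_equiv \<Sigma>"
  unfolding reduced_equiv_def Let_def
  by (metis (no_types, lifting) converseD converseI converse_Un converse_converse rtrancl_converseI sup_commute)

lemma reduced_equiv_trans:
  "(c, d) \<in> reduced_equiv \<Sigma> \<Longrightarrow> (d, e) \<in> reduced_equiv \<Sigma> \<Longrightarrow> (c, e) \<in> reduced_equiv \<Sigma>"
  unfolding reduced_equiv_def Let_def by (rule rtrancl_trans)

lemma equiv_reduced: "equiv UNIV (reduced_equiv \<Sigma>)"
  by (intro equivI refl_onI symI transI) (auto intro: reduced_equiv_refl reduced_equiv_sym reduced_equiv_trans)

lemma curve_homotopy_reduced: "(c, d) \<in> curve_homotopy \<Sigma> \<Longrightarrow> (c, d) \<in> reduced_equiv \<Sigma>"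
  by (auto simp: reduced_equiv_def Let_def)

lemma crossing_resolution_reduced: "(c, d) \<in> crossing_resolution \<Sigma> \<Longrightarrow> (c, d) \<in> reduced_equiv \<Sigma>"
  by (auto simp: reduced_equiv_def Let_def)

text \<open>Works with the generated equivalence relation instead of chains, so that homotopies and
  resolutions have to be treated in one direction only.\<close>

lemma reduced_equiv_induct [consumes 1, case_names refl homotopy crossing sym trans]:
  assumes "(c, d) \<in> reduced_equiv \<Sigma>"
    and "\<And>c. P c c" "\<And>c d. (c, d) \<in> curve_homotopy \<Sigma> \<Longrightarrow> P c d"
    and "\<And>c d. (c, d) \<in> crossing_resolution \<Sigma> \<Longrightarrow> P c d"
    and "\<And>c d. P c d \<Longrightarrow> P d c" "\<And>c d e. P c d \<Longrightarrow> P d e \<Longrightarrow> P c e"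
  shows "P c d"
  using assms(1) unfolding reduced_equiv_def Let_def
  by (induction rule: rtrancl_induct) (use assms(2-) in blast)+

lemma reduced_class_eq_iff: "reduced_class \<Sigma> c = reduced_class \<Sigma> d \<longleftrightarrow> (c, d) \<in> reduced_equiv \<Sigma>"
  unfolding reduced_class_def using equiv_class_eq_iff[OF equiv_reduced] by blast

lemma in_reduced_class_iff: "d \<in> reduced_class \<Sigma> c \<longleftrightarrow> (c, d) \<in> reduced_equiv \<Sigma>"
  by (simp add: reduced_class_def)

lemma reduced_classes_iff: "\<gamma> \<in> reduced_classes \<Sigma> \<longleftrightarrow> (\<exists>c\<in>curves \<Sigma>. \<gamma> = reduced_class \<Sigma> c)"
  by (auto simp: reduced_classes_def quotient_def reduced_class_def)

text \<open>Injectivity on a nondegenerate half-open interval rules out the constant alternative in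
  \<open>curves\<close>.\<close>

lemma loop_proper:
  assumes "c \<in> curves \<Sigma>" "0 \<le> a" "a < b" "b \<le> 1" "inj_on c {a..<b}"
  shows "c \<in> proper_curves \<Sigma>"
proof -
  have ne: "c ((a + b) / 2) \<noteq> c a"
    using assms(3) inj_onD[OF assms(5), of "(a + b) / 2" a] by (auto simp: field_simps)
  have "\<not> (\<forall>t\<in>{0..1}. c t = c 0)"
  proof
    assume H: "\<forall>t\<in>{0..1}. c t = c 0"
    have "c a = c 0" "c ((a + b) / 2) = c 0"
      using assms(2-4) by (auto intro!: bspec[OF H])
    then show False using ne by simp
  qed
  then show ?thesis
    using assms(1) unfolding curves_def curves_avoiding_def by blast
qed

lemma reverse_loop_curve:
  assumes "c \<in> curves \<Sigma>" "0 \<le> a" "a < b" "b \<le> 1" "c a = c b" "inj_on c {a..<b}"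
  shows "reverse_loop a b c \<in> curves \<Sigma>"
proof -
  have p: "pathin (surface_space \<Sigma>) c" and m: "c 0 \<in> marked_points \<Sigma>" "c 1 \<in> marked_points \<Sigma>"
    using assms by (auto simp: curves_def)
  have av: "\<And>t. t \<in> {0<..<1} \<Longrightarrow> c t \<notin> punctures \<Sigma>"
    using loop_proper[OF assms(1-4,6)] by (auto simp: curves_avoiding_def)
  have "pathin (surface_space \<Sigma>) (patch a b (\<lambda>t. c (a + b - t)) c)"
  proof (rule pathin_patch[OF p])
    have "continuous_map (top_of_set {a..b}) (top_of_set {0..1}) (\<lambda>t. a + b - t)"
      using assms by (auto simp: continuous_map_in_subtopology intro!: continuous_intros)
    then show "continuous_map (top_of_set {a..b}) (surface_space \<Sigma>) (\<lambda>t. c (a + b - t))"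
      using p unfolding pathin_def by (rule continuous_map_comp)
  qed (use assms in auto)
  then have "pathin (surface_space \<Sigma>) (reverse_loop a b c)"
    by (simp add: patch_def reverse_loop_def)
  moreover have "reverse_loop a b c 0 = c 0" "reverse_loop a b c 1 = c 1"
    using assms by (auto simp: reverse_loop_def order_antisym_conv)
  moreover have "reverse_loop a b c t \<notin> punctures \<Sigma>" if "t \<in> {0<..<1}" for t
  proof (cases "t \<in> {a<..<b}")
    case True
    then have "reverse_loop a b c t = c (a + b - t)" "a + b - t \<in> {0<..<1}"
      using assms(2,4) by (auto simp: reverse_loop_def)
    then show ?thesis using av by metis
  next
    case False
    then have "reverse_loop a b c t = c t"
      using assms(3,5) by (cases "t = a"; cases "t = b") (auto simp: reverse_loop_def)
    then show ?thesis using av[OF that] by simp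
  qed
  ultimately show ?thesis
    using m by (simp add: curves_def)
qed

lemma reduced_equiv_curves:
  assumes "(c, d) \<in> reduced_equiv \<Sigma>"
  shows "c \<in> curves \<Sigma> \<longleftrightarrow> d \<in> curves \<Sigma>"
  using assms
proof (induction rule: reduced_equiv_induct)
  case (homotopy c d)
  then show ?case
    unfolding curve_homotopy_def by (auto dest!: homotopic_with_imp_property)
next
  case (crossing c d)
  then show ?case
    by (auto simp: crossing_resolution_def encloses_one_special_def intro: reverse_loop_curve)
qed auto

lemma reduced_equiv_ends:
  assumes "(c, d) \<in> reduced_equiv \<Sigma>"
  shows "c 0 = d 0 \<and> c 1 = d 1"
  using assms
proof (induction rule: reduced_equiv_induct)
  case (homotopy c d)
  then show ?case
    unfolding curve_homotopy_def by (auto dest!: homotopic_with_imp_property)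
next
  case (crossing c d)
  then show ?case
    by (auto simp: crossing_resolution_def encloses_one_special_def reverse_loop_def order_antisym_conv)
qed auto

lemma reversed_curve: "c \<in> curves \<Sigma> \<Longrightarrow> (\<lambda>t. c (1 - t)) \<in> curves \<Sigma>"
proof -
  assume c: "c \<in> curves \<Sigma>"
  have "pathin (surface_space \<Sigma>) (\<lambda>t. c (1 - t))"
    unfolding pathin_def
  proof (rule continuous_map_comp[where g = c])
    show "continuous_map (top_of_set {0..1::real}) (top_of_set {0..1}) (\<lambda>t. 1 - t)"
      by (auto simp: continuous_map_in_subtopology intro!: continuous_intros)
    show "continuous_map (top_of_set {0..1}) (surface_space \<Sigma>) c"
      using c by (simp add: curves_def pathin_def)
  qed
  moreover have "(\<forall>t\<in>{0<..<1}. c t \<notin> punctures \<Sigma>) \<or> (\<forall>t\<in>{0..1}. c t = c 0)"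
    "c 0 \<in> marked_points \<Sigma>" "c 1 \<in> marked_points \<Sigma>"
    using c unfolding curves_def by blast+
  moreover have "(\<forall>t\<in>{0<..<1}. c (1 - t) \<notin> punctures \<Sigma>) \<or> (\<forall>t\<in>{0..1}. c (1 - t) = c (1 - 0))"
    using calculation(2)
  proof
    assume H: "\<forall>t\<in>{0..1}. c t = c 0"
    have "c (1 - t) = c (1 - 0)" if "t \<in> {0..1}" for t
      using bspec[OF H, of "1 - t"] bspec[OF H, of 1] that by (metis atLeastAtMost_iff diff_zero diff_ge_0_iff_ge le_add_same_cancel1 le_diff_eq add.commute order_refl zero_le_one diff_le_eq)
    then show ?thesis by blast
  qed auto
  ultimately show ?thesis
    unfolding curves_def by simp
qed

lemma reduced_equiv_reversed:
  assumes "(c, d) \<in> reduced_equiv \<Sigma>"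
  shows "((\<lambda>t. c (1 - t)), (\<lambda>t. d (1 - t))) \<in> reduced_equiv \<Sigma>"
  using assms
proof (induction rule: reduced_equiv_induct)
  case (homotopy c d)
  then obtain h :: "real \<times> real \<Rightarrow> 'a" where h:
    "continuous_map (prod_topology (top_of_set {0..1}) (top_of_set {0..1})) (surface_space \<Sigma>) h"
    "\<And>t. h (0, t) = c t" "\<And>t. h (1, t) = d t"
    "\<And>s. s \<in> {0..1} \<Longrightarrow> (\<lambda>t. h (s, t)) \<in> curves \<Sigma> \<and> h (s, 0) = c 0 \<and> h (s, 1) = c 1"
    by (rule curve_homotopyE) blast
  let ?I = "top_of_set {0..1::real}"
  show ?case
  proof (intro curve_homotopy_reduced curve_homotopyI)
    have "continuous_map (prod_topology ?I ?I) (prod_topology ?I ?I) (\<lambda>x::real \<times> real. (fst x, 1 - snd x))"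
      by (auto simp: continuous_map_in_subtopology intro!: continuous_intros)
    from continuous_map_compose[OF this h(1)]
    show "continuous_map (prod_topology ?I ?I) (surface_space \<Sigma>) (\<lambda>x. h (fst x, 1 - snd x))"
      by (simp add: o_def)
  qed (use h reversed_curve in \<open>fastforce+\<close>)
next
  case (crossing c d)
  then obtain a b where ab: "c \<in> curves \<Sigma>" "encloses_one_special \<Sigma> c a b" "d = reverse_loop a b c"
    by (auto simp: crossing_resolution_def)
  then have ab': "0 \<le> a" "a < b" "b \<le> 1" "c a = c b" "inj_on c {a..<b}"
    by (auto simp: encloses_one_special_def)
  let ?c = "\<lambda>t. c (1 - t)"
  have "inj_on ?c {1 - b..<1 - a}"
  proof (rule inj_onI)
    \<comment> \<open>Reversing time exchanges the open and the closed end; \<open>c a = c b\<close>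
      turns injectivity on [a,b) into injectivity on (a,b].\<close>
    have inj: "x = y" if "x \<in> {a<..b}" "y \<in> {a<..b}" "c x = c y" for x y
      using that ab' unfolding inj_on_def
      by (smt (verit) atLeastLessThan_iff greaterThanAtMost_iff)
    fix x y assume "x \<in> {1 - b..<1 - a}" "y \<in> {1 - b..<1 - a}" "?c x = ?c y"
    then show "x = y" using inj[of "1 - x" "1 - y"] by auto
  qed
  moreover have "?c ` {1 - b..1 - a} = c ` {a..b}"
  proof -
    have "?c ` {1 - b..1 - a} = c ` ((-) 1 ` {1 - b..1 - a})"
      by (simp only: image_image)
    then show ?thesis by simp
  qed
  ultimately have "encloses_one_special \<Sigma> ?c (1 - b) (1 - a)"
    using ab(2) unfolding encloses_one_special_def by auto
  moreover have "(\<lambda>t. d (1 - t)) = reverse_loop (1 - b) (1 - a) ?c"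
    using ab by (auto simp: reverse_loop_def fun_eq_iff algebra_simps)
  ultimately show ?case
    using reversed_curve[OF ab(1)]
    by (intro crossing_resolution_reduced) (auto simp: crossing_resolution_def)
qed (auto intro: reduced_equiv_refl reduced_equiv_sym reduced_equiv_trans)

lemma reversed_class_reduced_class:
  "reversed_class (reduced_class \<Sigma> c) = reduced_class \<Sigma> (\<lambda>t. c (1 - t))"
proof -
  have "d \<in> (\<lambda>c t. c (1 - t)) ` reduced_class \<Sigma> c"
    if "(\<lambda>t. c (1 - t), d) \<in> reduced_equiv \<Sigma>" for d
  proof (rule image_eqI)
    show "(\<lambda>t. d (1 - t)) \<in> reduced_class \<Sigma> c"
      using reduced_equiv_reversed[OF that] by (simp add: in_reduced_class_iff)
  qed auto
  then show ?thesis
    using reduced_equiv_reversed by (auto simp: reversed_class_def in_reduced_class_iff)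
qed

section \<open>Turns around a special puncture\<close>

text \<open>The discs that occur in crossing resolutions are closed, hence compact. Over a Hausdorff
  space continuity and injectivity make them embedded, which is why these three conditions are
  recorded.\<close>

definition special_disc :: "'a marked_surface \<Rightarrow> (complex \<Rightarrow> 'a) \<Rightarrow> real \<Rightarrow> bool" where
  "special_disc \<Sigma> \<psi> R \<longleftrightarrow>
     Hausdorff_space (surface_space \<Sigma>) \<and>
     continuous_map (top_of_set (ball 0 R)) (surface_space \<Sigma>) \<psi> \<and> inj_on \<psi> (ball 0 R) \<and>
     \<psi> 0 \<in> special_punctures \<Sigma> \<and>
     (\<forall>z\<in>ball 0 R - {0}. \<psi> z \<notin> marked_points \<Sigma> \<union> special_punctures \<Sigma>)"

lemma special_disc_punctures:
  "special_disc \<Sigma> \<psi> R \<Longrightarrow> z \<in> ball 0 R \<Longrightarrow> z \<noteq> 0 \<Longrightarrow> \<psi> z \<notin> punctures \<Sigma>"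
  by (auto simp: special_disc_def marked_points_def)

lemma exp_in_ball: "exp w \<in> ball 0 R" if "Re w < ln R" "0 < R" for w :: complex
  using that exp_less_mono[of "Re w" "ln R"] by (simp add: norm_exp_eq_Re)

lemma curves_avoiding_patch:
  assumes "e \<in> curves_avoiding \<Sigma> F" "0 \<le> a" "b \<le> 1" "d a = e a" "d b = e b" "a \<le> b"
    and "continuous_map (top_of_set {a..b}) (surface_space \<Sigma>) d"
    and "\<And>t. t \<in> {a..b} \<inter> {0<..<1} \<Longrightarrow> d t \<notin> F"
  shows "patch a b d e \<in> curves_avoiding \<Sigma> F"
proof -
  have "patch a b d e 0 = e 0" "patch a b d e 1 = e 1"
    using assms by (auto simp: patch_def order_antisym_conv)
  moreover have "pathin (surface_space \<Sigma>) (patch a b d e)"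
    using assms by (intro pathin_patch) (auto simp: curves_avoiding_def)
  moreover have "patch a b d e t \<notin> F" if "t \<in> {0<..<1}" for t
    using assms that by (cases "t \<in> {a..b}") (auto simp: curves_avoiding_def patch_def)
  ultimately show ?thesis
    using assms(1) by (simp add: curves_avoiding_def)
qed

text \<open>Logarithms turn the punctured disc into the half-plane Re w < ln R, which is convex, so
  the two logarithms can be joined by straight lines; the centre is never met because exp has no
  zero. That \<open>G\<close> and \<open>G'\<close> agree at both ends says that the two paths turn
  equally often.\<close>

lemma exp_homotopy:
  fixes G G' :: "real \<Rightarrow> complex"
  assumes e: "e \<in> proper_curves \<Sigma>" and ab: "0 \<le> a" "a \<le> b" "b \<le> 1"
    and psi: "continuous_map (top_of_set (ball 0 R)) (surface_space \<Sigma>) \<psi>" "0 < R"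
    and avoid: "\<And>z. z \<in> ball 0 R \<Longrightarrow> z \<noteq> 0 \<Longrightarrow> \<psi> z \<notin> punctures \<Sigma>"
    and G: "continuous_on {a..b} G" "continuous_on {a..b} G'" "G' a = G a" "G' b = G b"
    and ReG: "\<And>t. t \<in> {a..b} \<Longrightarrow> Re (G t) < ln R" "\<And>t. t \<in> {a..b} \<Longrightarrow> Re (G' t) < ln R"
    and e0: "\<And>t. t \<in> {a..b} \<Longrightarrow> e t = \<psi> (exp (G t))"
    and e1: "\<And>t. t \<in> {a..b} \<Longrightarrow> e' t = \<psi> (exp (G' t))"
    and eq: "\<And>t. t \<in> {0..1} - {a..b} \<Longrightarrow> e' t = e t"
  shows "(e, e') \<in> curve_homotopy \<Sigma>"
proof (rule curve_homotopy_patch[OF e ab psi(1), where k = "\<lambda>s t. exp ((1 - s) *\<^sub>R G t + s *\<^sub>R G' t)"])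
  have *: "exp ((1 - s) *\<^sub>R G t + s *\<^sub>R G' t) \<in> ball 0 R" if "s \<in> {0..1}" "t \<in> {a..b}" for s t
  proof (rule exp_in_ball[OF _ psi(2)])
    have "(1 - s) * Re (G t) + s * Re (G' t) < ln R"
      using that ReG[OF that(2)] by (intro convex_bound_lt) auto
    then show "Re ((1 - s) *\<^sub>R G t + s *\<^sub>R G' t) < ln R" by simp
  qed
  show "exp ((1 - s) *\<^sub>R G t + s *\<^sub>R G' t) \<in> ball 0 R" if "s \<in> {0..1}" "t \<in> {a..b}" for s t
    using *[OF that] .
  show "(\<forall>t\<in>{a..b} \<inter> {0<..<1}. \<psi> (exp ((1 - s) *\<^sub>R G t + s *\<^sub>R G' t)) \<notin> punctures \<Sigma>) \<or>
      a = 0 \<and> b = 1 \<and> (\<forall>t\<in>{0..1}. \<psi> (exp ((1 - s) *\<^sub>R G t + s *\<^sub>R G' t)) = \<psi> (exp ((1 - s) *\<^sub>R G 0 + s *\<^sub>R G' 0)))"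
    if "s \<in> {0..1}" for s
    using avoid[OF *[OF that]] by (intro disjI1 ballI) (meson IntD1 exp_not_eq_zero)
  show "continuous_on ({0..1} \<times> {a..b}) (\<lambda>(s, t). exp ((1 - s) *\<^sub>R G t + s *\<^sub>R G' t))"
    unfolding case_prod_unfold
    by (intro continuous_intros continuous_on_compose2[OF G(1)] continuous_on_compose2[OF G(2)]) auto
  show "\<psi> (exp ((1 - s) *\<^sub>R G a + s *\<^sub>R G' a)) = e a \<and> \<psi> (exp ((1 - s) *\<^sub>R G b + s *\<^sub>R G' b)) = e b" for s
    using e0[of a] e0[of b] ab G(3,4) by (simp flip: scaleR_left_distrib)
qed (use e0 e1 eq in auto)

lemma exp_4pi: "exp (z + 4 * of_int k * of_real pi * \<i>) = exp z"
proof -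
  have "exp (z + 4 * of_int k * of_real pi * \<i>) = exp (z + of_int (2 * k) * (of_real 2 * of_real pi * \<i>))"
    by (simp add: algebra_simps)
  then show ?thesis using exp_plus_2pin[of z "2 * k"] by (simp add: algebra_simps)
qed

text \<open>A crossing resolution trades a turn around a special puncture for a turn in the opposite direction,
  so it changes the winding by two turns.\<close>

lemma two_turns_reduced_equiv:
  fixes G G' :: "real \<Rightarrow> complex"
  assumes e: "e \<in> proper_curves \<Sigma>" and ab: "0 \<le> a" "a < b" "b \<le> 1"
    and sd: "special_disc \<Sigma> \<psi> R" and R: "0 < R"
    and G: "continuous_on {a..b} G" "continuous_on {a..b} G'" "G' a = G a" "G' b = G b + 4 * of_real pi * \<i>"
    and ReG: "\<And>t. t \<in> {a..b} \<Longrightarrow> Re (G t) < ln R" "\<And>t. t \<in> {a..b} \<Longrightarrow> Re (G' t) < ln R"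
    and e0: "\<And>t. t \<in> {a..b} \<Longrightarrow> e t = \<psi> (exp (G t))"
    and e1: "\<And>t. t \<in> {a..b} \<Longrightarrow> e' t = \<psi> (exp (G' t))"
    and eq: "\<And>t. t \<in> {0..1} - {a..b} \<Longrightarrow> e' t = e t"
  shows "(e, e') \<in> reduced_equiv \<Sigma>"
proof -
  let ?X = "surface_space \<Sigma>"
  have psi: "continuous_map (top_of_set (ball 0 R)) ?X \<psi>" "inj_on \<psi> (ball 0 R)"
    "\<psi> 0 \<in> special_punctures \<Sigma>" "Hausdorff_space ?X"
    "\<And>z. z \<in> ball 0 R - {0} \<Longrightarrow> \<psi> z \<notin> marked_points \<Sigma> \<union> special_punctures \<Sigma>"
    using sd by (auto simp: special_disc_def)
  have avoid: "\<And>z. z \<in> ball 0 R \<Longrightarrow> z \<noteq> 0 \<Longrightarrow> \<psi> z \<notin> punctures \<Sigma>"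
    using sd by (rule special_disc_punctures)
  define m where "m = (a + b) / 2"
  have m: "a < m" "m < b" using ab by (auto simp: m_def)
  define u w where "u = G a" and "w = G b"
  define \<tau> where "\<tau> = (\<lambda>t. min 1 ((t - a) / (m - a)))"
  define \<sigma> where "\<sigma> = (\<lambda>t. max 0 ((t - m) / (b - m)))"
  have \<tau>: "\<tau> a = 0" "\<And>t. t \<le> m \<Longrightarrow> \<tau> t = (t - a) / (m - a)" "\<And>t. m \<le> t \<Longrightarrow> \<tau> t = 1"
    and \<sigma>: "\<sigma> b = 1" "\<And>t. t \<le> m \<Longrightarrow> \<sigma> t = 0" "\<And>t. t \<in> {a..b} \<Longrightarrow> 0 \<le> \<sigma> t \<and> \<sigma> t \<le> 1"
    using m by (auto simp: \<tau>_def \<sigma>_def field_simps min_def max_def)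
  \<comment> \<open>For j = 1 or -1 the path exp (L j) first runs once around the circle through exp
    u, in the direction given by j, and then follows the image of a segment. The summand 2 pi i
    makes \<open>L (-1)\<close> end at w like \<open>G\<close>, and \<open>L 1\<close> at w + 4 pi i
    like \<open>G'\<close>. After m the two differ by 4 pi i, so they describe the same
    path.\<close>
  define L where "L = (\<lambda>(j::real) t. u + of_real (2 * pi * j * \<tau> t) * \<i> + of_real (\<sigma> t) * (w + 2 * of_real pi * \<i> - u))"
  have contL: "continuous_on {a..b} (L j)" for j
    unfolding L_def \<tau>_def \<sigma>_def by (intro continuous_intros) (use m in auto)
  have La: "L j a = u" for j using \<tau> \<sigma>(2)[of a] m by (simp add: L_def)
  have Lb: "L 1 b = w + 4 * of_real pi * \<i>" "L (-1) b = w"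
    using \<tau>(3)[of b] \<sigma>(1) m by (simp_all add: L_def algebra_simps)
  have uw: "Re u < ln R" "Re w < ln R" using ReG(1)[of a] ReG(1)[of b] ab by (auto simp: u_def w_def)
  have ReL: "Re (L j t) < ln R" if "t \<in> {a..b}" for j t
  proof -
    have "Re (L j t) = (1 - \<sigma> t) * Re u + \<sigma> t * Re w"
      by (simp add: L_def algebra_simps)
    also have "\<dots> < ln R" using uw \<sigma>(3)[OF that] by (intro convex_bound_lt) auto
    finally show ?thesis .
  qed
  define E where "E = (\<lambda>j. patch a b (\<lambda>t. \<psi> (exp (L j t))) e)"
  have E_in: "E j t = \<psi> (exp (L j t))" if "t \<in> {a..b}" for j t
    using that by (simp add: E_def)
  have E_out: "E j t = e t" if "t \<notin> {a..b}" for j t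
    using that unfolding E_def by (rule patch_outside)
  have ce: "(e, E (-1)) \<in> curve_homotopy \<Sigma>"
  proof (rule exp_homotopy[OF e _ _ _ psi(1) R avoid, where G = G and G' = "L (-1)"])
    show "E (-1) t = e t" if "t \<in> {0..1} - {a..b}" for t
      using E_out that by blast
  qed (use ab G contL La Lb ReG ReL e0 E_in in \<open>auto simp: u_def w_def\<close>)
  have e'p: "e' \<in> proper_curves \<Sigma>"
  proof -
    have c: "continuous_map (top_of_set {a..b}) ?X (\<lambda>t. \<psi> (exp (G' t)))"
    proof (rule continuous_map_comp[OF _ psi(1)])
      show "continuous_map (top_of_set {a..b}) (top_of_set (ball 0 R)) (\<lambda>t. exp (G' t))"
        using ReG(2) G(2) exp_in_ball[OF _ R]
        by (auto simp: continuous_map_in_subtopology intro!: continuous_intros)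
    qed
    have "patch a b (\<lambda>t. \<psi> (exp (G' t))) e \<in> proper_curves \<Sigma>"
    proof (rule curves_avoiding_patch[OF e _ _ _ _ _ c])
      show "\<psi> (exp (G' t)) \<notin> punctures \<Sigma>" if "t \<in> {a..b} \<inter> {0<..<1}" for t
        using that by (intro avoid exp_in_ball R ReG) auto
      show "\<psi> (exp (G' b)) = e b"
        using exp_4pi[of "G b" 1] G(4) e0[of b] ab by simp
      show "\<psi> (exp (G' a)) = e a" using G(3) e0[of a] ab by simp
    qed (use ab in auto)
    moreover have "patch a b (\<lambda>t. \<psi> (exp (G' t))) e t = e' t" if "t \<in> {0..1}" for t
      using e1 eq that by (auto simp: patch_def)
    ultimately show ?thesis
      using pathin_cong[of ?X "patch a b (\<lambda>t. \<psi> (exp (G' t))) e" e'] by (simp add: curves_avoiding_def)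
  qed
  have ce': "(e', E 1) \<in> curve_homotopy \<Sigma>"
  proof (rule exp_homotopy[OF e'p _ _ _ psi(1) R avoid, where G = G' and G' = "L 1"])
    show "E 1 t = e' t" if "t \<in> {0..1} - {a..b}" for t
      using E_out eq that by auto
  qed (use ab G contL La Lb ReG ReL e1 E_in in \<open>auto simp: u_def w_def\<close>)
  have E1c: "E 1 \<in> curves \<Sigma>"
    using reduced_equiv_curves[OF curve_homotopy_reduced[OF ce']] e'p proper_curves_subset by auto
  have L1: "L 1 t = u + of_real (2 * pi * ((t - a) / (m - a))) * \<i>" if "t \<in> {a..m}" for t
    using that \<tau>(2) \<sigma>(2) by (simp add: L_def)
  have exp2pi: "exp (z + 2 * of_real pi * \<i>) = exp z" for z :: complex
    using exp_plus_2pin[of z 1] by (simp add: algebra_simps)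
  \<comment> \<open>Up to the period 2 pi i, the circle of \<open>E 1\<close> traversed backwards is
    the circle of \<open>E (-1)\<close>. This is the only resolution that is applied.\<close>
  have "reverse_loop a m (E 1) = E (-1)"
  proof
    fix t
    consider "t \<in> {a..m}" | "t \<in> {m<..b}" | "t \<notin> {a..b}" using m by fastforce
    then show "reverse_loop a m (E 1) t = E (-1) t"
    proof cases
      case 1
      have r: "(a + m - t - a) / (m - a) = 1 - (t - a) / (m - a)"
        using m by (simp add: field_simps)
      have "L 1 (a + m - t) = L (-1) t + 2 * of_real pi * \<i>"
        using 1 L1[of "a + m - t"] \<tau>(2)[of t] \<sigma>(2)[of t] unfolding r by (simp add: L_def algebra_simps)
      then show ?thesis
        using 1 m E_in[of "a + m - t" 1] E_in[of t "-1"] exp2pi[of "L (-1) t"]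
        by (simp add: reverse_loop_def)
    next
      case 2
      have "L 1 t = L (-1) t + 4 * of_int 1 * of_real pi * \<i>"
        using 2 \<tau>(3)[of t] by (simp add: L_def algebra_simps)
      then have "exp (L 1 t) = exp (L (-1) t)" by (simp only: exp_4pi)
      then show ?thesis
        using 2 m E_in[of t 1] E_in[of t "-1"] by (simp add: reverse_loop_def)
    next
      case 3
      then show ?thesis using m E_out[of t] by (auto simp: reverse_loop_def)
    qed
  qed
  moreover have "encloses_one_special \<Sigma> (E 1) a m"
  proof -
    \<comment> \<open>The loop is a round circle of this radius in the disc, so scaling the unit
      disc by \<rho> gives the disc that it bounds.\<close>
    define \<rho> where "\<rho> = exp (Re u)"
    have \<rho>: "0 < \<rho>" "\<rho> < R"
      using uw(1) R by (simp_all add: \<rho>_def) (metis exp_less_mono exp_ln)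
    let ?h = "\<lambda>z. \<psi> (of_real \<rho> * z)"
    have sub: "of_real \<rho> * z \<in> ball 0 R" if "z \<in> cball 0 1" for z :: complex
    proof -
      have "\<rho> * norm z \<le> \<rho> * 1" using that \<rho> by (intro mult_left_mono) auto
      moreover have "norm (of_real \<rho> * z) = \<rho> * norm z" using \<rho> by (simp add: norm_mult)
      ultimately show ?thesis using \<rho> unfolding mem_ball_0 by linarith
    qed
    have inj: "inj_on ?h (cball 0 1)"
    proof (rule inj_onI)
      fix x y :: complex assume "x \<in> cball 0 1" "y \<in> cball 0 1" "?h x = ?h y"
      then have "of_real \<rho> * x = of_real \<rho> * y"
        by (intro inj_onD[OF psi(2)] sub)
      then show "x = y" using \<rho> by simp
    qed
    have emb: "embedding_map (top_of_set (cball 0 1)) ?X ?h"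
    proof (rule continuous_imp_embedding_map)
      show "continuous_map (top_of_set (cball 0 1)) ?X ?h"
        by (rule continuous_map_comp[OF _ psi(1)])
          (use sub in \<open>auto simp: continuous_map_in_subtopology intro!: continuous_intros\<close>)
      show "inj_on ?h (topspace (top_of_set (cball 0 1)))"
        using inj by simp
    qed (use psi in \<open>auto simp: compact_space_subtopology\<close>)
    have form: "E 1 t = ?h (exp (of_real (Im u + 2 * pi * ((t - a) / (m - a))) * \<i>))" if "t \<in> {a..m}" for t
    proof -
      have "exp (L 1 t) = of_real \<rho> * exp (of_real (Im u + 2 * pi * ((t - a) / (m - a))) * \<i>)"
        unfolding L1[OF that] \<rho>_def
        by (subst (2) complex_eq) (simp add: exp_of_real exp_add algebra_simps flip: exp_of_real)
      then show ?thesis using that m E_in[of t 1] by simp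
    qed
    have "E 1 a = E 1 m"
      using form[of a] form[of m] m exp2pi[of "of_real (Im u) * \<i>"] by (simp add: algebra_simps)
    moreover have "inj_on (E 1) {a..<m}"
    proof (rule inj_onI)
      fix x y assume xy: "x \<in> {a..<m}" "y \<in> {a..<m}" "E 1 x = E 1 y"
      have "exp (of_real (Im u + 2 * pi * ((x - a) / (m - a))) * \<i>) = exp (of_real (Im u + 2 * pi * ((y - a) / (m - a))) * \<i>)"
        using xy form[of x] form[of y] by (intro inj_onD[OF inj]) auto
      then obtain n :: int where "of_real (Im u + 2 * pi * ((x - a) / (m - a))) * \<i> =
          of_real (Im u + 2 * pi * ((y - a) / (m - a))) * \<i> + of_real (2 * of_int n * pi) * \<i>"
        unfolding exp_eq by auto
      then have "Im u + 2 * pi * ((x - a) / (m - a)) = Im u + 2 * pi * ((y - a) / (m - a)) + 2 * of_int n * pi"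
        by (metis (no_types, lifting) complex_i_not_zero distrib_right mult_right_cancel of_real_add of_real_eq_iff)
      then have "2 * pi * ((x - a) / (m - a) - (y - a) / (m - a) - of_int n) = 0"
        by (simp add: algebra_simps)
      then have n: "(x - a) / (m - a) - (y - a) / (m - a) = of_int n"
        by simp
      have "0 \<le> (x - a) / (m - a)" "(x - a) / (m - a) < 1" "0 \<le> (y - a) / (m - a)" "(y - a) / (m - a) < 1"
        using xy m by (auto simp: field_simps)
      then have "\<bar>real_of_int n\<bar> < 1" using n by linarith
      then have "n = 0" by linarith
      then have "(x - a) / (m - a) = (y - a) / (m - a)" using n by simp
      then show "x = y" using m by auto
    qed
    moreover have "?h ` sphere 0 1 = E 1 ` {a..m}"
    proof
      show "E 1 ` {a..m} \<subseteq> ?h ` sphere 0 1"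
        using form by auto
      show "?h ` sphere 0 1 \<subseteq> E 1 ` {a..m}"
      proof
        fix x assume "x \<in> ?h ` sphere 0 1"
        then obtain z where z: "norm z = 1" "x = ?h z" by auto
        have "z * exp (- of_real (Im u) * \<i>) \<noteq> 0" using z by auto
        \<comment> \<open>The angle of z as seen from the base point of the loop, rescaled below to
          a time in [a,m].\<close>
        define \<theta> where "\<theta> = Arg2pi (z * exp (- of_real (Im u) * \<i>))"
        have \<theta>: "0 \<le> \<theta>" "\<theta> < 2 * pi" "z * exp (- of_real (Im u) * \<i>) = exp (\<i> * of_real \<theta>)"
          using Arg2pi[of "z * exp (- of_real (Im u) * \<i>)"] z by (auto simp: \<theta>_def norm_mult is_Arg_def)
        define t where "t = a + (m - a) * (\<theta> / (2 * pi))"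
        have "\<theta> / (2 * pi) \<le> 1" using \<theta> by simp
        then have "(m - a) * (\<theta> / (2 * pi)) \<le> (m - a) * 1" using m by (intro mult_left_mono) auto
        then have t: "t \<in> {a..m}" using \<theta> m by (auto simp: t_def)
        have r: "2 * pi * ((t - a) / (m - a)) = \<theta>" using m by (simp add: t_def)
        have "exp (of_real (Im u + \<theta>) * \<i>) = exp (of_real (Im u) * \<i>) * exp (\<i> * of_real \<theta>)"
          by (simp add: exp_add algebra_simps)
        also have "\<dots> = z" unfolding \<theta>(3)[symmetric] by (simp add: exp_minus)
        finally have "E 1 t = x" using form[OF t] z(2) unfolding r by simp
        then show "x \<in> E 1 ` {a..m}" using t by blast
      qed
    qed
    moreover have "?h ` ball 0 1 \<inter> (marked_points \<Sigma> \<union> special_punctures \<Sigma>) = {\<psi> 0}"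
    proof -
      have "z = 0" if "z \<in> ball 0 1" "?h z \<in> marked_points \<Sigma> \<union> special_punctures \<Sigma>" for z
        using that sub[of z] psi(5)[of "of_real \<rho> * z"] \<rho> by force
      then show ?thesis using psi(3) by (force intro: image_eqI[of _ _ 0])
    qed
    ultimately show ?thesis
      unfolding encloses_one_special_def using emb ab m psi(3) by (auto intro!: exI[of _ ?h])
  qed
  ultimately have "(E 1, E (-1)) \<in> crossing_resolution \<Sigma>"
    using E1c unfolding crossing_resolution_def by force
  then show ?thesis
    using ce ce' by (meson crossing_resolution_reduced curve_homotopy_reduced reduced_equiv_sym reduced_equiv_trans)
qed

text \<open>Two turns are split off at a time: \<open>H\<close> spreads a drift of 4 pi i linearly
  over [a,b]. Since exp (4 pi i) = 1 the ends of the path stay put, and since real parts do not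
  change the path stays in the disc.\<close>

lemma even_turns_reduced_equiv_nat:
  fixes G G' :: "real \<Rightarrow> complex"
  assumes "e \<in> proper_curves \<Sigma>" "0 \<le> a" "a < b" "b \<le> 1"
    and "special_disc \<Sigma> \<psi> R" "0 < R"
    and "continuous_on {a..b} G" "continuous_on {a..b} G'" "G' a = G a" "G' b = G b + 4 * of_nat n * of_real pi * \<i>"
    and "\<And>t. t \<in> {a..b} \<Longrightarrow> Re (G t) < ln R" "\<And>t. t \<in> {a..b} \<Longrightarrow> Re (G' t) < ln R"
    and "\<And>t. t \<in> {a..b} \<Longrightarrow> e t = \<psi> (exp (G t))"
    and "\<And>t. t \<in> {a..b} \<Longrightarrow> e' t = \<psi> (exp (G' t))"
    and "\<And>t. t \<in> {0..1} - {a..b} \<Longrightarrow> e' t = e t"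
  shows "(e, e') \<in> reduced_equiv \<Sigma>"
  using assms
proof (induction n arbitrary: e G)
  case 0
  have "(e, e') \<in> curve_homotopy \<Sigma>"
    using "0.prems" special_disc_punctures[OF "0.prems"(5)]
    by (intro exp_homotopy[of e \<Sigma> a b R \<psi> G G']) (auto simp: special_disc_def)
  then show ?case by (rule curve_homotopy_reduced)
next
  case (Suc n)
  note P = Suc.prems
  define H where "H = (\<lambda>t. G t + of_real (4 * pi * ((t - a) / (b - a))) * \<i>)"
  have contH: "continuous_on {a..b} H" unfolding H_def using P(3) by (intro continuous_intros P(7)) auto
  have Ha: "H a = G a" and Hb: "H b = G b + 4 * of_real pi * \<i>" using P(3) by (simp_all add: H_def)
  have ReH: "Re (H t) < ln R" if "t \<in> {a..b}" for t using P(11)[OF that] by (simp add: H_def)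
  define d where "d = patch a b (\<lambda>t. \<psi> (exp (H t))) e"
  have d_in: "d t = \<psi> (exp (H t))" if "t \<in> {a..b}" for t using that by (simp add: d_def)
  have d_out: "d t = e t" if "t \<notin> {a..b}" for t using that unfolding d_def by (rule patch_outside)
  have ed: "(e, d) \<in> reduced_equiv \<Sigma>"
  proof (rule two_turns_reduced_equiv[where a = a and b = b and \<psi> = \<psi> and R = R and G = G and G' = H])
    show "d t = e t" if "t \<in> {0..1} - {a..b}" for t
      using d_out that by blast
  qed (use P d_in contH Ha Hb ReH in auto)
  have "d \<in> proper_curves \<Sigma>"
    unfolding d_def
  proof (rule curves_avoiding_patch[OF P(1)])
    show "continuous_map (top_of_set {a..b}) (surface_space \<Sigma>) (\<lambda>t. \<psi> (exp (H t)))"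
    proof (rule continuous_map_comp[where g = \<psi>])
      show "continuous_map (top_of_set {a..b}) (top_of_set (ball 0 R)) (\<lambda>t. exp (H t))"
        using ReH contH exp_in_ball[OF _ P(6)]
        by (auto simp: continuous_map_in_subtopology intro!: continuous_intros)
      show "continuous_map (top_of_set (ball 0 R)) (surface_space \<Sigma>) \<psi>"
        using P(5) by (simp add: special_disc_def)
    qed
    show "\<psi> (exp (H t)) \<notin> punctures \<Sigma>" if "t \<in> {a..b} \<inter> {0<..<1}" for t
      using that by (intro special_disc_punctures[OF P(5)] exp_in_ball P(6) ReH) auto
    show "\<psi> (exp (H b)) = e b" using exp_4pi[of "G b" 1] Hb P(3,13) by simp
  qed (use P Ha in auto)
  then have "(d, e') \<in> reduced_equiv \<Sigma>"
  proof (rule Suc.IH[where G = H])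
    show "e' t = d t" if "t \<in> {0..1} - {a..b}" for t
      using P(15)[OF that] d_out[of t] that by simp
    show "G' b = H b + 4 * of_nat n * of_real pi * \<i>"
      using P(10) Hb by (simp add: algebra_simps)
  qed (use P d_in contH ReH Ha in auto)
  with ed show ?case by (rule reduced_equiv_trans)
qed

lemma even_turns_reduced_equiv:
  fixes G G' :: "real \<Rightarrow> complex"
  assumes "e \<in> proper_curves \<Sigma>" "e' \<in> proper_curves \<Sigma>" "0 \<le> a" "a < b" "b \<le> 1"
    and "special_disc \<Sigma> \<psi> R" "0 < R"
    and "continuous_on {a..b} G" "continuous_on {a..b} G'" "G' a = G a" "G' b = G b + 4 * of_int k * of_real pi * \<i>"
    and "\<And>t. t \<in> {a..b} \<Longrightarrow> Re (G t) < ln R" "\<And>t. t \<in> {a..b} \<Longrightarrow> Re (G' t) < ln R"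
    and "\<And>t. t \<in> {a..b} \<Longrightarrow> e t = \<psi> (exp (G t))"
    and "\<And>t. t \<in> {a..b} \<Longrightarrow> e' t = \<psi> (exp (G' t))"
    and "\<And>t. t \<in> {0..1} - {a..b} \<Longrightarrow> e' t = e t"
  shows "(e, e') \<in> reduced_equiv \<Sigma>"
proof (cases "0 \<le> k")
  case True
  then show ?thesis
    using assms by (intro even_turns_reduced_equiv_nat[of e \<Sigma> a b \<psi> R G G' "nat k"]) auto
next
  case False
  then have "G b = G' b + 4 * of_nat (nat (- k)) * of_real pi * \<i>"
    using assms by simp
  then have "(e', e) \<in> reduced_equiv \<Sigma>"
    using assms by (intro even_turns_reduced_equiv_nat[of e' \<Sigma> a b \<psi> R G' G "nat (- k)"]) auto
  then show ?thesis by (rule reduced_equiv_sym)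
qed

section \<open>Paths in a chart\<close>

text \<open>The coordinate image is a ball cut by the half-plane: a disc, a half-disc or something
  in between. It is convex in every case, so interior and boundary points can be treated
  together.\<close>

definition disc_chart ::
    "'a topology \<Rightarrow> 'a \<Rightarrow> 'a set \<Rightarrow> ('a \<Rightarrow> complex) \<Rightarrow> (complex \<Rightarrow> 'a) \<Rightarrow> complex \<Rightarrow> real \<Rightarrow> bool" where
  "disc_chart X x U \<phi> g z r \<longleftrightarrow>
     openin X U \<and> x \<in> U \<and> \<phi> x = z \<and> z \<in> half_plane \<and> 0 < r \<and>
     homeomorphic_maps (subtopology X U) (top_of_set (ball z r \<inter> half_plane)) \<phi> g"

lemma disc_chartD:
  assumes "disc_chart X x U \<phi> g z r"
  shows "openin X U" "x \<in> U" "U \<subseteq> topspace X" "z \<in> ball z r \<inter> half_plane" "g z = x" "\<phi> x = z"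
    "continuous_map (top_of_set (ball z r \<inter> half_plane)) X g"
    "\<And>w. w \<in> ball z r \<inter> half_plane \<Longrightarrow> g w \<in> U" "\<And>w. w \<in> ball z r \<inter> half_plane \<Longrightarrow> \<phi> (g w) = w"
    "\<And>y. y \<in> U \<Longrightarrow> \<phi> y \<in> ball z r \<inter> half_plane" "\<And>y. y \<in> U \<Longrightarrow> g (\<phi> y) = y"
    "continuous_map (subtopology X U) euclidean \<phi>"
proof -
  have U: "openin X U" "x \<in> U" "\<phi> x = z" "z \<in> half_plane" "0 < r" "U \<subseteq> topspace X"
    using assms openin_subset by (auto simp: disc_chart_def)
  have h: "continuous_map (subtopology X U) (top_of_set (ball z r \<inter> half_plane)) \<phi>"
    "continuous_map (top_of_set (ball z r \<inter> half_plane)) (subtopology X U) g"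
    "\<And>y. y \<in> topspace (subtopology X U) \<Longrightarrow> g (\<phi> y) = y"
    "\<And>w. w \<in> topspace (top_of_set (ball z r \<inter> half_plane)) \<Longrightarrow> \<phi> (g w) = w"
    using assms by (simp_all add: disc_chart_def homeomorphic_maps_def)
  show "openin X U" "x \<in> U" "U \<subseteq> topspace X" "z \<in> ball z r \<inter> half_plane" "\<phi> x = z"
    using U by auto
  show gp: "g (\<phi> y) = y" if "y \<in> U" for y using h(3) that U(6) by auto
  show "g z = x" using gp[OF U(2)] U(3) by simp
  show "\<phi> (g w) = w" if "w \<in> ball z r \<inter> half_plane" for w using h(4) that by simp
  show "continuous_map (top_of_set (ball z r \<inter> half_plane)) X g"
    using h(2) by (rule continuous_map_into_fulltopology)
  show "g w \<in> U" if "w \<in> ball z r \<inter> half_plane" for w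
    using continuous_map_image_subset_topspace[OF h(2)] that by auto
  show "\<phi> y \<in> ball z r \<inter> half_plane" if "y \<in> U" for y
  proof -
    have "\<phi> y \<in> \<phi> ` topspace (subtopology X U)" using that U(6) by auto
    then show ?thesis
      using continuous_map_image_subset_topspace[OF h(1)] by (metis subsetD topspace_euclidean_subtopology)
  qed
  show "continuous_map (subtopology X U) euclidean \<phi>"
    using h(1) by (rule continuous_map_into_fulltopology)
qed

lemma convex_half_disc: "convex (ball z r \<inter> half_plane)" for z :: complex
  by (intro convex_Int convex_ball convex_halfspace_Im_ge)

lemma disc_chart_exists:
  assumes "surface_chart X V \<phi>" "x \<in> V" "openin X W" "x \<in> W"
  obtains U g r where "disc_chart X x U \<phi> g (\<phi> x) r" "U \<subseteq> W"
proof -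
  have V: "openin X V" "openin (top_of_set half_plane) (\<phi> ` V)" "V \<subseteq> topspace X"
    and hom: "homeomorphic_map (subtopology X V) (top_of_set (\<phi> ` V)) \<phi>"
    using assms(1) openin_subset by (auto simp: surface_chart_def)
  obtain g where g: "homeomorphic_maps (subtopology X V) (top_of_set (\<phi> ` V)) \<phi> g"
    using hom homeomorphic_map_maps by blast
  have gp: "g (\<phi> y) = y" if "y \<in> V" for y
    using g that V(3) by (auto simp: homeomorphic_maps_def)
  have "openin (subtopology X V) (V \<inter> W)"
    using assms(3) by (simp add: openin_subtopology_Int2)
  then have "openin (top_of_set (\<phi> ` V)) (\<phi> ` (V \<inter> W))"
    using homeomorphic_imp_open_map[OF hom] by (auto simp: open_map_def)
  then have "openin (top_of_set half_plane) (\<phi> ` (V \<inter> W))"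
    using V(2) by (rule openin_trans)
  then obtain r where r: "0 < r" "ball (\<phi> x) r \<inter> half_plane \<subseteq> \<phi> ` (V \<inter> W)"
    using assms(2,4) unfolding openin_contains_ball by (meson IntI imageI)
  define C where "C = ball (\<phi> x) r \<inter> half_plane"
  have hp: "\<phi> ` V \<subseteq> half_plane" using openin_imp_subset[OF V(2)] .
  define U where "U = {y \<in> topspace (subtopology X V). \<phi> y \<in> C}"
  have CV: "C \<subseteq> \<phi> ` V" using r by (auto simp: C_def)
  have "openin (top_of_set (\<phi> ` V)) C"
  proof -
    have "C = \<phi> ` V \<inter> ball (\<phi> x) r" using CV hp by (auto simp: C_def)
    then show ?thesis by (simp add: openin_open_Int)
  qed
  then have "openin (subtopology X V) U"
    unfolding U_def using g by (intro openin_continuous_map_preimage) (auto simp: homeomorphic_maps_def)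
  then have U: "openin X U" using V(1) openin_trans_full by blast
  have UV: "U \<subseteq> V" by (auto simp: U_def)
  have xC: "\<phi> x \<in> C" using r(1) hp assms(2) by (auto simp: C_def)
  have "continuous_map (subtopology X U) (top_of_set C) \<phi>"
  proof -
    have "continuous_map (subtopology X V) (top_of_set (\<phi> ` V)) \<phi>" using g by (simp add: homeomorphic_maps_def)
    then have "continuous_map (subtopology X U) euclidean \<phi>"
      using UV continuous_map_from_subtopology_mono continuous_map_into_fulltopology by blast
    then show ?thesis by (auto simp: continuous_map_in_subtopology U_def)
  qed
  moreover have "continuous_map (top_of_set C) (subtopology X U) g"
  proof -
    have g': "continuous_map (top_of_set (\<phi> ` V)) (subtopology X V) g" using g by (simp add: homeomorphic_maps_def)
    then have "continuous_map (top_of_set C) X g"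
      using CV continuous_map_from_subtopology_mono continuous_map_into_fulltopology by blast
    moreover have "g w \<in> U" if w: "w \<in> C" for w
    proof -
      obtain y where y: "y \<in> V" "w = \<phi> y" using CV w by blast
      then show ?thesis using gp[OF y(1)] w V(3) by (auto simp: U_def)
    qed
    ultimately show ?thesis by (auto simp: continuous_map_in_subtopology)
  qed
  moreover have "\<phi> (g w) = w" if "w \<in> C" for w
    using g CV that by (auto simp: homeomorphic_maps_def)
  ultimately have "homeomorphic_maps (subtopology X U) (top_of_set C) \<phi> g"
    using gp UV by (auto simp: homeomorphic_maps_def)
  then have "disc_chart X x U \<phi> g (\<phi> x) r"
    using U xC assms(2) V(3) r(1) by (auto simp: disc_chart_def C_def U_def)
  moreover have "U \<subseteq> W"
  proof
    fix y assume y: "y \<in> U"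
    then have "\<phi> y \<in> \<phi> ` (V \<inter> W)" using r by (auto simp: U_def C_def)
    then obtain y' where "y' \<in> V \<inter> W" "\<phi> y = \<phi> y'" by blast
    then show "y \<in> W" using gp[of y] gp[of y'] y UV by auto
  qed
  ultimately show thesis by (rule that)
qed

lemma disc_chart_path:
  assumes "disc_chart X x U \<phi> g z r" "continuous_map (top_of_set S) X c" "\<And>t. t \<in> S \<Longrightarrow> c t \<in> U"
  shows "continuous_on S (\<lambda>t. \<phi> (c t))"
proof -
  have "continuous_map (top_of_set S) (subtopology X U) c"
    using assms by (auto simp: continuous_map_in_subtopology)
  then have "continuous_map (top_of_set S) euclidean (\<lambda>t. \<phi> (c t))"
    using disc_chartD(12)[OF assms(1)] by (rule continuous_map_comp)
  then show ?thesis by simp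
qed

text \<open>The path makes a detour through a third point w and is straight on both pieces. The
  segment from p to w meets z away from p only if p - z is opposite to w - z in direction. Of three
  directions into the half-plane at most one is excluded by p and at most one by q. The ends p and q
  may be z itself.\<close>

lemma path_avoiding_centre:
  fixes p q z :: complex and a b r :: real
  assumes "z \<in> half_plane" "0 < r" "p \<in> ball z r \<inter> half_plane" "q \<in> ball z r \<inter> half_plane" "a < b"
  obtains d where "continuous_on {a..b} d" "\<And>t. t \<in> {a..b} \<Longrightarrow> d t \<in> ball z r \<inter> half_plane"
    "d a = p" "d b = q" "\<And>t. t \<in> {a<..<b} \<Longrightarrow> d t \<noteq> z"
proof -
  let ?C = "ball z r \<inter> half_plane"
  let ?bad = "\<lambda>p e. \<exists>s>0. p - z = - of_real s * e"
  have uniq: "e = e'" if b: "?bad p e" "?bad p e'" and that: "e \<in> {\<i>, 1 + \<i>, -1 + \<i>}" "e' \<in> {\<i>, 1 + \<i>, -1 + \<i>}" for p e e' :: complex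
  proof -
    obtain s s' where "0 < s" "0 < s'" "p - z = - of_real s * e" "p - z = - of_real s' * e'"
      using b by blast
    then have "of_real s * e = of_real s' * e'" by simp
    then have "s * Re e = s' * Re e'" "s * Im e = s' * Im e'" by (simp_all add: complex_eq_iff)
    then show ?thesis using \<open>0 < s\<close> \<open>0 < s'\<close> that by (auto simp: complex_eq_iff)
  qed
  have ne: "\<i> \<noteq> 1 + \<i>" "\<i> \<noteq> -1 + \<i>" "1 + \<i> \<noteq> -1 + \<i>" by (auto simp: complex_eq_iff)
  obtain e where e: "e \<in> {\<i>, 1 + \<i>, -1 + \<i>}" "\<not> ?bad p e" "\<not> ?bad q e"
    using uniq[of p] uniq[of q] ne by (metis insertCI)
  have eI: "Im e = 1" "norm e \<le> 2" "e \<noteq> 0"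
  proof -
    show "Im e = 1" using e(1) by auto
    have "norm (1 + \<i>) \<le> 2" "norm (-1 + \<i>) \<le> 2"
      using norm_triangle_ineq[of 1 \<i>] norm_triangle_ineq[of "-1" \<i>] by auto
    then show "norm e \<le> 2" using e(1) by auto
  qed (use e(1) in \<open>auto simp: complex_eq_iff\<close>)
  \<comment> \<open>As \<open>norm e \<le> 2\<close>, the factor r / 3 keeps w within distance 2 r /
    3 of z, and \<open>Im e = 1\<close> keeps it in the half-plane.\<close>
  define w where "w = z + of_real (r / 3) * e"
  have w: "w \<in> ?C"
  proof -
    have "norm (of_real (r / 3) * e) \<le> (r / 3) * 2"
      unfolding norm_mult using eI assms(2) by (intro mult_mono) auto
    then show ?thesis using eI assms(1,2) by (auto simp: w_def dist_norm)
  qed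
  define m where "m = (a + b) / 2"
  have m: "a < m" "m < b" using assms(5) by (auto simp: m_def)
  define \<tau> where "\<tau> = (\<lambda>t. min 1 ((t - a) / (m - a)))"
  define \<sigma> where "\<sigma> = (\<lambda>t. max 0 ((t - m) / (b - m)))"
  define d where "d = (\<lambda>t. (1 - \<tau> t) *\<^sub>R p + (\<tau> t - \<sigma> t) *\<^sub>R w + \<sigma> t *\<^sub>R q)"
  have seg: "u *\<^sub>R p' + (1 - u) *\<^sub>R w \<noteq> z" if "\<not> ?bad p' e" "0 \<le> u" "u < 1" for u p'
  proof
    assume eq: "u *\<^sub>R p' + (1 - u) *\<^sub>R w = z"
    have "u \<noteq> 0" using eq assms(2) eI by (auto simp: w_def)
    have "of_real u * (p' - z) = - of_real ((1 - u) * (r / 3)) * e"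
      using eq by (simp add: w_def scaleR_conv_of_real algebra_simps)
    then have "p' - z = - of_real ((1 - u) * (r / 3) / u) * e"
      using \<open>u \<noteq> 0\<close> by (simp add: field_simps)
    moreover have "0 < (1 - u) * (r / 3) / u" using that \<open>u \<noteq> 0\<close> assms(2) by auto
    ultimately show False using that(1) by blast
  qed
  have left: "\<tau> t = (t - a) / (m - a) \<and> \<sigma> t = 0 \<and> 0 \<le> \<tau> t \<and> \<tau> t \<le> 1 \<and> (a < t \<longrightarrow> 0 < \<tau> t)" if "t \<in> {a..m}" for t
    using that m by (auto simp: \<tau>_def \<sigma>_def field_simps)
  have right: "\<tau> t = 1 \<and> \<sigma> t = (t - m) / (b - m) \<and> 0 \<le> \<sigma> t \<and> \<sigma> t \<le> 1 \<and> (t < b \<longrightarrow> \<sigma> t < 1)" if "t \<in> {m..b}" for t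
    using that m by (auto simp: \<tau>_def \<sigma>_def field_simps)
  show thesis
  proof (rule that[of d])
    show "continuous_on {a..b} d"
      unfolding d_def \<tau>_def \<sigma>_def by (intro continuous_intros) (use m in auto)
    show "d a = p" using left[of a] m by (auto simp: d_def)
    show "d b = q" using right[of b] m by (auto simp: d_def)
    show "d t \<in> ?C" if "t \<in> {a..b}" for t
    proof (cases "t \<le> m")
      case True
      then have "d t = (1 - \<tau> t) *\<^sub>R p + \<tau> t *\<^sub>R w" using left[of t] that by (simp add: d_def)
      moreover have "(1 - \<tau> t) *\<^sub>R p + \<tau> t *\<^sub>R w \<in> ?C"
        using left[of t] that True by (intro convexD_alt[OF convex_half_disc assms(3) w]) auto
      ultimately show ?thesis by simp
    next
      case False
      then have "d t = (1 - \<sigma> t) *\<^sub>R w + \<sigma> t *\<^sub>R q" using right[of t] that by (simp add: d_def)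
      moreover have "(1 - \<sigma> t) *\<^sub>R w + \<sigma> t *\<^sub>R q \<in> ?C"
        using right[of t] that False by (intro convexD_alt[OF convex_half_disc w assms(4)]) auto
      ultimately show ?thesis by simp
    qed
    show "d t \<noteq> z" if "t \<in> {a<..<b}" for t
    proof (cases "t \<le> m")
      case True
      then show ?thesis using left[of t] that seg[OF e(2), of "1 - \<tau> t"] by (simp add: d_def)
    next
      case False
      then show ?thesis using right[of t] that seg[OF e(3), of "\<sigma> t"] by (simp add: d_def add.commute)
    qed
  qed
qed

lemma disc_chart_connect:
  fixes a b :: real
  assumes dc: "disc_chart X x U \<phi> g z r" and F: "U \<inter> F \<subseteq> {x}" and uv: "u \<in> U" "v \<in> U" "a < b"
  obtains d where "continuous_map (top_of_set {a..b}) X d" "d a = u" "d b = v"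
    "\<And>t. t \<in> {a..b} \<Longrightarrow> d t \<in> U" "\<And>t. t \<in> {a<..<b} \<Longrightarrow> d t \<notin> F"
proof -
  note D = disc_chartD[OF dc]
  have "z \<in> half_plane" "0 < r" using dc by (auto simp: disc_chart_def)
  then obtain d where d: "continuous_on {a..b} d" "\<And>t. t \<in> {a..b} \<Longrightarrow> d t \<in> ball z r \<inter> half_plane"
    "d a = \<phi> u" "d b = \<phi> v" "\<And>t. t \<in> {a<..<b} \<Longrightarrow> d t \<noteq> z"
    using path_avoiding_centre[OF _ _ D(10)[OF uv(1)] D(10)[OF uv(2)] uv(3)] by metis
  show thesis
  proof (rule that[of "\<lambda>t. g (d t)"])
    show "continuous_map (top_of_set {a..b}) X (\<lambda>t. g (d t))"
    proof (rule continuous_map_comp[OF _ D(7)])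
      show "continuous_map (top_of_set {a..b}) (top_of_set (ball z r \<inter> half_plane)) d"
        using d(1,2) by (auto simp: continuous_map_in_subtopology)
    qed
    show "g (d t) \<notin> F" if "t \<in> {a<..<b}" for t
    proof
      assume "g (d t) \<in> F"
      moreover have dt: "d t \<in> ball z r \<inter> half_plane" by (intro d(2)) (use that in auto)
      ultimately have "g (d t) = x" using F D(8) by blast
      then show False using D(9)[OF dt] D(6) d(5)[OF that] by simp
    qed
  qed (use d D uv in auto)
qed

text \<open>A path that leaves z may wind around z infinitely often as t tends to 0, so no logarithm
  is available up to its start. Here it is straightened instead: for t > 0 the point
  \<open>k s t\<close> lies on the ray from z through some \<alpha> t' with t' \<ge> t, so it is z
  only if \<alpha> returns to z at such a time t'.\<close>

lemma shrink_path:
  fixes \<alpha> :: "real \<Rightarrow> complex"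
  assumes cont: "continuous_on {0..b} \<alpha>" and b: "0 < b" and \<alpha>0: "\<alpha> 0 = z"
    and C: "convex C" "\<And>t. t \<in> {0..b} \<Longrightarrow> \<alpha> t \<in> C"
  obtains k :: "real \<Rightarrow> real \<Rightarrow> complex" where "continuous_on ({0..1} \<times> {0..b}) (\<lambda>(s, t). k s t)"
    "\<And>s t. s \<in> {0..1} \<Longrightarrow> t \<in> {0..b} \<Longrightarrow> k s t \<in> C"
    "\<And>t. t \<in> {0..b} \<Longrightarrow> k 0 t = \<alpha> t" "\<And>t. t \<in> {0..b} \<Longrightarrow> k 1 t = z + of_real (t / b) * (\<alpha> b - z)"
    "\<And>s. s \<in> {0..1} \<Longrightarrow> k s 0 = z" "\<And>s. s \<in> {0..1} \<Longrightarrow> k s b = \<alpha> b"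
    "\<And>s t. s \<in> {0..1} \<Longrightarrow> t \<in> {0<..b} \<Longrightarrow> \<forall>t'\<in>{t..b}. \<alpha> t' \<noteq> z \<Longrightarrow> k s t \<noteq> z"
proof -
  define M where "M = (\<lambda>s t. max t (s * b))"
  \<comment> \<open>At stage s the piece over [0, s b] is replaced by the segment from z to \<alpha>
    (s b), and later times are left alone. Where M = 0 the value is z; continuity there holds
    because the quotient stays in [0,1] while \<alpha> tends to z.\<close>
  define k where "k = (\<lambda>s t. z + of_real (t / M s t) * (\<alpha> (M s t) - z))"
  have M: "M s t \<in> {0..b}" "t \<le> M s t" if "s \<in> {0..1}" "t \<in> {0..b}" for s t
    using that b by (auto simp: M_def mult_left_le_one_le)
  let ?D = "{0..1} \<times> {0..b}"
  have contM: "continuous_on ?D (\<lambda>x. M (fst x) (snd x))"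
    unfolding M_def by (intro continuous_intros)
  have cont\<alpha>: "continuous_on ?D (\<lambda>x. \<alpha> (M (fst x) (snd x)) - z)"
    by (intro continuous_intros continuous_on_compose2[OF cont contM]) (use M in auto)
  have "continuous_on ?D (\<lambda>x. of_real (snd x / M (fst x) (snd x)) * (\<alpha> (M (fst x) (snd x)) - z))"
    (is "continuous_on ?D ?h")
    unfolding continuous_on_eq_continuous_within
  proof
    fix x assume x: "x \<in> ?D"
    show "continuous (at x within ?D) ?h"
    proof (cases "M (fst x) (snd x) = 0")
      case False
      have c: "continuous (at x within ?D) (\<lambda>x. M (fst x) (snd x))"
        "continuous (at x within ?D) (\<lambda>x. \<alpha> (M (fst x) (snd x)) - z)"
        using contM cont\<alpha> x unfolding continuous_on_eq_continuous_within by blast+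
      have "continuous (at x within ?D) (\<lambda>x. of_real (snd x / M (fst x) (snd x)) :: complex)"
        using c(1) False by (intro continuous_intros) auto
      then show ?thesis using c(2) by (rule continuous_mult)
    next
      case True
      have h0: "?h x = 0" using True by simp
      have "((\<lambda>x. \<alpha> (M (fst x) (snd x)) - z) \<longlongrightarrow> \<alpha> (M (fst x) (snd x)) - z) (at x within ?D)"
        using cont\<alpha> x unfolding continuous_on_def by blast
      then have lim: "((\<lambda>x. \<alpha> (M (fst x) (snd x)) - z) \<longlongrightarrow> 0) (at x within ?D)"
        using True \<alpha>0 by simp
      have "(?h \<longlongrightarrow> 0) (at x within ?D)"
      proof (rule Lim_null_comparison)
        show "((\<lambda>x. norm (\<alpha> (M (fst x) (snd x)) - z)) \<longlongrightarrow> 0) (at x within ?D)"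
          using lim by (rule tendsto_norm_zero)
        have "norm (?h y) \<le> norm (\<alpha> (M (fst y) (snd y)) - z)" if "y \<in> ?D" for y
        proof -
          have "0 \<le> snd y / M (fst y) (snd y)" "snd y / M (fst y) (snd y) \<le> 1"
            using M[of "fst y" "snd y"] that by (auto simp: divide_le_eq_1)
          then show ?thesis
            unfolding norm_mult norm_of_real by (simp only: abs_of_nonneg mult_left_le_one_le norm_ge_zero)
        qed
        then show "\<forall>\<^sub>F y in at x within ?D. norm (?h y) \<le> norm (\<alpha> (M (fst y) (snd y)) - z)"
          by (auto simp: eventually_at_filter)
      qed
      then show ?thesis unfolding continuous_within h0 .
    qed
  qed
  then have contk: "continuous_on ?D (\<lambda>(s, t). k s t)"
    unfolding k_def case_prod_unfold by (rule continuous_on_add[OF continuous_on_const])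
  show thesis
  proof (rule that[of k, OF contk])
    show "k s t \<in> C" if "s \<in> {0..1}" "t \<in> {0..b}" for s t
    proof -
      define q where "q = t / M s t"
      have q: "0 \<le> q" "q \<le> 1" using M[OF that] that by (auto simp: q_def divide_le_eq_1)
      have "(1 - q) *\<^sub>R z + q *\<^sub>R \<alpha> (M s t) \<in> C"
        using C q M[OF that] b \<alpha>0 C(2)[of 0] by (intro convexD_alt) auto
      moreover have "k s t = z + of_real q * (\<alpha> (M s t) - z)"
        by (simp only: k_def q_def)
      moreover have "z + of_real q * (\<alpha> (M s t) - z) = (1 - q) *\<^sub>R z + q *\<^sub>R \<alpha> (M s t)"
        by (simp add: scaleR_conv_of_real algebra_simps)
      ultimately show ?thesis by (simp only:)
    qed
    show "k 0 t = \<alpha> t" if "t \<in> {0..b}" for t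
      using that \<alpha>0 by (cases "t = 0") (auto simp: k_def M_def)
    show "k 1 t = z + of_real (t / b) * (\<alpha> b - z)" if "t \<in> {0..b}" for t
      using that by (simp add: k_def M_def max_absorb2)
    show "k s 0 = z" for s by (simp add: k_def)
    show "k s b = \<alpha> b" if "s \<in> {0..1}" for s
    proof -
      have "M s b = b" using that b by (simp add: M_def max_absorb1 mult_left_le_one_le)
      then show ?thesis using b by (simp add: k_def)
    qed
    show "k s t \<noteq> z" if "s \<in> {0..1}" "t \<in> {0<..b}" "\<forall>t'\<in>{t..b}. \<alpha> t' \<noteq> z" for s t
      using M[of s t] that(1,2) bspec[OF that(3), of "M s t"] by (auto simp: k_def)
  qed
qed

text \<open>Around a boundary point there is no winding: division by i turns the half-plane into Re
  \<ge> 0, where the principal logarithm is continuous off 0 and has imaginary part between - pi / 2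
  and pi / 2. Together with the bound on the real part this is a convex condition, so logarithms can
  be joined by straight lines.\<close>

lemma half_disc_homotopy:
  fixes \<alpha> \<beta> :: "real \<Rightarrow> complex"
  assumes z: "Im z = 0" and r: "0 < r"
    and cont: "continuous_on {a..b} \<alpha>" "continuous_on {a..b} \<beta>"
    and C: "\<And>t. t \<in> {a..b} \<Longrightarrow> \<alpha> t \<in> ball z r \<inter> half_plane - {z}"
      "\<And>t. t \<in> {a..b} \<Longrightarrow> \<beta> t \<in> ball z r \<inter> half_plane - {z}"
  obtains k :: "real \<Rightarrow> real \<Rightarrow> complex" where "continuous_on ({0..1} \<times> {a..b}) (\<lambda>(s, t). k s t)"
    "\<And>s t. s \<in> {0..1} \<Longrightarrow> t \<in> {a..b} \<Longrightarrow> k s t \<in> ball z r \<inter> half_plane - {z}"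
    "\<And>t. t \<in> {a..b} \<Longrightarrow> k 0 t = \<alpha> t" "\<And>t. t \<in> {a..b} \<Longrightarrow> k 1 t = \<beta> t"
    "\<And>s t. t \<in> {a..b} \<Longrightarrow> \<alpha> t = \<beta> t \<Longrightarrow> k s t = \<alpha> t"
proof -
  have Lnw: "exp (Ln w) = w" "\<bar>Im (Ln w)\<bar> \<le> pi / 2" "Re (Ln w) < ln r"
    if "w \<noteq> 0" "0 \<le> Re w" "norm w < r" for w :: complex
    using that r Re_Ln_pos_le[of w] by simp_all
  define A where "A = (\<lambda>(\<gamma> :: real \<Rightarrow> complex) t. Ln ((\<gamma> t - z) / \<i>))"
  have key: "continuous_on {a..b} (A \<gamma>) \<and> (\<forall>t\<in>{a..b}. exp (A \<gamma> t) = (\<gamma> t - z) / \<i> \<and>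
      \<bar>Im (A \<gamma> t)\<bar> \<le> pi / 2 \<and> Re (A \<gamma> t) < ln r)"
    if g: "continuous_on {a..b} \<gamma>" "\<And>t. t \<in> {a..b} \<Longrightarrow> \<gamma> t \<in> ball z r \<inter> half_plane - {z}" for \<gamma>
  proof -
    have n: "(\<gamma> t - z) / \<i> \<notin> \<real>\<^sub>\<le>\<^sub>0" "(\<gamma> t - z) / \<i> \<noteq> 0" "0 \<le> Re ((\<gamma> t - z) / \<i>)" "norm ((\<gamma> t - z) / \<i>) < r"
      if "t \<in> {a..b}" for t
    proof -
      have t: "\<gamma> t \<noteq> z" "0 \<le> Im (\<gamma> t)" "dist z (\<gamma> t) < r" using g(2)[OF that] by auto
      show "(\<gamma> t - z) / \<i> \<noteq> 0" using t by simp
      show "0 \<le> Re ((\<gamma> t - z) / \<i>)" using t z by (simp add: Re_divide)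
      show "norm ((\<gamma> t - z) / \<i>) < r"
        unfolding norm_divide norm_ii div_by_1 using t(3) by (simp add: dist_norm norm_minus_commute)
      show "(\<gamma> t - z) / \<i> \<notin> \<real>\<^sub>\<le>\<^sub>0"
        using t z by (auto simp: complex_nonpos_Reals_iff complex_eq_iff)
    qed
    have "continuous_on {a..b} (A \<gamma>)"
      unfolding A_def by (intro continuous_intros g(1)) (use n in auto)
    moreover have "exp (A \<gamma> t) = (\<gamma> t - z) / \<i> \<and> \<bar>Im (A \<gamma> t)\<bar> \<le> pi / 2 \<and> Re (A \<gamma> t) < ln r"
      if "t \<in> {a..b}" for t
      unfolding A_def using n[OF that] by (intro conjI Lnw)
    ultimately show ?thesis by blast
  qed
  define k where "k = (\<lambda>s t. z + \<i> * exp ((1 - s) *\<^sub>R A \<alpha> t + s *\<^sub>R A \<beta> t))"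
  have e: "z + \<i> * exp (A \<gamma> t) = \<gamma> t" if "exp (A \<gamma> t) = (\<gamma> t - z) / \<i>" for \<gamma> t
    unfolding that by simp
  show thesis
  proof (rule that[of k])
    show "continuous_on ({0..1} \<times> {a..b}) (\<lambda>(s, t). k s t)"
    proof -
      have "continuous_on ({0..1} \<times> {a..b}) (\<lambda>x. A \<gamma> (snd x))" if "continuous_on {a..b} (A \<gamma>)" for \<gamma>
        by (rule continuous_on_compose2[OF that]) (auto intro: continuous_intros)
      then show ?thesis
        unfolding k_def case_prod_unfold using key[OF cont(1) C(1)] key[OF cont(2) C(2)]
        by (intro continuous_intros) auto
    qed
    show "k s t \<in> ball z r \<inter> half_plane - {z}" if "s \<in> {0..1}" "t \<in> {a..b}" for s t
    proof -
      define w where "w = (1 - s) *\<^sub>R A \<alpha> t + s *\<^sub>R A \<beta> t"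
      have ab: "\<bar>Im (A \<alpha> t)\<bar> \<le> pi / 2" "Re (A \<alpha> t) < ln r" "\<bar>Im (A \<beta> t)\<bar> \<le> pi / 2" "Re (A \<beta> t) < ln r"
        using key[OF cont(1) C(1)] key[OF cont(2) C(2)] that by auto
      have "(1 - s) * Re (A \<alpha> t) + s * Re (A \<beta> t) < ln r"
        using ab that by (intro convex_bound_lt) auto
      then have R: "Re w < ln r" by (simp add: w_def)
      have "\<bar>(1 - s) * Im (A \<alpha> t) + s * Im (A \<beta> t)\<bar> \<le> (1 - s) * \<bar>Im (A \<alpha> t)\<bar> + s * \<bar>Im (A \<beta> t)\<bar>"
        using that abs_triangle_ineq[of "(1 - s) * Im (A \<alpha> t)" "s * Im (A \<beta> t)"] by (simp add: abs_mult)
      also have "\<dots> \<le> pi / 2"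
        using ab that by (intro convex_bound_le) auto
      finally have I: "\<bar>Im w\<bar> \<le> pi / 2" by (simp add: w_def)
      have "0 \<le> cos (Im w)" using I by (intro cos_ge_zero) auto
      moreover have "norm (exp w) < r" using exp_in_ball[OF R r] by simp
      ultimately show ?thesis
        using z by (simp add: k_def w_def[symmetric] dist_norm norm_mult Re_exp)
    qed
    show "k 0 t = \<alpha> t" if "t \<in> {a..b}" for t
      using e[of \<alpha> t] key[OF cont(1) C(1)] that by (simp add: k_def)
    show "k 1 t = \<beta> t" if "t \<in> {a..b}" for t
      using e[of \<beta> t] key[OF cont(2) C(2)] that by (simp add: k_def)
    show "k s t = \<alpha> t" if "t \<in> {a..b}" "\<alpha> t = \<beta> t" for s t
    proof -
      have "A \<beta> t = A \<alpha> t" using that by (simp add: A_def)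
      then have "k s t = z + \<i> * exp (A \<alpha> t)" by (simp add: k_def flip: scaleR_left_distrib)
      then show ?thesis using e[of \<alpha> t] key[OF cont(1) C(1)] that by simp
    qed
  qed
qed

section \<open>Images of generic curves\<close>

text \<open>What is used of a marked surface; polygons have these properties too.\<close>

definition tame_surface :: "'a marked_surface \<Rightarrow> bool" where
  "tame_surface \<Sigma> \<longleftrightarrow>
     (let X = surface_space \<Sigma> in
       Hausdorff_space X \<and> compact_space X \<and> finite (marked_points \<Sigma>) \<and> finite (special_punctures \<Sigma>) \<and>
       marked_points \<Sigma> \<union> special_punctures \<Sigma> \<subseteq> topspace X \<and>
       marked_points \<Sigma> \<inter> special_punctures \<Sigma> = {} \<and>
       boundary_marked \<Sigma> \<subseteq> surface_boundary X \<and>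
       (\<forall>x\<in>topspace X. \<exists>V \<phi>. surface_chart X V \<phi> \<and> x \<in> V))"

lemma is_marked_surface_tame:
  assumes "is_marked_surface \<Sigma>"
  shows "tame_surface \<Sigma>"
proof -
  let ?X = "surface_space \<Sigma>"
  have a: "smooth_surface ?X" "compact_space ?X" "finite (marked_points \<Sigma>)" "finite (special_punctures \<Sigma>)"
    "boundary_marked \<Sigma> \<subseteq> surface_boundary ?X"
    "ordinary_punctures \<Sigma> \<subseteq> topspace ?X" "special_punctures \<Sigma> \<subseteq> topspace ?X"
    "marked_points \<Sigma> \<inter> special_punctures \<Sigma> = {}"
    using assms unfolding is_marked_surface_def Let_def by auto
  obtain \<A> where "smooth_atlas ?X \<A>" using a(1) by (auto simp: smooth_surface_def)
  then have charts: "\<forall>p\<in>\<A>. case p of (U, \<phi>) \<Rightarrow> surface_chart ?X U \<phi>"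
      and cover: "(\<Union>p\<in>\<A>. case p of (U, \<phi>) \<Rightarrow> U) = topspace ?X"
    unfolding smooth_atlas_def by (rule conjunct1, rule conjunct1[OF conjunct2])
  have "\<forall>x\<in>topspace ?X. \<exists>V \<phi>. surface_chart ?X V \<phi> \<and> x \<in> V"
  proof
    fix x assume "x \<in> topspace ?X"
    then obtain p where p: "p \<in> \<A>" "x \<in> (case p of (U, \<phi>) \<Rightarrow> U)" using cover by blast
    obtain U \<phi> where "p = (U, \<phi>)" by (cases p)
    then show "\<exists>V \<phi>. surface_chart ?X V \<phi> \<and> x \<in> V"
      using p bspec[OF charts p(1)] by auto
  qed
  moreover have "boundary_marked \<Sigma> \<subseteq> topspace ?X"
  proof
    fix x assume "x \<in> boundary_marked \<Sigma>"
    then obtain U \<phi> where "surface_chart ?X U \<phi>" "x \<in> U"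
      using a(5) unfolding surface_boundary_def by blast
    then show "x \<in> topspace ?X"
      using openin_subset unfolding surface_chart_def by blast
  qed
  then have "marked_points \<Sigma> \<union> special_punctures \<Sigma> \<subseteq> topspace ?X"
    using a(6,7) by (auto simp: marked_points_def)
  moreover have "Hausdorff_space ?X" using a(1) by (simp add: smooth_surface_def)
  ultimately show ?thesis
    using a(2-5,8) unfolding tame_surface_def Let_def by (simp only: simp_thms)
qed

text \<open>Instantiated with f, with the identity of a surface, and with the morphisms from a
  polygon.\<close>

locale tame_morphism =
  fixes \<Sigma> :: "'a marked_surface" and \<Sigma>' :: "'b marked_surface" and f :: "'a \<Rightarrow> 'b"
  assumes tame: "tame_surface \<Sigma>" "tame_surface \<Sigma>'"
    and morphism: "surface_morphism \<Sigma> \<Sigma>' f"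
begin

abbreviation X where "X \<equiv> surface_space \<Sigma>"
abbreviation Y where "Y \<equiv> surface_space \<Sigma>'"

text \<open>Beyond the punctures of \<Sigma>, these are the branch points and the boundary marked
  points that f sends to ordinary punctures, because only marked points go to marked points.\<close>

definition obstacles :: "'a set" where
  "obstacles = punctures \<Sigma> \<union> {x \<in> topspace X. f x \<in> punctures \<Sigma>'}"

abbreviation generic_curves :: "(real \<Rightarrow> 'a) set" where
  "generic_curves \<equiv> curves_avoiding \<Sigma> obstacles"

definition same_image :: "(real \<Rightarrow> 'a) \<Rightarrow> (real \<Rightarrow> 'a) \<Rightarrow> bool" where
  "same_image c d \<longleftrightarrow> (f \<circ> c, f \<circ> d) \<in> reduced_equiv \<Sigma>'"

lemma same_image_trans: "same_image c d \<Longrightarrow> same_image d e \<Longrightarrow> same_image c e"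
  unfolding same_image_def by (rule reduced_equiv_trans)

lemma same_image_sym: "same_image c d \<Longrightarrow> same_image d c"
  unfolding same_image_def by (rule reduced_equiv_sym)

lemma tame_source: "Hausdorff_space X" "compact_space X" "finite (marked_points \<Sigma>)"
    "finite (special_punctures \<Sigma>)" "marked_points \<Sigma> \<subseteq> topspace X" "special_punctures \<Sigma> \<subseteq> topspace X"
    "marked_points \<Sigma> \<inter> special_punctures \<Sigma> = {}" "boundary_marked \<Sigma> \<subseteq> surface_boundary X"
    "\<And>x. x \<in> topspace X \<Longrightarrow> \<exists>V \<phi>. surface_chart X V \<phi> \<and> x \<in> V"
  using tame(1) unfolding tame_surface_def Let_def by auto

lemma tame_target: "Hausdorff_space Y" "finite (marked_points \<Sigma>')" "finite (special_punctures \<Sigma>')"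
    "marked_points \<Sigma>' \<subseteq> topspace Y" "special_punctures \<Sigma>' \<subseteq> topspace Y"
    "marked_points \<Sigma>' \<inter> special_punctures \<Sigma>' = {}"
  using tame(2) unfolding tame_surface_def Let_def by auto

lemma continuous_f: "continuous_map X Y f"
  and fibre_discrete: "y \<in> topspace Y \<Longrightarrow>
    subtopology X {x \<in> topspace X. f x = y} = discrete_topology {x \<in> topspace X. f x = y}"
  and marked_preimage: "{x \<in> topspace X. f x \<in> marked_points \<Sigma>'} = marked_points \<Sigma>"
  and special_image: "f ` special_punctures \<Sigma> \<subseteq> special_punctures \<Sigma>'"
  and locally_injective: "p \<in> topspace X - branch_points \<Sigma> \<Sigma>' f \<Longrightarrow> \<exists>U. openin X U \<and> p \<in> U \<and> inj_on f U"
  and ramified: "p \<in> branch_points \<Sigma> \<Sigma>' f \<Longrightarrow> ramified_double_cover_at X Y f p"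
  using morphism unfolding surface_morphism_def Let_def by auto

text \<open>A fibre is discrete and closed in a compact space, hence finite.\<close>

lemma finite_preimage:
  assumes "finite S"
  shows "finite {x \<in> topspace X. f x \<in> S}"
proof -
  have "finite {x \<in> topspace X. f x = y}" for y
  proof (cases "y \<in> topspace Y")
    case True
    then have "closedin X {x \<in> topspace X. f x \<in> {y}}"
      by (intro closedin_continuous_map_preimage[OF continuous_f] closedin_Hausdorff_singleton tame_target)
    then have "compact_space (subtopology X {x \<in> topspace X. f x = y})"
      using tame_source(2) closedin_compact_space compact_space_subtopology by fastforce
    then show ?thesis
      using fibre_discrete[OF True] by (simp add: compact_space_discrete_topology)
  next
    case False
    then have "{x \<in> topspace X. f x = y} = {}"
      using continuous_map_image_subset_topspace[OF continuous_f] by auto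
    then show ?thesis by (metis finite.emptyI)
  qed
  moreover have "{x \<in> topspace X. f x \<in> S} = (\<Union>y\<in>S. {x \<in> topspace X. f x = y})" by auto
  ultimately show ?thesis using assms by simp
qed

lemma finite_punctures: "finite (punctures \<Sigma>)" "finite (punctures \<Sigma>')"
  using tame_source tame_target by (auto simp: marked_points_def)

lemma finite_obstacles: "finite obstacles"
  unfolding obstacles_def using finite_punctures finite_preimage by blast

lemma obstacles_subset: "obstacles \<subseteq> topspace X"
  using tame_source by (auto simp: obstacles_def marked_points_def)

lemma generic_proper: "c \<in> generic_curves \<Longrightarrow> c \<in> proper_curves \<Sigma>"
  by (auto simp: curves_avoiding_def obstacles_def)

lemma pathin_topspace: "pathin X c \<Longrightarrow> t \<in> {0..1} \<Longrightarrow> c t \<in> topspace X"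
  unfolding pathin_def using continuous_map_image_subset_topspace by fastforce

lemma generic_image:
  assumes "c \<in> generic_curves"
  shows "f \<circ> c \<in> proper_curves \<Sigma>'"
proof -
  have c: "pathin X c" "c 0 \<in> marked_points \<Sigma>" "c 1 \<in> marked_points \<Sigma>" "\<And>t. t \<in> {0<..<1} \<Longrightarrow> c t \<notin> obstacles"
    using assms by (auto simp: curves_avoiding_def)
  have "pathin Y (f \<circ> c)"
    using c(1) continuous_f by (rule pathin_compose)
  moreover have "f (c 0) \<in> marked_points \<Sigma>'" "f (c 1) \<in> marked_points \<Sigma>'"
    using c(2,3) marked_preimage by auto
  moreover have "f (c t) \<notin> punctures \<Sigma>'" if "t \<in> {0<..<1}" for t
    using c(4)[OF that] pathin_topspace[OF c(1), of t] that unfolding obstacles_def by auto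
  ultimately show ?thesis by (simp add: curves_avoiding_def)
qed

text \<open>At a boundary marked point the chart is built from the one that witnesses membership in
  \<open>surface_boundary\<close>, from which Im z = 0 is read off.\<close>

lemma chart_at:
  assumes F: "finite F" "F \<subseteq> topspace X" and "x \<in> topspace X" "openin X W" "x \<in> W"
  obtains U \<phi> g z r where "disc_chart X x U \<phi> g z r" "U \<subseteq> W" "U \<inter> F \<subseteq> {x}"
    "x \<in> boundary_marked \<Sigma> \<Longrightarrow> Im z = 0"
proof -
  have "closedin X (F - {x})"
    using F Hausdorff_imp_t1_space[OF tame_source(1)]
    by (meson Diff_subset finite_Diff order_trans t1_space_closedin_finite)
  then have W': "openin X (W - (F - {x}))"
    using assms(4) by (simp add: openin_diff)
  obtain V \<phi> where V: "surface_chart X V \<phi>" "x \<in> V" "x \<in> boundary_marked \<Sigma> \<Longrightarrow> Im (\<phi> x) = 0"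
    using tame_source(9)[OF assms(3)] tame_source(8) unfolding surface_boundary_def by blast
  obtain U g r where U: "disc_chart X x U \<phi> g (\<phi> x) r" "U \<subseteq> W - (F - {x})"
    using disc_chart_exists[OF V(1,2) W'] assms(5) by blast
  show thesis
    by (rule that[OF U(1)]) (use U V in auto)
qed

section \<open>Local comparison of the images of generic curves\<close>

lemma same_image_patch:
  fixes k :: "real \<Rightarrow> real \<Rightarrow> complex"
  assumes dc: "disc_chart X x U \<phi> g z r"
    and e: "e \<in> generic_curves" and ab: "0 \<le> a" "a \<le> b" "b \<le> 1"
    and eU: "\<And>t. t \<in> {a..b} \<Longrightarrow> e t \<in> U \<and> e' t \<in> U"
    and eq: "\<And>t. t \<in> {0..1} - {a..b} \<Longrightarrow> e' t = e t"
    and k: "continuous_on ({0..1} \<times> {a..b}) (\<lambda>(s, t). k s t)"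
      "\<And>s t. s \<in> {0..1} \<Longrightarrow> t \<in> {a..b} \<Longrightarrow> k s t \<in> ball z r \<inter> half_plane"
      "\<And>t. t \<in> {a..b} \<Longrightarrow> k 0 t = \<phi> (e t)" "\<And>t. t \<in> {a..b} \<Longrightarrow> k 1 t = \<phi> (e' t)"
      "\<And>s. s \<in> {0..1} \<Longrightarrow> k s a = \<phi> (e a)" "\<And>s. s \<in> {0..1} \<Longrightarrow> k s b = \<phi> (e b)"
    and avoid: "\<And>s t. s \<in> {0..1} \<Longrightarrow> t \<in> {a..b} \<inter> {0<..<1} \<Longrightarrow> g (k s t) \<notin> obstacles"
  shows "same_image e e'"
proof -
  note D = disc_chartD[OF dc]
  \<comment> \<open>The homotopy lives in a chart of the source and misses the obstacles at inner
    times, so f carries it to a homotopy of curves in \<Sigma>'.\<close>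
  have "(f \<circ> e, f \<circ> e') \<in> curve_homotopy \<Sigma>'"
  proof (rule curve_homotopy_patch[OF generic_image[OF e] ab _ k(1,2), where g = "\<lambda>w. f (g w)"])
    show "continuous_map (top_of_set (ball z r \<inter> half_plane)) Y (\<lambda>w. f (g w))"
      using D(7) continuous_f by (rule continuous_map_comp)
    show "(\<forall>t\<in>{a..b} \<inter> {0<..<1}. f (g (k s t)) \<notin> punctures \<Sigma>') \<or>
        a = 0 \<and> b = 1 \<and> (\<forall>t\<in>{0..1}. f (g (k s t)) = f (g (k s 0)))" if s: "s \<in> {0..1}" for s
    proof (intro disjI1 ballI)
      fix t assume t: "t \<in> {a..b} \<inter> {0<..<1}"
      then have "g (k s t) \<in> topspace X" using D(3) D(8)[OF k(2)[OF s]] by auto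
      then show "f (g (k s t)) \<notin> punctures \<Sigma>'"
        using avoid[OF s t] by (auto simp: obstacles_def)
    qed
  qed (use k eU D eq ab in auto)
  then show ?thesis unfolding same_image_def by (rule curve_homotopy_reduced)
qed

lemma path_restrict:
  assumes "pathin X e" "0 \<le> a" "b \<le> 1"
  shows "continuous_map (top_of_set {a..b}) X e"
  using assms unfolding pathin_def by (metis atLeastatMost_subset_iff continuous_map_from_subtopology_mono)

lemma same_image_straight:
  assumes dc: "disc_chart X x U \<phi> g z r" and U: "U \<inter> obstacles = {}"
    and e: "e \<in> generic_curves" "e' \<in> generic_curves" and ab: "0 \<le> a" "a < b" "b \<le> 1"
    and eU: "\<And>t. t \<in> {a..b} \<Longrightarrow> e t \<in> U \<and> e' t \<in> U"
    and eq: "\<And>t. t \<in> {0..1} - {a<..<b} \<Longrightarrow> e' t = e t"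
  shows "same_image e e'"
proof (rule same_image_patch[OF dc e(1) ab(1) _ ab(3) eU, where k = "\<lambda>s t. (1 - s) *\<^sub>R \<phi> (e t) + s *\<^sub>R \<phi> (e' t)"])
  note D = disc_chartD[OF dc]
  have p: "pathin X e" "pathin X e'" using e by (auto simp: curves_avoiding_def)
  have c: "continuous_on {a..b} (\<lambda>t. \<phi> (e t))" "continuous_on {a..b} (\<lambda>t. \<phi> (e' t))"
    using disc_chart_path[OF dc path_restrict] p ab eU by blast+
  have "continuous_on ({0..1::real} \<times> {a..b}) (\<lambda>x. h (snd x))" if "continuous_on {a..b} h" for h :: "real \<Rightarrow> complex"
    by (rule continuous_on_compose2[OF that]) (auto intro: continuous_intros)
  then show "continuous_on ({0..1} \<times> {a..b}) (\<lambda>(s, t). (1 - s) *\<^sub>R \<phi> (e t) + s *\<^sub>R \<phi> (e' t))"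
    unfolding case_prod_unfold using c by (intro continuous_intros) auto
  show C: "(1 - s) *\<^sub>R \<phi> (e t) + s *\<^sub>R \<phi> (e' t) \<in> ball z r \<inter> half_plane" if "s \<in> {0..1}" "t \<in> {a..b}" for s t
    using that eU[OF that(2)] by (intro convexD_alt[OF convex_half_disc] D(10)) (simp_all only: atLeastAtMost_iff)
  show "g ((1 - s) *\<^sub>R \<phi> (e t) + s *\<^sub>R \<phi> (e' t)) \<notin> obstacles" if "s \<in> {0..1}" "t \<in> {a..b} \<inter> {0<..<1}" for s t
    using D(8)[OF C[of s t]] U that by blast
  show "(1 - s) *\<^sub>R \<phi> (e a) + s *\<^sub>R \<phi> (e' a) = \<phi> (e a)" "(1 - s) *\<^sub>R \<phi> (e b) + s *\<^sub>R \<phi> (e' b) = \<phi> (e b)" for s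
    using eq[of a] eq[of b] ab by (auto simp flip: scaleR_left_distrib)
qed (use ab eq in auto)

text \<open>Meant for a boundary marked point that f sends to an ordinary puncture. The curves come
  near it at inner times, where they have to miss it; a straight homotopy in the chart could hit x,
  one through logarithms cannot.\<close>

lemma same_image_boundary:
  assumes dc: "disc_chart X x U \<phi> g z r" and U: "U \<inter> obstacles \<subseteq> {x}" and z: "Im z = 0" and x: "x \<in> obstacles"
    and e: "e \<in> generic_curves" "e' \<in> generic_curves" and ab: "0 < a" "a < b" "b < 1"
    and eU: "\<And>t. t \<in> {a..b} \<Longrightarrow> e t \<in> U \<and> e' t \<in> U"
    and eq: "\<And>t. t \<in> {0..1} - {a<..<b} \<Longrightarrow> e' t = e t"
  shows "same_image e e'"
proof -
  note D = disc_chartD[OF dc]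
  have p: "pathin X e" "pathin X e'" and av: "\<And>t. t \<in> {0<..<1} \<Longrightarrow> e t \<notin> obstacles \<and> e' t \<notin> obstacles"
    using e by (auto simp: curves_avoiding_def)
  have c: "continuous_on {a..b} (\<lambda>t. \<phi> (e t))" "continuous_on {a..b} (\<lambda>t. \<phi> (e' t))"
    using disc_chart_path[OF dc path_restrict] p ab eU by (meson less_imp_le)+
  have ne: "\<phi> y \<in> ball z r \<inter> half_plane - {z}" if "y \<in> U" "y \<notin> obstacles" for y
    using D(10)[OF that(1)] D(11)[OF that(1)] D(5) that x by auto
  have r: "0 < r" using dc by (simp add: disc_chart_def)
  have in1: "\<phi> (e t) \<in> ball z r \<inter> half_plane - {z}" "\<phi> (e' t) \<in> ball z r \<inter> half_plane - {z}" if "t \<in> {a..b}" for t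
    using that ab eU[OF that] av[of t] by (intro ne; auto)+
  obtain k :: "real \<Rightarrow> real \<Rightarrow> complex" where k: "continuous_on ({0..1} \<times> {a..b}) (\<lambda>(s, t). k s t)"
    "\<And>s t. s \<in> {0..1} \<Longrightarrow> t \<in> {a..b} \<Longrightarrow> k s t \<in> ball z r \<inter> half_plane - {z}"
    "\<And>t. t \<in> {a..b} \<Longrightarrow> k 0 t = \<phi> (e t)" "\<And>t. t \<in> {a..b} \<Longrightarrow> k 1 t = \<phi> (e' t)"
    "\<And>s t. t \<in> {a..b} \<Longrightarrow> \<phi> (e t) = \<phi> (e' t) \<Longrightarrow> k s t = \<phi> (e t)"
    by (rule half_disc_homotopy[OF z r c in1]) (assumption | rule that)+
  show ?thesis
  proof (rule same_image_patch[OF dc e(1) _ _ _ eU, where k = k])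
    show "g (k s t) \<notin> obstacles" if "s \<in> {0..1}" "t \<in> {a..b} \<inter> {0<..<1}" for s t
    proof
      assume "g (k s t) \<in> obstacles"
      moreover have kC: "k s t \<in> ball z r \<inter> half_plane - {z}" using k(2) that by blast
      ultimately have "g (k s t) = x" using U D(8) by blast
      then show False using D(9)[of "k s t"] D(6) kC by auto
    qed
    show "k s a = \<phi> (e a)" "k s b = \<phi> (e b)" for s
      using k(5)[of a s] k(5)[of b s] eq[of a] eq[of b] ab by auto
    show "k s t \<in> ball z r \<inter> half_plane" if "s \<in> {0..1}" "t \<in> {a..b}" for s t
      using k(2)[OF that] by blast
  qed (use k ab eq in auto)
qed

text \<open>Near their common start the two curves may wind around x in different ways. Both are
  therefore shrunk to the same curve \<open>e1\<close>, which leaves x along a segment of the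
  chart.\<close>

lemma same_image_start:
  assumes dc: "disc_chart X x U \<phi> g z r" and U: "U \<inter> obstacles \<subseteq> {x}" and x: "e 0 = x"
    and e: "e \<in> generic_curves" "e' \<in> generic_curves" and b: "0 < b" "b < 1"
    and eU: "\<And>t. t \<in> {0..b} \<Longrightarrow> e t \<in> U \<and> e' t \<in> U"
    and eq: "\<And>t. t \<in> {0..1} - {0<..<b} \<Longrightarrow> e' t = e t"
  shows "same_image e e'"
proof -
  note D = disc_chartD[OF dc]
  define l where "l = (\<lambda>t. g (z + of_real (t / b) * (\<phi> (e b) - z)))"
  define e1 where "e1 = patch 0 b l e"
  have shrink: "same_image d e1" if d: "d \<in> generic_curves" and dU: "\<And>t. t \<in> {0..b} \<Longrightarrow> d t \<in> U"
    and de: "\<And>t. t \<in> {0..1} - {0<..<b} \<Longrightarrow> e t = d t" for d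
  proof -
    have p: "pathin X d" and av: "\<And>t. t \<in> {0<..<1} \<Longrightarrow> d t \<notin> obstacles"
      using d by (auto simp: curves_avoiding_def)
    have c: "continuous_on {0..b} (\<lambda>t. \<phi> (d t))"
      using disc_chart_path[OF dc path_restrict[OF p]] b dU by auto
    have d0: "\<phi> (d 0) = z" using de[of 0] x b D(6) by simp
    have db: "d b = e b" using de[of b] b by simp
    obtain k :: "real \<Rightarrow> real \<Rightarrow> complex" where k: "continuous_on ({0..1} \<times> {0..b}) (\<lambda>(s, t). k s t)"
      "\<And>s t. s \<in> {0..1} \<Longrightarrow> t \<in> {0..b} \<Longrightarrow> k s t \<in> ball z r \<inter> half_plane"
      "\<And>t. t \<in> {0..b} \<Longrightarrow> k 0 t = \<phi> (d t)" "\<And>t. t \<in> {0..b} \<Longrightarrow> k 1 t = z + of_real (t / b) * (\<phi> (d b) - z)"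
      "\<And>s. s \<in> {0..1} \<Longrightarrow> k s 0 = z" "\<And>s. s \<in> {0..1} \<Longrightarrow> k s b = \<phi> (d b)"
      "\<And>s t. s \<in> {0..1} \<Longrightarrow> t \<in> {0<..b} \<Longrightarrow> \<forall>t'\<in>{t..b}. \<phi> (d t') \<noteq> z \<Longrightarrow> k s t \<noteq> z"
      by (rule shrink_path[OF c b(1) d0 convex_half_disc D(10)[OF dU]]) (assumption | rule that)+
    have l: "l t = g (k 1 t)" if "t \<in> {0..b}" for t using k(4)[OF that] db by (simp add: l_def)
    show ?thesis
    proof (rule same_image_patch[OF dc d _ _ _ _ _ k(1,2,3)])
      show "d t \<in> U \<and> e1 t \<in> U" if "t \<in> {0..b}" for t
        using that dU l D(8)[OF k(2)[of 1 t]] by (simp add: e1_def)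
      show "e1 t = d t" if "t \<in> {0..1} - {0..b}" for t
      proof -
        have "e1 t = e t" using that unfolding e1_def by (intro patch_outside) auto
        then show ?thesis using de[of t] that by auto
      qed
      show "k 1 t = \<phi> (e1 t)" if "t \<in> {0..b}" for t
        using that l[OF that] D(9)[OF k(2)[of 1 t]] by (simp add: e1_def)
      show "g (k s t) \<notin> obstacles" if "s \<in> {0..1}" "t \<in> {0..b} \<inter> {0<..<1}" for s t
      proof
        assume o: "g (k s t) \<in> obstacles"
        have kC: "k s t \<in> ball z r \<inter> half_plane" using k(2) that by blast
        then have gx: "g (k s t) = x" using U D(8) o by blast
        then have "k s t = z" using D(9)[OF kC] D(6) by auto
        moreover have "k s t \<noteq> z"
        proof (rule k(7))
          show "\<forall>t'\<in>{t..b}. \<phi> (d t') \<noteq> z"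
          proof (intro ballI notI)
            fix t' assume that: "t' \<in> {t..b}"
            assume "\<phi> (d t') = z"
            then have "d t' = x" using D(11)[OF dU, of t'] D(5) that \<open>t \<in> {0..b} \<inter> {0<..<1}\<close> by auto
            then show False using av[of t'] o gx that \<open>t \<in> {0..b} \<inter> {0<..<1}\<close> b by auto
          qed
        qed (use that in auto)
        ultimately show False by blast
      qed
    qed (use k b d0 in auto)
  qed
  have "same_image e e1" using e eU by (intro shrink) auto
  moreover have "same_image e' e1" using e eU eq by (intro shrink) auto
  ultimately show ?thesis using same_image_sym same_image_trans by blast
qed

lemma same_image_reversed:
  assumes "same_image (\<lambda>t. e (1 - t)) (\<lambda>t. e' (1 - t))"
  shows "same_image e e'"
  using reduced_equiv_reversed[OF assms[unfolded same_image_def]] by (simp add: same_image_def o_def)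

lemma curves_avoiding_reversed:
  assumes "e \<in> curves_avoiding S F"
  shows "(\<lambda>t. e (1 - t)) \<in> curves_avoiding S F"
proof -
  have "pathin (surface_space S) (\<lambda>t. e (1 - t))"
    unfolding pathin_def
  proof (rule continuous_map_comp[where g = e])
    show "continuous_map (top_of_set {0..1::real}) (top_of_set {0..1}) (\<lambda>t. 1 - t)"
      by (auto simp: continuous_map_in_subtopology intro!: continuous_intros)
  qed (use assms in \<open>auto simp: curves_avoiding_def pathin_def\<close>)
  then show ?thesis using assms by (auto simp: curves_avoiding_def)
qed

lemma same_image_end:
  assumes dc: "disc_chart X x U \<phi> g z r" and U: "U \<inter> obstacles \<subseteq> {x}" and x: "e 1 = x"
    and e: "e \<in> generic_curves" "e' \<in> generic_curves" and a: "0 < a" "a < 1"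
    and eU: "\<And>t. t \<in> {a..1} \<Longrightarrow> e t \<in> U \<and> e' t \<in> U"
    and eq: "\<And>t. t \<in> {0..1} - {a<..<1} \<Longrightarrow> e' t = e t"
  shows "same_image e e'"
proof (rule same_image_reversed)
  show "same_image (\<lambda>t. e (1 - t)) (\<lambda>t. e' (1 - t))"
    using x e[THEN curves_avoiding_reversed] a
    by (intro same_image_start[OF dc U, of _ _ "1 - a"] eq conjI) (use eU in auto)
qed

lemma branch_neighbourhood:
  assumes p: "p \<in> branch_points \<Sigma> \<Sigma>' f"
  obtains U where "openin X U" "p \<in> U"
    "\<And>a b e e'. \<lbrakk>e \<in> generic_curves; e' \<in> generic_curves; 0 \<le> a; a < b; b \<le> 1;
       (\<And>t. t \<in> {a..b} \<Longrightarrow> e t \<in> U - {p} \<and> e' t \<in> U - {p});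
       (\<And>t. t \<in> {0..1} - {a<..<b} \<Longrightarrow> e' t = e t)\<rbrakk> \<Longrightarrow> same_image e e'"
proof -
  obtain U0 \<phi> \<psi> where U0: "openin X U0" "p \<in> U0"
      and \<phi>: "homeomorphic_map (subtopology X U0) (top_of_set (ball (0::complex) 1)) \<phi>" "\<phi> p = 0"
      and \<psi>: "homeomorphic_map (subtopology Y (f ` U0)) (top_of_set (ball (0::complex) 1)) \<psi>"
      and sq: "\<And>x. x \<in> U0 \<Longrightarrow> \<psi> (f x) = (\<phi> x)\<^sup>2"
    using ramified[OF p] unfolding ramified_double_cover_at_def by blast
  have U0t: "U0 \<subseteq> topspace X" using U0 openin_subset by blast
  have ft: "f ` U0 \<subseteq> topspace Y" using U0t continuous_map_image_subset_topspace[OF continuous_f] by blast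
  have fp: "f p \<in> special_punctures \<Sigma>'" using p by (auto simp: branch_points_def)
  obtain \<xi> where \<xi>: "homeomorphic_maps (subtopology Y (f ` U0)) (top_of_set (ball 0 1)) \<psi> \<xi>"
    using \<psi> homeomorphic_map_maps by blast
  have \<xi>l: "\<xi> (\<psi> y) = y" if "y \<in> f ` U0" for y
    using \<xi> that ft by (auto simp: homeomorphic_maps_def)
  have \<xi>r: "\<psi> (\<xi> w) = w" if "w \<in> ball 0 1" for w
    using \<xi> that by (auto simp: homeomorphic_maps_def)
  have \<xi>c: "continuous_map (top_of_set (ball 0 1)) Y \<xi>"
    using \<xi> continuous_map_into_fulltopology by (auto simp: homeomorphic_maps_def)
  have \<phi>inj: "inj_on \<phi> U0"
    using homeomorphic_imp_injective_map[OF \<phi>(1)] U0t by (simp add: Int_absorb1)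
  have \<phi>c: "continuous_map (subtopology X U0) (top_of_set (ball 0 1)) \<phi>"
    using \<phi>(1) homeomorphic_imp_continuous_map by blast
  define F where "F = marked_points \<Sigma>' \<union> special_punctures \<Sigma>' - {f p}"
  have "closedin Y F"
  proof -
    have "F \<subseteq> topspace Y" "finite F" using tame_target by (auto simp: F_def)
    then show ?thesis using Hausdorff_imp_t1_space[OF tame_target(1)] t1_space_closedin_finite by blast
  qed
  then have "openin X {x \<in> topspace X. f x \<in> topspace Y - F}"
    by (intro openin_continuous_map_preimage[OF continuous_f]) auto
  then have "openin (subtopology X U0) (U0 \<inter> {x \<in> topspace X. f x \<in> topspace Y - F})"
    by (rule openin_subtopology_Int2)
  then have "openin (top_of_set (ball 0 1)) (\<phi> ` (U0 \<inter> {x \<in> topspace X. f x \<in> topspace Y - F}))"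
    using homeomorphic_imp_open_map[OF \<phi>(1)] by (simp add: open_map_def)
  then have "open (\<phi> ` (U0 \<inter> {x \<in> topspace X. f x \<in> topspace Y - F}))"
    using openin_open_trans by blast
  moreover have "0 \<in> \<phi> ` (U0 \<inter> {x \<in> topspace X. f x \<in> topspace Y - F})"
    using U0 U0t ft \<phi>(2) by (intro image_eqI[of _ _ p]) (auto simp: F_def)
  ultimately obtain r where r: "0 < r" "ball 0 r \<subseteq> \<phi> ` (U0 \<inter> {x \<in> topspace X. f x \<in> topspace Y - F})"
    using open_contains_ball by blast
  have rb: "ball 0 r \<subseteq> ball (0::complex) 1"
  proof -
    have "\<phi> ` U0 \<subseteq> ball 0 1"
      using continuous_map_image_subset_topspace[OF \<phi>c] U0t by (simp add: Int_absorb1)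
    then show ?thesis using r(2) by blast
  qed
  then have r1: "r \<le> 1" using r(1) by (simp add: ball_subset_ball_iff)
  have r2: "0 < r\<^sup>2" "r\<^sup>2 \<le> r" using r(1) r1 by (auto simp: power2_eq_square mult_left_le_one_le)
  \<comment> \<open>A point of the target disc of radius r squared is the square of a point of the
    source disc of radius r. So it is the image of a source point that f keeps off all other marked
    points and special punctures.\<close>
  have sd: "special_disc \<Sigma>' \<xi> (r\<^sup>2)"
    unfolding special_disc_def
  proof (intro conjI ballI)
    have sub: "ball 0 (r\<^sup>2) \<subseteq> ball (0::complex) 1" using r2 r1 by (intro subset_ball) simp
    show "continuous_map (top_of_set (ball 0 (r\<^sup>2))) Y \<xi>"
      using \<xi>c sub by (rule continuous_map_from_subtopology_mono)
    show "inj_on \<xi> (ball 0 (r\<^sup>2))" using \<xi>r sub by (intro inj_on_inverseI[of _ \<psi>]) auto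
    have \<xi>0: "\<xi> 0 = f p" using \<xi>l[of "f p"] sq[OF U0(2)] \<phi>(2) U0 by simp
    show "\<xi> 0 \<in> special_punctures \<Sigma>'" using \<xi>0 fp by simp
    fix w :: complex assume w: "w \<in> ball 0 (r\<^sup>2) - {0}"
    have "csqrt w \<in> ball 0 r"
      using w r(1) real_sqrt_less_mono[of "norm w" "r\<^sup>2"] by simp
    then have "csqrt w \<in> \<phi> ` (U0 \<inter> {x \<in> topspace X. f x \<in> topspace Y - F})"
      using r(2) by blast
    then obtain y where y: "y \<in> U0" "f y \<in> topspace Y - F" "\<phi> y = csqrt w"
      by auto
    have "\<psi> (f y) = w" using sq[OF y(1)] y(3) by simp
    then have "\<xi> w = f y" "f y \<noteq> f p" using \<xi>l[of "f y"] y(1) w sq[OF U0(2)] \<phi>(2) by auto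
    then show "\<xi> w \<notin> marked_points \<Sigma>' \<union> special_punctures \<Sigma>'" using y(2) by (auto simp: F_def)
  qed (use tame_target in auto)
  define U where "U = {x \<in> topspace (subtopology X U0). \<phi> x \<in> ball 0 r}"
  have "openin (subtopology X U0) U"
    unfolding U_def using rb by (intro openin_continuous_map_preimage[OF \<phi>c]) (simp add: openin_open_eq)
  then have openU: "openin X U" using U0(1) openin_trans_full by blast
  have pU: "p \<in> U" using U0 U0t \<phi>(2) r(1) by (auto simp: U_def)
  have UU0: "U \<subseteq> U0" by (auto simp: U_def)
  show thesis
  proof (rule that[OF openU pU])
    fix a b e e'
    assume e: "e \<in> generic_curves" "e' \<in> generic_curves" and ab: "(0::real) \<le> a" "a < b" "b \<le> 1"
      and eU: "\<And>t. t \<in> {a..b} \<Longrightarrow> e t \<in> U - {p} \<and> e' t \<in> U - {p}"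
      and eq: "\<And>t. t \<in> {0..1} - {a<..<b} \<Longrightarrow> e' t = e t"
    have lift: "\<exists>A. continuous_on {a..b} A \<and> (\<forall>t\<in>{a..b}. \<phi> (d t) = exp (A t))"
      if d: "d \<in> generic_curves" "\<And>t. t \<in> {a..b} \<Longrightarrow> d t \<in> U - {p}" for d
    proof -
      have "continuous_map (top_of_set {a..b}) (subtopology X U0) d"
        using path_restrict[of d a b] d ab UU0 by (auto simp: continuous_map_in_subtopology curves_avoiding_def)
      then have "continuous_map (top_of_set {a..b}) (top_of_set (ball 0 1)) (\<lambda>t. \<phi> (d t))"
        using \<phi>c by (rule continuous_map_comp)
      then have "continuous_on {a..b} (\<lambda>t. \<phi> (d t))" by simp
      moreover have "\<phi> (d t) \<noteq> 0" if "t \<in> {a..b}" for t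
        using d(2)[OF that] inj_onD[OF \<phi>inj, of "d t" p] UU0 U0 \<phi>(2) by auto
      ultimately show ?thesis
        using continuous_logarithm_on_contractible[of "{a..b}" "\<lambda>t. \<phi> (d t)"] convex_imp_contractible
        by (metis convex_real_interval(5))
    qed
    obtain A where A: "continuous_on {a..b} A" "\<And>t. t \<in> {a..b} \<Longrightarrow> \<phi> (e t) = exp (A t)"
      using lift[OF e(1)] eU by blast
    obtain A0 where A0: "continuous_on {a..b} A0" "\<And>t. t \<in> {a..b} \<Longrightarrow> \<phi> (e' t) = exp (A0 t)"
      using lift[OF e(2)] eU by blast
    have "exp (A0 a) = exp (A a)" "exp (A0 b) = exp (A b)"
      using A(2)[of a] A0(2)[of a] A(2)[of b] A0(2)[of b] eq[of a] eq[of b] ab by auto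
    then obtain n m :: int where nm: "A0 a = A a + of_int (2 * n) * of_real pi * \<i>"
        "A0 b = A b + of_int (2 * m) * of_real pi * \<i>"
      unfolding exp_eq by (metis of_int_mult of_int_numeral of_real_mult of_real_of_int_eq)
    \<comment> \<open>After this shift both logarithms start at the same value and end 2 pi i (m -
      n) apart. Squaring doubles this to 4 pi i (m - n), an even number of turns.\<close>
    define A' where "A' = (\<lambda>t. A0 t - of_int (2 * n) * of_real pi * \<i>)"
    have eA': "exp (A' t) = \<phi> (e' t)" if "t \<in> {a..b}" for t
    proof -
      have "A' t = A0 t + \<i> * (of_int (- n) * (of_real pi * 2))" by (simp add: A'_def)
      then show ?thesis by (simp only: exp_plus_2pin A0(2)[OF that])
    qed
    have Re_less: "Re (2 * w) < ln (r\<^sup>2)" if "norm (exp w) < r" for w :: complex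
    proof -
      have "Re w < ln r"
        using that r(1) exp_less_cancel_iff[of "Re w" "ln r"] by (simp only: norm_exp_eq_Re exp_ln)
      then show ?thesis using r(1) by (simp add: ln_realpow)
    qed
    have fe: "f x = \<xi> (exp (2 * w))" if "x \<in> U" "\<phi> x = exp w" for x w
    proof -
      have "\<psi> (f x) = exp (2 * w)" using sq[of x] that UU0 by (auto simp: exp_double)
      then show ?thesis using \<xi>l[of "f x"] that UU0 by auto
    qed
    have "(f \<circ> e, f \<circ> e') \<in> reduced_equiv \<Sigma>'"
    proof (rule even_turns_reduced_equiv[OF generic_image[OF e(1)] generic_image[OF e(2)] ab sd r2(1),
          where G = "\<lambda>t. 2 * A t" and G' = "\<lambda>t. 2 * A' t" and k = "m - n"])
      show "continuous_on {a..b} (\<lambda>t. 2 * A t)" "continuous_on {a..b} (\<lambda>t. 2 * A' t)"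
        unfolding A'_def by (intro continuous_intros A A0)+
      show "2 * A' a = 2 * A a" by (simp add: A'_def nm)
      show "2 * A' b = 2 * A b + 4 * of_int (m - n) * of_real pi * \<i>"
        by (simp add: A'_def nm algebra_simps)
      show "Re (2 * A t) < ln (r\<^sup>2)" if "t \<in> {a..b}" for t
        using eU[OF that] A(2)[OF that] by (intro Re_less) (auto simp: U_def)
      show "Re (2 * A' t) < ln (r\<^sup>2)" if "t \<in> {a..b}" for t
        using eU[OF that] eA'[OF that] by (intro Re_less) (auto simp: U_def)
      show "(f \<circ> e) t = \<xi> (exp (2 * A t))" if "t \<in> {a..b}" for t
        using eU[OF that] A(2)[OF that] fe by simp
      show "(f \<circ> e') t = \<xi> (exp (2 * A' t))" if "t \<in> {a..b}" for t
        using eU[OF that] eA'[OF that] fe by simp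
      show "(f \<circ> e') t = (f \<circ> e) t" if "t \<in> {0..1} - {a..b}" for t
        using eq[of t] that by auto
    qed
    then show "same_image e e'" by (simp add: same_image_def)
  qed
qed

end

section \<open>Limit classes\<close>

lemma continuous_map_join:
  fixes a b c :: real
  assumes "continuous_map (top_of_set {a..b}) X d" "continuous_map (top_of_set {b..c}) X d'" "d b = d' b"
    "a \<le> b" "b \<le> c"
  shows "continuous_map (top_of_set {a..c}) X (\<lambda>t. if t \<le> b then d t else d' t)"
proof (rule continuous_map_cases_le)
  have "{x \<in> topspace (top_of_set {a..c}). x \<le> b} = {a..b}" "{x \<in> topspace (top_of_set {a..c}). b \<le> x} = {b..c}"
    "{a..c} \<inter> {a..b} = {a..b}" "{a..c} \<inter> {b..c} = {b..c}"
    using assms by auto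
  then show "continuous_map (subtopology (top_of_set {a..c}) {x \<in> topspace (top_of_set {a..c}). x \<le> b}) X d"
    "continuous_map (subtopology (top_of_set {a..c}) {x \<in> topspace (top_of_set {a..c}). b \<le> x}) X d'"
    using assms by (simp_all only: subtopology_subtopology)
qed (use assms in auto)

text \<open>Supplies in \<open>close_generic\<close> a junction point outside the finite set that is
  to be avoided.\<close>

lemma disc_chart_other_point:
  assumes "disc_chart X x U \<phi> g z r"
  obtains w where "w \<in> U" "w \<noteq> x"
proof -
  note D = disc_chartD[OF assms]
  have r: "0 < r" using assms by (simp add: disc_chart_def)
  have w: "z + \<i> * of_real (r / 2) \<in> ball z r \<inter> half_plane"
    using D(4) r by (simp add: dist_norm norm_mult)
  show thesis
  proof (rule that[OF D(8)[OF w]])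
    show "g (z + \<i> * of_real (r / 2)) \<noteq> x"
      using D(9)[OF w] D(6) r by auto
  qed
qed

section \<open>Approximation by generic curves\<close>

context tame_morphism
begin

text \<open>An open neighbourhood of the graph of a curve in this space prescribes how close another
  curve has to be at each time; it stands in for uniform distance.\<close>

abbreviation time_space :: "(real \<times> 'a) topology" where
  "time_space \<equiv> prod_topology (top_of_set {0..1}) X"

text \<open>Imposes a condition at the times in K only, so that neighbourhoods prescribed over
  different closed intervals can be intersected.\<close>

lemma open_over:
  assumes "openin time_space N" "closed K"
  shows "openin time_space {p \<in> topspace time_space. fst p \<in> K \<longrightarrow> p \<in> N}"
proof -
  have "continuous_map time_space euclideanreal fst"
    by (rule continuous_map_into_fulltopology) (rule continuous_map_fst)
  then have "openin time_space {p \<in> topspace time_space. fst p \<in> - K}"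
    by (rule openin_continuous_map_preimage) (use assms in \<open>simp add: open_Compl\<close>)
  then have "openin time_space ({p \<in> topspace time_space. fst p \<in> - K} \<union> N)"
    using assms(1) by blast
  moreover have "{p \<in> topspace time_space. fst p \<in> - K} \<union> N = {p \<in> topspace time_space. fst p \<in> K \<longrightarrow> p \<in> N}"
    using openin_subset[OF assms(1)] by blast
  ultimately show ?thesis by simp
qed

lemma open_box:
  assumes "openin time_space N" "(t0, x0) \<in> N"
  obtains \<epsilon> W where "0 < \<epsilon>" "openin X W" "x0 \<in> W"
    "\<And>t x. t \<in> {0..1} \<Longrightarrow> \<bar>t - t0\<bar> < \<epsilon> \<Longrightarrow> x \<in> W \<Longrightarrow> (t, x) \<in> N"
proof -
  obtain S W where S: "openin (top_of_set {0..1}) S" "openin X W" "t0 \<in> S" "x0 \<in> W" "S \<times> W \<subseteq> N"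
    using assms(1)[unfolded openin_prod_topology_alt, rule_format, OF assms(2)] by (elim exE conjE) (rule that)
  then obtain \<epsilon> where e: "0 < \<epsilon>" "ball t0 \<epsilon> \<inter> {0..1} \<subseteq> S"
    unfolding openin_contains_ball by blast
  show thesis
  proof (rule that[OF e(1) S(2,4)])
    fix t x assume "t \<in> {0..1}" "\<bar>t - t0\<bar> < \<epsilon>" "x \<in> W"
    then have "t \<in> ball t0 \<epsilon> \<inter> {0..1}" by (simp add: dist_real_def abs_minus_commute)
    then show "(t, x) \<in> N" using e(2) S(5) \<open>x \<in> W\<close> by blast
  qed
qed

lemma path_near:
  assumes "pathin X c" "t0 \<in> {0..1}" "openin X W" "c t0 \<in> W"
  obtains \<epsilon> where "0 < \<epsilon>" "\<And>t. t \<in> {0..1} \<Longrightarrow> \<bar>t - t0\<bar> < \<epsilon> \<Longrightarrow> c t \<in> W"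
proof -
  have "openin (top_of_set {0..1}) {t \<in> topspace (top_of_set {0..1}). c t \<in> W}"
    using assms(1,3) unfolding pathin_def by (rule openin_continuous_map_preimage)
  moreover have "t0 \<in> {t \<in> topspace (top_of_set {0..1}). c t \<in> W}" using assms by simp
  ultimately obtain \<epsilon> where e: "0 < \<epsilon>" "ball t0 \<epsilon> \<inter> {0..1} \<subseteq> {t \<in> topspace (top_of_set {0..1}). c t \<in> W}"
    unfolding openin_contains_ball by blast
  show thesis
  proof (rule that[OF e(1)])
    fix t assume "t \<in> {0..1}" "\<bar>t - t0\<bar> < \<epsilon>"
    then have "t \<in> ball t0 \<epsilon> \<inter> {0..1}" by (simp add: dist_real_def abs_minus_commute)
    then show "c t \<in> W" using e(2) by blast
  qed
qed

text \<open>Bisection fails with fixed ends, because the point of c at the division time may lie in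
  F, where the new path must not go. So \<open>P\<close> demands paths between all points near the
  two ends, and two pieces are joined at a nearby point outside F.\<close>

lemma close_generic:
  assumes F: "finite F" "F \<subseteq> topspace X" and c: "pathin X c" and ab: "0 \<le> a" "a < b" "b \<le> 1" and N: "openin time_space N"
    and cN: "\<And>t. t \<in> {a..b} \<Longrightarrow> (t, c t) \<in> N"
  obtains d where "continuous_map (top_of_set {a..b}) X d" "d a = c a" "d b = c b"
    "\<And>t. t \<in> {a..b} \<Longrightarrow> (t, d t) \<in> N" "\<And>t. t \<in> {a<..<b} \<Longrightarrow> d t \<notin> F"
proof -
  define Q where "Q = (\<lambda>a b u v. \<exists>d. continuous_map (top_of_set {a..b}) X d \<and> d a = u \<and> d b = v \<and>
    (\<forall>t\<in>{a..b}. (t, d t) \<in> N) \<and> (\<forall>t\<in>{a<..<b}. d t \<notin> F))"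
  define P where "P = (\<lambda>a b. 0 \<le> a \<longrightarrow> a < b \<longrightarrow> b \<le> 1 \<longrightarrow>
    (\<exists>A E. openin X A \<and> openin X E \<and> c a \<in> A \<and> c b \<in> E \<and> (\<forall>u\<in>A. \<forall>v\<in>E. Q a b u v)))"
  have "P a b"
    using less_imp_le[OF ab(2)]
  proof (induction rule: Bolzano)
    case (trans a b c')
    show ?case
      unfolding P_def
    proof (intro impI)
      assume ac: "0 \<le> a" "a < c'" "c' \<le> 1"
      consider "a = b" | "b = c'" | "a < b" "b < c'" using trans(3,4) by linarith
      then show "\<exists>A E. openin X A \<and> openin X E \<and> c a \<in> A \<and> c c' \<in> E \<and> (\<forall>u\<in>A. \<forall>v\<in>E. Q a c' u v)"
      proof cases
        case 3
        obtain A E where AE: "openin X A" "openin X E" "c a \<in> A" "c b \<in> E" "\<forall>u\<in>A. \<forall>v\<in>E. Q a b u v"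
          using trans(1) ac 3 unfolding P_def by auto
        obtain A' E' where AE': "openin X A'" "openin X E'" "c b \<in> A'" "c c' \<in> E'" "\<forall>u\<in>A'. \<forall>v\<in>E'. Q b c' u v"
          using trans(2) ac 3 unfolding P_def by auto
        have cb: "c b \<in> topspace X" using pathin_topspace[OF c, of b] ac 3 by simp
        obtain U \<phi> g z r where U: "disc_chart X (c b) U \<phi> g z r" "U \<subseteq> E \<inter> A'" "U \<inter> F \<subseteq> {c b}"
          by (rule chart_at[OF F cb, of "E \<inter> A'"]) (use AE AE' in blast, use AE AE' in blast, rule that)
        obtain w where "w \<in> U" "w \<noteq> c b" using disc_chart_other_point[OF U(1)] by blast
        then have w: "w \<in> E" "w \<in> A'" "w \<notin> F" using U by auto
        have "Q a c' u v" if u: "u \<in> A" "v \<in> E'" for u v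
        proof -
          obtain d where d: "continuous_map (top_of_set {a..b}) X d" "d a = u" "d b = w"
            "\<forall>t\<in>{a..b}. (t, d t) \<in> N" "\<forall>t\<in>{a<..<b}. d t \<notin> F"
            using AE(5) u w unfolding Q_def by blast
          obtain d' where d': "continuous_map (top_of_set {b..c'}) X d'" "d' b = w" "d' c' = v"
            "\<forall>t\<in>{b..c'}. (t, d' t) \<in> N" "\<forall>t\<in>{b<..<c'}. d' t \<notin> F"
            using AE'(5) u w unfolding Q_def by blast
          let ?d = "\<lambda>t. if t \<le> b then d t else d' t"
          have "continuous_map (top_of_set {a..c'}) X ?d"
            using d d' 3 by (intro continuous_map_join) auto
          moreover have "?d t \<notin> F" if "t \<in> {a<..<c'}" for t
            using that d(3,5) d'(5) w(3) by (cases t b rule: linorder_cases) auto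
          ultimately show ?thesis
            unfolding Q_def using d d' 3 by (intro exI[of _ ?d]) auto
        qed
        then show ?thesis using AE AE' by blast
      qed (use trans(1,2) ac in \<open>auto simp: P_def\<close>)
    qed
  next
    case (local x)
    then have x: "x \<in> {0..1}" "x \<in> {a..b}" using ab by auto
    obtain \<epsilon> W where e: "0 < \<epsilon>" "openin X W" "c x \<in> W"
      "\<And>t y. t \<in> {0..1} \<Longrightarrow> \<bar>t - x\<bar> < \<epsilon> \<Longrightarrow> y \<in> W \<Longrightarrow> (t, y) \<in> N"
      using open_box[OF N cN[OF x(2)]] by metis
    obtain U \<phi> g z r where U: "disc_chart X (c x) U \<phi> g z r" "U \<subseteq> W" "U \<inter> F \<subseteq> {c x}"
      by (rule chart_at[OF F pathin_topspace[OF c x(1)] e(2,3)]) (rule that)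
    obtain \<delta> where \<delta>: "0 < \<delta>" "\<And>t. t \<in> {0..1} \<Longrightarrow> \<bar>t - x\<bar> < \<delta> \<Longrightarrow> c t \<in> U"
      using path_near[OF c x(1) disc_chartD(1,2)[OF U(1)]] by metis
    show ?case
    proof (intro exI[of _ "min \<epsilon> \<delta>"] conjI allI impI)
      show "0 < min \<epsilon> \<delta>" using e \<delta> by simp
      fix a b assume ab: "a \<le> x \<and> x \<le> b \<and> b - a < min \<epsilon> \<delta>"
      show "P a b"
        unfolding P_def
      proof (intro impI exI[of _ U] conjI ballI)
        assume ab': "0 \<le> a" "a < b" "b \<le> 1"
        show "openin X U" using disc_chartD(1)[OF U(1)] .
        show "c a \<in> U" "c b \<in> U" using \<delta>(2)[of a] \<delta>(2)[of b] ab ab' by auto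
        fix u v assume "u \<in> U" "v \<in> U"
        then obtain d where d: "continuous_map (top_of_set {a..b}) X d" "d a = u" "d b = v"
          "\<And>t. t \<in> {a..b} \<Longrightarrow> d t \<in> U" "\<And>t. t \<in> {a<..<b} \<Longrightarrow> d t \<notin> F"
          using disc_chart_connect[OF U(1,3) _ _ ab'(2)] by metis
        have "(t, d t) \<in> N" if "t \<in> {a..b}" for t
          using that ab ab' d(4)[OF that] U(2) by (intro e(4)) auto
        then show "Q a b u v" unfolding Q_def using d by blast
      qed (use disc_chartD(1)[OF U(1)] in simp)
    qed
  qed
  then obtain A E where "c a \<in> A" "c b \<in> E" "\<forall>u\<in>A. \<forall>v\<in>E. Q a b u v"
    using ab unfolding P_def by blast
  then have "Q a b (c a) (c b)" by blast
  then show thesis using that unfolding Q_def by blast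
qed

text \<open>The extra set F lets one curve be generic for two morphisms at once, as
  \<open>class_image_comp\<close> requires.\<close>

lemma approximate_generic:
  assumes c: "pathin X c" "c 0 \<in> marked_points \<Sigma>" "c 1 \<in> marked_points \<Sigma>"
    and N: "openin time_space N" "\<And>t. t \<in> {0..1} \<Longrightarrow> (t, c t) \<in> N" and F: "finite F" "F \<subseteq> topspace X"
  obtains d where "d \<in> generic_curves" "d 0 = c 0" "d 1 = c 1" "\<And>t. t \<in> {0..1} \<Longrightarrow> (t, d t) \<in> N"
    "\<And>t. t \<in> {0<..<1} \<Longrightarrow> d t \<notin> F"
proof -
  have F': "finite (obstacles \<union> F)" "obstacles \<union> F \<subseteq> topspace X"
    using F finite_obstacles obstacles_subset by auto
  obtain d where d: "continuous_map (top_of_set {0..1}) X d" "d 0 = c 0" "d 1 = c 1"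
    "\<And>t. t \<in> {0..1} \<Longrightarrow> (t, d t) \<in> N" "\<And>t. t \<in> {0<..<1} \<Longrightarrow> d t \<notin> obstacles \<union> F"
    using close_generic[OF F' c(1) order_refl zero_less_one order_refl N] by metis
  show thesis
    by (rule that[of d]) (use c d in \<open>auto simp: curves_avoiding_def pathin_def\<close>)
qed

section \<open>Stability of the image under small changes of a curve\<close>

lemma local_equivalence:
  assumes c: "c \<in> proper_curves \<Sigma>" and x: "x \<in> {0..1}"
  obtains U \<delta> where "openin X U" "c x \<in> U" "0 < \<delta>"
    "\<And>a b e e'. \<lbrakk>0 \<le> a; a < b; b \<le> 1; a \<le> x; x \<le> b; b - a < \<delta>; e \<in> generic_curves; e' \<in> generic_curves;
       e 0 = c 0; e 1 = c 1; (\<And>t. t \<in> {0..1} - {a<..<b} \<Longrightarrow> e' t = e t);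
       (\<And>t. t \<in> {a..b} \<Longrightarrow> e t \<in> U \<and> e' t \<in> U)\<rbrakk> \<Longrightarrow> same_image e e'"
proof -
  have p: "pathin X c" and av: "\<And>t. t \<in> {0<..<1} \<Longrightarrow> c t \<notin> punctures \<Sigma>"
    using c by (auto simp: curves_avoiding_def)
  have cx: "c x \<in> topspace X" using pathin_topspace[OF p x] .
  obtain U \<phi> g z r where U: "disc_chart X (c x) U \<phi> g z r" "U \<inter> obstacles \<subseteq> {c x}"
    "c x \<in> boundary_marked \<Sigma> \<Longrightarrow> Im z = 0"
    by (rule chart_at[OF finite_obstacles obstacles_subset cx openin_topspace cx]) (rule that)
  note D = disc_chartD[OF U(1)]
  consider "x = 0" | "x = 1" | "x \<in> {0<..<1}" "c x \<notin> obstacles" | "x \<in> {0<..<1}" "c x \<in> obstacles"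
    using x by fastforce
  then show thesis
  proof cases
    case 1
    show ?thesis
    \<comment> \<open>With \<delta> = 1, an interval [0,b] that is short enough satisfies b < 1, as
      \<open>same_image_start\<close> requires.\<close>
    proof (rule that[OF D(1,2) zero_less_one])
      fix a b e e' assume ab: "(0::real) \<le> a" "a < b" "b \<le> 1" "a \<le> x" "x \<le> b" "b - a < 1"
        and e: "e \<in> generic_curves" "e' \<in> generic_curves" "e 0 = c 0" "e 1 = c 1"
          "\<And>t. t \<in> {0..1} - {a<..<b} \<Longrightarrow> e' t = e t" "\<And>t. t \<in> {a..b} \<Longrightarrow> e t \<in> U \<and> e' t \<in> U"
      have a: "a = 0" using ab 1 by simp
      show "same_image e e'"
        using ab e 1 by (intro same_image_start[OF U(1,2) _ e(1,2), of b]) (simp_all add: a)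
    qed
  next
    case 2
    show ?thesis
    proof (rule that[OF D(1,2) zero_less_one])
      fix a b e e' assume ab: "(0::real) \<le> a" "a < b" "b \<le> 1" "a \<le> x" "x \<le> b" "b - a < 1"
        and e: "e \<in> generic_curves" "e' \<in> generic_curves" "e 0 = c 0" "e 1 = c 1"
          "\<And>t. t \<in> {0..1} - {a<..<b} \<Longrightarrow> e' t = e t" "\<And>t. t \<in> {a..b} \<Longrightarrow> e t \<in> U \<and> e' t \<in> U"
      have b: "b = 1" using ab 2 by simp
      show "same_image e e'"
        using ab e 2 by (intro same_image_end[OF U(1,2) _ e(1,2), of a]) (simp_all add: b)
    qed
  next
    case 3
    have U0: "U \<inter> obstacles = {}" using U(2) 3 by auto
    show ?thesis
      by (rule that[OF D(1,2) zero_less_one]) (rule same_image_straight[OF U(1) U0])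
  next
    case 4
    \<comment> \<open>Since c is proper and x is an inner time, the obstacle c x is either a branch
      point or a boundary marked point over an ordinary puncture.\<close>
    have "c x \<notin> punctures \<Sigma>" using av 4(1) by simp
    then have fx: "f (c x) \<in> punctures \<Sigma>'" using 4(2) by (auto simp: obstacles_def)
    \<comment> \<open>Keeps [a,b] inside (0,1), where generic curves miss every obstacle and in
      particular c x.\<close>
    define \<delta> where "\<delta> = min x (1 - x)"
    have \<delta>: "0 < \<delta>" using 4(1) by (auto simp: \<delta>_def)
    show ?thesis
    proof (cases "f (c x) \<in> special_punctures \<Sigma>'")
      case True
      then have "c x \<in> branch_points \<Sigma> \<Sigma>' f"
        using cx \<open>c x \<notin> punctures \<Sigma>\<close> by (auto simp: branch_points_def)
      then obtain U' where U': "openin X U'" "c x \<in> U'"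
        "\<And>a b e e'. \<lbrakk>e \<in> generic_curves; e' \<in> generic_curves; 0 \<le> a; a < b; b \<le> 1;
           (\<And>t. t \<in> {a..b} \<Longrightarrow> e t \<in> U' - {c x} \<and> e' t \<in> U' - {c x});
           (\<And>t. t \<in> {0..1} - {a<..<b} \<Longrightarrow> e' t = e t)\<rbrakk> \<Longrightarrow> same_image e e'"
        using branch_neighbourhood by metis
      show ?thesis
      proof (rule that[OF U'(1,2) \<delta>])
        fix a b e e' assume ab: "0 \<le> a" "a < b" "b \<le> 1" "a \<le> x" "x \<le> b" "b - a < \<delta>"
          and e: "e \<in> generic_curves" "e' \<in> generic_curves" "e 0 = c 0" "e 1 = c 1"
            "\<And>t. t \<in> {0..1} - {a<..<b} \<Longrightarrow> e' t = e t" "\<And>t. t \<in> {a..b} \<Longrightarrow> e t \<in> U' \<and> e' t \<in> U'"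
        have "t \<in> {0<..<1}" if "t \<in> {a..b}" for t
          using that ab by (auto simp: \<delta>_def)
        then have "e t \<noteq> c x \<and> e' t \<noteq> c x" if "t \<in> {a..b}" for t
          using that e(1,2) 4(2) unfolding curves_avoiding_def by fastforce
        then show "same_image e e'"
          using e ab by (intro U'(3)[of e e' a b]) auto
      qed
    next
      case False
      then have "f (c x) \<in> marked_points \<Sigma>'" using fx by (auto simp: marked_points_def)
      then have "c x \<in> marked_points \<Sigma>" using cx marked_preimage by blast
      then have z: "Im z = 0" using U(3) \<open>c x \<notin> punctures \<Sigma>\<close> by (auto simp: marked_points_def)
      show ?thesis
      proof (rule that[OF D(1,2) \<delta>])
        fix a b e e' assume ab: "0 \<le> a" "a < b" "b \<le> 1" "a \<le> x" "x \<le> b" "b - a < \<delta>"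
          and e: "e \<in> generic_curves" "e' \<in> generic_curves" "e 0 = c 0" "e 1 = c 1"
            "\<And>t. t \<in> {0..1} - {a<..<b} \<Longrightarrow> e' t = e t" "\<And>t. t \<in> {a..b} \<Longrightarrow> e t \<in> U \<and> e' t \<in> U"
        have "0 < a" "b < 1" using ab by (auto simp: \<delta>_def)
        then show "same_image e e'"
          using e ab by (intro same_image_boundary[OF U(1,2) z 4(2) e(1,2)]) auto
      qed
    qed
  qed
qed

text \<open>Outside (a,b) the two curves have to be equal, but not close to c. This makes the
  property additive in the interval, as bisection requires. For a = 0 and b = 1 it says that all
  generic curves near c with the ends of c have the same image class.\<close>

definition stable_on :: "(real \<Rightarrow> 'a) \<Rightarrow> (real \<times> 'a) set \<Rightarrow> real \<Rightarrow> real \<Rightarrow> bool" where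
  "stable_on c N a b \<longleftrightarrow> openin time_space N \<and> (\<forall>t\<in>{a..b}. (t, c t) \<in> N) \<and>
     (\<forall>e\<in>generic_curves. \<forall>e'\<in>generic_curves. e 0 = c 0 \<longrightarrow> e 1 = c 1 \<longrightarrow>
        (\<forall>t\<in>{0..1} - {a<..<b}. e' t = e t) \<longrightarrow> (\<forall>t\<in>{a..b}. (t, e t) \<in> N \<and> (t, e' t) \<in> N) \<longrightarrow> same_image e e')"

lemma stable_onD:
  assumes "stable_on c N a b"
  shows "openin time_space N" "\<And>t. t \<in> {a..b} \<Longrightarrow> (t, c t) \<in> N"
  using assms by (simp_all add: stable_on_def)

lemma stable_locally:
  assumes c: "c \<in> proper_curves \<Sigma>" and x: "x \<in> {0..1}"
  obtains \<delta> where "0 < \<delta>"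
    "\<And>a b. 0 \<le> a \<Longrightarrow> a < b \<Longrightarrow> b \<le> 1 \<Longrightarrow> a \<le> x \<Longrightarrow> x \<le> b \<Longrightarrow> b - a < \<delta> \<Longrightarrow> \<exists>N. stable_on c N a b"
proof -
  obtain U \<delta> where U: "openin X U" "c x \<in> U" "0 < \<delta>"
    "\<And>a b e e'. \<lbrakk>0 \<le> a; a < b; b \<le> 1; a \<le> x; x \<le> b; b - a < \<delta>; e \<in> generic_curves; e' \<in> generic_curves;
       e 0 = c 0; e 1 = c 1; (\<And>t. t \<in> {0..1} - {a<..<b} \<Longrightarrow> e' t = e t);
       (\<And>t. t \<in> {a..b} \<Longrightarrow> e t \<in> U \<and> e' t \<in> U)\<rbrakk> \<Longrightarrow> same_image e e'"
    using local_equivalence[OF c x] by metis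
  have p: "pathin X c" using c by (simp add: curves_avoiding_def)
  obtain \<epsilon> where e: "0 < \<epsilon>" "\<And>t. t \<in> {0..1} \<Longrightarrow> \<bar>t - x\<bar> < \<epsilon> \<Longrightarrow> c t \<in> U"
    using path_near[OF p x U(1,2)] by metis
  show thesis
  proof (rule that[of "min \<delta> \<epsilon>"])
    show "0 < min \<delta> \<epsilon>" using U e by simp
    fix a b assume ab: "0 \<le> a" "a < b" "b \<le> 1" "a \<le> x" "x \<le> b" "b - a < min \<delta> \<epsilon>"
    have "stable_on c ({0..1} \<times> U) a b"
      unfolding stable_on_def
    proof (intro conjI ballI impI)
      show "openin time_space ({0..1} \<times> U)" using U(1) by (simp add: openin_prod_Times_iff)
      show "(t, c t) \<in> {0..1} \<times> U" if "t \<in> {a..b}" for t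
        using that ab e(2)[of t] by auto
      show "same_image d d'" if "d \<in> generic_curves" "d' \<in> generic_curves" "d 0 = c 0" "d 1 = c 1"
        "\<forall>t\<in>{0..1} - {a<..<b}. d' t = d t" "\<forall>t\<in>{a..b}. (t, d t) \<in> {0..1} \<times> U \<and> (t, d' t) \<in> {0..1} \<times> U" for d d'
        using that ab by (intro U(4)[of a b d d']) auto
    qed
    then show "\<exists>N. stable_on c N a b" by blast
  qed
qed

lemma generic_patch:
  assumes "e \<in> generic_curves" "0 \<le> a" "a \<le> b" "b \<le> 1" "d a = e a" "d b = e b"
    and "continuous_map (top_of_set {a..b}) X d" "\<And>t. t \<in> {a<..<b} \<Longrightarrow> d t \<notin> obstacles"
  shows "patch a b d e \<in> generic_curves"
proof (rule curves_avoiding_patch[OF assms(1,2,4,5,6,3,7)])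
  fix t assume t: "t \<in> {a..b} \<inter> {0<..<1}"
  then have "e t \<notin> obstacles" using assms(1) by (auto simp: curves_avoiding_def)
  then show "d t \<notin> obstacles"
    using t assms(5,6,8) by (cases "t = a"; cases "t = b") auto
qed

text \<open>A generic curve close to \<open>c\<close> is first made to pass through the point where its competitor is at
  time \<open>b\<close>; the pieces before and after \<open>b\<close> can then be replaced one at a time.\<close>

lemma stable_concat:
  assumes c: "c \<in> proper_curves \<Sigma>" and abc: "0 \<le> a" "a < b" "b < c'" "c' \<le> 1"
    and N1: "stable_on c N1 a b" and N2: "stable_on c N2 b c'"
  shows "\<exists>N. stable_on c N a c'"
proof -
  have p: "pathin X c" using c by (simp add: curves_avoiding_def)
  have b: "b \<in> {0..1}" using abc by simp
  obtain \<delta> where \<delta>: "0 < \<delta>"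
    "\<And>a' b'. 0 \<le> a' \<Longrightarrow> a' < b' \<Longrightarrow> b' \<le> 1 \<Longrightarrow> a' \<le> b \<Longrightarrow> b \<le> b' \<Longrightarrow> b' - a' < \<delta> \<Longrightarrow> \<exists>N. stable_on c N a' b'"
    using stable_locally[OF c b] by metis
  define \<eta> where "\<eta> = Min {\<delta> / 4, (b - a) / 2, (c' - b) / 2}"
  have \<eta>: "0 < \<eta>" "2 * \<eta> < \<delta>" "\<eta> < b - a" "\<eta> < c' - b"
    using \<delta>(1) abc by (auto simp: \<eta>_def min_def)
  \<comment> \<open>Rerouting a curve near b changes it on both sides of b, which neither
    \<open>N1\<close> nor \<open>N2\<close> controls; hence a third neighbourhood, over an interval
    around b.\<close>
  obtain N3 where N3: "stable_on c N3 (b - \<eta>) (b + \<eta>)"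
    using \<delta>(2)[of "b - \<eta>" "b + \<eta>"] \<eta> abc by auto
  have op: "openin time_space N1" "openin time_space N2" "openin time_space N3"
    using stable_onD(1) N1 N2 N3 by blast+
  have "(b, c b) \<in> N1 \<inter> N2 \<inter> N3"
    using stable_onD(2)[OF N1, of b] stable_onD(2)[OF N2, of b] stable_onD(2)[OF N3, of b] abc \<eta> by auto
  then obtain \<epsilon>1 W1 where W1: "0 < \<epsilon>1" "openin X W1" "c b \<in> W1"
    "\<And>t x. t \<in> {0..1} \<Longrightarrow> \<bar>t - b\<bar> < \<epsilon>1 \<Longrightarrow> x \<in> W1 \<Longrightarrow> (t, x) \<in> N1 \<inter> N2 \<inter> N3"
    using open_box[of "N1 \<inter> N2 \<inter> N3" b "c b"] op by (metis openin_Int)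
  obtain W \<phi> g z r where W: "disc_chart X (c b) W \<phi> g z r" "W \<subseteq> W1" "W \<inter> obstacles \<subseteq> {c b}"
    by (rule chart_at[OF finite_obstacles obstacles_subset pathin_topspace[OF p b] W1(2,3)]) (rule that)
  note D = disc_chartD[OF W(1)]
  obtain \<epsilon>2 where e2: "0 < \<epsilon>2" "\<And>t. t \<in> {0..1} \<Longrightarrow> \<bar>t - b\<bar> < \<epsilon>2 \<Longrightarrow> c t \<in> W"
    using path_near[OF p b D(1,2)] by metis
  define \<epsilon> where "\<epsilon> = Min {\<epsilon>1 / 2, \<epsilon>2 / 2, \<eta>}"
  have e: "0 < \<epsilon>" "\<epsilon> < \<epsilon>1" "\<epsilon> < \<epsilon>2" "\<epsilon> \<le> \<eta>"
    using W1(1) e2(1) \<eta>(1) by (auto simp: \<epsilon>_def min_def)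
  define a' b' where "a' = b - \<epsilon>" and "b' = b + \<epsilon>"
  have ab': "a < a'" "a' < b" "b < b'" "b' < c'" "b - \<eta> \<le> a'" "b' \<le> b + \<eta>"
    using e \<eta> by (auto simp: a'_def b'_def)
  \<comment> \<open>The last condition keeps curves inside the chart domain W over [a',b']. Their
    points can be joined there off the obstacles, and every path in W over [a',b'] satisfies the
    other three conditions.\<close>
  define N where "N = {p \<in> topspace time_space. fst p \<in> {a..b} \<longrightarrow> p \<in> N1} \<inter>
     {p \<in> topspace time_space. fst p \<in> {b..c'} \<longrightarrow> p \<in> N2} \<inter>
     {p \<in> topspace time_space. fst p \<in> {b - \<eta>..b + \<eta>} \<longrightarrow> p \<in> N3} \<inter>
     {p \<in> topspace time_space. fst p \<in> {a'..b'} \<longrightarrow> p \<in> {0..1} \<times> W}"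
  have openN: "openin time_space N"
    unfolding N_def using op D(1) by (intro openin_Int open_over) (auto simp: openin_prod_Times_iff)
  have near: "(t, x) \<in> N1 \<inter> N2 \<inter> N3" if "t \<in> {a'..b'}" "x \<in> W" for t x
    using that W1(4)[of t x] W(2) ab' abc e by (auto simp: a'_def b'_def)
  have "stable_on c N a c'"
    unfolding stable_on_def
  proof (intro conjI ballI impI openN)
    show "(t, c t) \<in> N" if "t \<in> {a..c'}" for t
    proof -
      have "t \<in> {0..1}" using that abc by auto
      moreover have "c t \<in> W" if "t \<in> {a'..b'}"
        using e2(2)[OF \<open>t \<in> {0..1}\<close>] that e by (auto simp: a'_def b'_def)
      ultimately show ?thesis
        using stable_onD(2)[OF N1, of t] stable_onD(2)[OF N2, of t] stable_onD(2)[OF N3, of t]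
          pathin_topspace[OF p \<open>t \<in> {0..1}\<close>] by (auto simp: N_def)
    qed
    fix e e' assume gen: "e \<in> generic_curves" "e' \<in> generic_curves" and ends: "e 0 = c 0" "e 1 = c 1"
      and eq: "\<forall>t\<in>{0..1} - {a<..<c'}. e' t = e t"
      and in_N: "\<forall>t\<in>{a..c'}. (t, e t) \<in> N \<and> (t, e' t) \<in> N"
    have inW: "e t \<in> W \<and> e' t \<in> W" if "t \<in> {a'..b'}" for t
      using in_N[THEN bspec, of t] that ab' by (auto simp: N_def)
    obtain d1 where d1: "continuous_map (top_of_set {a'..b}) X d1" "d1 a' = e a'" "d1 b = e' b"
      "\<And>t. t \<in> {a'..b} \<Longrightarrow> d1 t \<in> W" "\<And>t. t \<in> {a'<..<b} \<Longrightarrow> d1 t \<notin> obstacles"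
      using disc_chart_connect[OF W(1,3), of "e a'" "e' b" a' b] inW[of a'] inW[of b] ab' by auto
    obtain d2 where d2: "continuous_map (top_of_set {b..b'}) X d2" "d2 b = e' b" "d2 b' = e b'"
      "\<And>t. t \<in> {b..b'} \<Longrightarrow> d2 t \<in> W" "\<And>t. t \<in> {b<..<b'} \<Longrightarrow> d2 t \<notin> obstacles"
      using disc_chart_connect[OF W(1,3), of "e' b" "e b'" b b'] inW[of b'] inW[of b] ab' by auto
    define d where "d = (\<lambda>t. if t \<le> b then d1 t else d2 t)"
    have d: "continuous_map (top_of_set {a'..b'}) X d" "d a' = e a'" "d b' = e b'" "d b = e' b"
      unfolding d_def using d1 d2 ab' by (auto intro!: continuous_map_join)
    have dW: "d t \<in> W" if "t \<in> {a'..b'}" for t using that d1(4) d2(4) by (auto simp: d_def)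
    have e'b: "e' b \<notin> obstacles" using gen(2) abc by (auto simp: curves_avoiding_def)
    have dobs: "d t \<notin> obstacles" if "t \<in> {a'<..<b'}" for t
      using that d1(3,5) d2(5) e'b by (cases t b rule: linorder_cases) (auto simp: d_def)
    define e1 where "e1 = patch a' b' d e"
    have e1_in: "e1 t = d t" if "t \<in> {a'..b'}" for t using that by (simp add: e1_def)
    have e1_out: "e1 t = e t" if "t \<notin> {a'<..<b'}" for t
    proof (cases "t \<in> {a'..b'}")
      case True
      then have "t = a' \<or> t = b'" using that by auto
      then show ?thesis using d(2,3) e1_in[OF True] by auto
    next
      case False
      then show ?thesis unfolding e1_def by (rule patch_outside)
    qed
    have e1: "e1 \<in> generic_curves"
      unfolding e1_def by (rule generic_patch[OF gen(1) _ _ _ d(2,3,1) dobs]) (use ab' abc in auto)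
    \<comment> \<open>\<open>e2\<close> follows e' up to b and e1 from then on, so e and e1 differ
      only near b, e1 and e2 only inside [a,b], and e2 and e' only inside [b,c'].\<close>
    define e2 where "e2 = patch a b e' e1"
    have e1a: "e1 a = e a" using ab' by (intro e1_out) auto
    have e1b: "e1 b = e' b" using e1_in[of b] d(4) ab' by auto
    have e'a: "e' a = e a" using eq abc by auto
    have e2_in: "e2 t = e' t" if "t \<in> {a..b}" for t using that by (simp add: e2_def)
    have e2_out: "e2 t = e1 t" if "t \<notin> {a<..<b}" for t
    proof (cases "t \<in> {a..b}")
      case True
      then have "t = a \<or> t = b" using that by auto
      then show ?thesis using e1a e1b e'a e2_in[OF True] by auto
    next
      case False
      then show ?thesis unfolding e2_def by (rule patch_outside)
    qed
    have e'path: "pathin X e'" "pathin X e" using gen by (auto simp: curves_avoiding_def)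
    have e2: "e2 \<in> generic_curves"
      unfolding e2_def
    proof (rule generic_patch[OF e1])
      show "continuous_map (top_of_set {a..b}) X e'" using path_restrict[OF e'path(1)] abc by simp
      show "e' t \<notin> obstacles" if "t \<in> {a<..<b}" for t
        using gen(2) that abc by (auto simp: curves_avoiding_def)
    qed (use abc e1a e1b e'a in auto)
    have e1_ends: "e1 0 = c 0" "e1 1 = c 1"
      using e1_out[of 0] e1_out[of 1] ab' abc ends by auto
    have e2_ends: "e2 0 = c 0" "e2 1 = c 1"
      using e2_out[of 0] e2_out[of 1] abc e1_ends by auto
    have e_N3: "(t, e t) \<in> N3" if "t \<in> {b - \<eta>..b + \<eta>}" for t
      using in_N[THEN bspec, of t] that \<eta> by (auto simp: N_def)
    have e_N: "(t, e t) \<in> N1 \<and> (t, e' t) \<in> N1" if "t \<in> {a..b}" for t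
      using in_N[THEN bspec, of t] that abc by (auto simp: N_def)
    have e_N': "(t, e t) \<in> N2 \<and> (t, e' t) \<in> N2" if "t \<in> {b..c'}" for t
      using in_N[THEN bspec, of t] that abc by (auto simp: N_def)
    have e1_N: "(t, e1 t) \<in> M" if "(t, e t) \<in> M" "N1 \<inter> N2 \<inter> N3 \<subseteq> M" for t M
      using that e1_in[of t] e1_out[of t] near[OF _ dW, of t t]
      by (cases "t \<in> {a'..b'}") auto
    have e1_N123: "(t, e t) \<in> N1 \<Longrightarrow> (t, e1 t) \<in> N1" "(t, e t) \<in> N2 \<Longrightarrow> (t, e1 t) \<in> N2"
      "(t, e t) \<in> N3 \<Longrightarrow> (t, e1 t) \<in> N3" for t
      using e1_N[of t] by blast+
    have s1: "same_image e e1"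
    proof -
      have "\<forall>t\<in>{0..1} - {b - \<eta><..<b + \<eta>}. e1 t = e t"
        using e1_out ab' by auto
      moreover have "\<forall>t\<in>{b - \<eta>..b + \<eta>}. (t, e t) \<in> N3 \<and> (t, e1 t) \<in> N3"
        using e_N3 e1_N123(3) by blast
      ultimately show ?thesis using N3 gen(1) e1 ends unfolding stable_on_def by blast
    qed
    have s2: "same_image e1 e2"
    proof -
      have "\<forall>t\<in>{0..1} - {a<..<b}. e2 t = e1 t" using e2_out by auto
      moreover have "\<forall>t\<in>{a..b}. (t, e1 t) \<in> N1 \<and> (t, e2 t) \<in> N1"
        using e_N e1_N123(1) e2_in by simp
      ultimately show ?thesis using N1 e1 e2 e1_ends unfolding stable_on_def by blast
    qed
    have s3: "same_image e2 e'"
    proof -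
      have "e' t = e2 t" if tt: "t \<in> {0..1} - {b<..<c'}" for t
      proof -
        consider "t < a" | "t \<in> {a..b}" | "c' \<le> t" using tt abc by fastforce
        then show ?thesis
        proof cases
          case 1
          then show ?thesis using e2_out[of t] e1_out[of t] eq tt ab' by auto
        next
          case 2
          then show ?thesis using e2_in by simp
        next
          case 3
          then show ?thesis using e2_out[of t] e1_out[of t] eq tt ab' abc by auto
        qed
      qed
      moreover have "\<forall>t\<in>{b..c'}. (t, e2 t) \<in> N2 \<and> (t, e' t) \<in> N2"
        using e_N' e1_N123(2) e2_out abc by simp
      ultimately show ?thesis using N2 e2 gen(2) e2_ends unfolding stable_on_def by blast
    qed
    show "same_image e e'" using s1 s2 s3 same_image_trans by blast
  qed
  then show ?thesis by blast
qed

text \<open>Bisection of [0,1], with \<open>stable_locally\<close> for short intervals and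
  \<open>stable_concat\<close> for adjacent ones.\<close>

lemma stable_exists:
  assumes c: "c \<in> proper_curves \<Sigma>"
  obtains N where "stable_on c N 0 1"
proof -
  define P where "P = (\<lambda>a b. 0 \<le> a \<longrightarrow> a < b \<longrightarrow> b \<le> 1 \<longrightarrow> (\<exists>N. stable_on c N a b))"
  have "P 0 1"
    using zero_le_one
  proof (induction rule: Bolzano)
    case (trans a b c')
    show ?case
      unfolding P_def
    proof (intro impI)
      assume ac: "0 \<le> a" "a < c'" "c' \<le> 1"
      consider "a = b" | "b = c'" | "a < b" "b < c'" using trans(3,4) by linarith
      then show "\<exists>N. stable_on c N a c'"
      proof cases
        case 3
        have "\<exists>N. stable_on c N a b" "\<exists>N. stable_on c N b c'"
          using trans(1,2) ac 3 unfolding P_def by auto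
        then show ?thesis using stable_concat[OF c ac(1) 3 ac(3)] by blast
      qed (use trans(1,2) ac in \<open>simp_all add: P_def\<close>)
    qed
  next
    case (local x)
    then have x: "x \<in> {0..1}" by simp
    obtain \<delta> where "0 < \<delta>"
      "\<And>a b. 0 \<le> a \<Longrightarrow> a < b \<Longrightarrow> b \<le> 1 \<Longrightarrow> a \<le> x \<Longrightarrow> x \<le> b \<Longrightarrow> b - a < \<delta> \<Longrightarrow> \<exists>N. stable_on c N a b"
      using stable_locally[OF c x] by metis
    then show ?case unfolding P_def by blast
  qed
  then show thesis using that unfolding P_def by auto
qed

section \<open>Limit classes of arbitrary curves\<close>

definition limit_class :: "(real \<Rightarrow> 'a) \<Rightarrow> 'b curve_class \<Rightarrow> bool" where
  "limit_class c \<kappa> \<longleftrightarrow> (\<exists>N. openin time_space N \<and> (\<forall>t\<in>{0..1}. (t, c t) \<in> N) \<and>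
     (\<forall>d\<in>generic_curves. d 0 = c 0 \<longrightarrow> d 1 = c 1 \<longrightarrow> (\<forall>t\<in>{0..1}. (t, d t) \<in> N) \<longrightarrow>
        reduced_class \<Sigma>' (f \<circ> d) = \<kappa>))"

text \<open>The intersection of two neighbourhoods of the graph still contains a generic curve with
  the right ends, by \<open>approximate_generic\<close>.\<close>

lemma limit_class_unique:
  assumes c: "c \<in> curves \<Sigma>" and "limit_class c \<kappa>" "limit_class c \<kappa>'"
  shows "\<kappa> = \<kappa>'"
proof -
  obtain N where N: "openin time_space N" "\<forall>t\<in>{0..1}. (t, c t) \<in> N"
    "\<forall>d\<in>generic_curves. d 0 = c 0 \<longrightarrow> d 1 = c 1 \<longrightarrow> (\<forall>t\<in>{0..1}. (t, d t) \<in> N) \<longrightarrow> reduced_class \<Sigma>' (f \<circ> d) = \<kappa>"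
    using assms(2) unfolding limit_class_def by blast
  obtain N' where N': "openin time_space N'" "\<forall>t\<in>{0..1}. (t, c t) \<in> N'"
    "\<forall>d\<in>generic_curves. d 0 = c 0 \<longrightarrow> d 1 = c 1 \<longrightarrow> (\<forall>t\<in>{0..1}. (t, d t) \<in> N') \<longrightarrow> reduced_class \<Sigma>' (f \<circ> d) = \<kappa>'"
    using assms(3) unfolding limit_class_def by blast
  have "openin time_space (N \<inter> N')" using N(1) N'(1) by (rule openin_Int)
  moreover have "(t, c t) \<in> N \<inter> N'" if "t \<in> {0..1}" for t using N(2) N'(2) that by blast
  moreover have "pathin X c" "c 0 \<in> marked_points \<Sigma>" "c 1 \<in> marked_points \<Sigma>" using curvesD[OF c] by auto
  ultimately obtain d where "d \<in> generic_curves" "d 0 = c 0" "d 1 = c 1" "\<And>t. t \<in> {0..1} \<Longrightarrow> (t, d t) \<in> N \<inter> N'"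
    using approximate_generic[of c "N \<inter> N'" "{}"] by (metis finite.emptyI empty_subsetI)
  then show ?thesis using N(3) N'(3) by (metis IntE)
qed

lemma limit_class_generic:
  assumes "c \<in> generic_curves"
  shows "limit_class c (reduced_class \<Sigma>' (f \<circ> c))"
proof -
  obtain N where N: "stable_on c N 0 1"
    using stable_exists[OF generic_proper[OF assms]] by blast
  have "reduced_class \<Sigma>' (f \<circ> d) = reduced_class \<Sigma>' (f \<circ> c)"
    if "d \<in> generic_curves" "d 0 = c 0" "d 1 = c 1" "\<forall>t\<in>{0..1}. (t, d t) \<in> N" for d
  proof -
    have "\<forall>t\<in>{0..1} - {0<..<1}. c t = d t" using that by force
    then have "same_image d c"
      using N that assms unfolding stable_on_def by blast
    then show ?thesis by (simp add: same_image_def reduced_class_eq_iff)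
  qed
  then show ?thesis using stable_onD[OF N] unfolding limit_class_def by blast
qed

lemma limit_class_proper:
  assumes c: "c \<in> proper_curves \<Sigma>"
  shows "\<exists>\<kappa>. limit_class c \<kappa>"
proof -
  obtain N where N: "stable_on c N 0 1" using stable_exists[OF c] by blast
  then have N': "openin time_space N" "\<forall>t\<in>{0..1}. (t, c t) \<in> N" using stable_onD by blast+
  obtain e where e: "e \<in> generic_curves" "e 0 = c 0" "e 1 = c 1" "\<And>t. t \<in> {0..1} \<Longrightarrow> (t, e t) \<in> N"
    using approximate_generic[of c N "{}"] c N' by (auto simp: curves_avoiding_def)
  have "reduced_class \<Sigma>' (f \<circ> d) = reduced_class \<Sigma>' (f \<circ> e)"
    if "d \<in> generic_curves" "d 0 = c 0" "d 1 = c 1" "\<forall>t\<in>{0..1}. (t, d t) \<in> N" for d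
  proof -
    have "\<forall>t\<in>{0..1} - {0<..<1}. e t = d t" using that e by force
    then have "same_image d e"
      using N that e unfolding stable_on_def by blast
    then show ?thesis by (simp add: same_image_def reduced_class_eq_iff)
  qed
  then show ?thesis using N' unfolding limit_class_def by blast
qed

text \<open>Covers the constant curves at ordinary punctures, which \<open>stable_exists\<close>
  does not reach. A small generic loop is contracted linearly in the chart: if p is an obstacle, the
  stages before the last meet it only at their ends, and the last stage is a constant curve, which
  \<open>curves\<close> admits.\<close>

lemma limit_class_constant:
  assumes p: "p \<in> marked_points \<Sigma>" and c: "\<And>t. t \<in> {0..1} \<Longrightarrow> c t = p"
  shows "limit_class c (reduced_class \<Sigma>' (\<lambda>t. f p))"
proof -
  have pt: "p \<in> topspace X" using p tame_source by auto
  obtain U \<phi> g z r where U: "disc_chart X p U \<phi> g z r" "U \<inter> obstacles \<subseteq> {p}"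
    by (rule chart_at[OF finite_obstacles obstacles_subset pt openin_topspace pt]) (rule that)
  note D = disc_chartD[OF U(1)]
  have "reduced_class \<Sigma>' (f \<circ> d) = reduced_class \<Sigma>' (\<lambda>t. f p)"
    if d: "d \<in> generic_curves" "d 0 = c 0" "d 1 = c 1" "\<forall>t\<in>{0..1}. (t, d t) \<in> {0..1} \<times> U" for d
  proof -
    let ?k = "\<lambda>s t. (1 - s) *\<^sub>R \<phi> (d t) + s *\<^sub>R z"
    have dU: "d t \<in> U" if "t \<in> {0..1}" for t using d(4) that by auto
    have d01: "d 0 = p" "d 1 = p" using d(2,3) c by auto
    have pd: "pathin X d" using d(1) by (simp add: curves_avoiding_def)
    have kC: "?k s t \<in> ball z r \<inter> half_plane" if "s \<in> {0..1}" "t \<in> {0..1}" for s t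
      using that by (intro convexD_alt[OF convex_half_disc] D(10) dU D(4)) (simp_all only: atLeastAtMost_iff)
    have "(f \<circ> d, \<lambda>t. f p) \<in> curve_homotopy \<Sigma>'"
    proof (rule curve_homotopy_patch[OF generic_image[OF d(1)] order_refl zero_le_one order_refl _ _ kC, where g = "\<lambda>w. f (g w)"])
      show "continuous_map (top_of_set (ball z r \<inter> half_plane)) Y (\<lambda>w. f (g w))"
        using D(7) continuous_f by (rule continuous_map_comp)
      have "continuous_on {0..1} (\<lambda>t. \<phi> (d t))"
        using disc_chart_path[OF U(1) pd[unfolded pathin_def]] dU by auto
      then have "continuous_on ({0..1::real} \<times> {0..1}) (\<lambda>x. \<phi> (d (snd x)))"
        by (rule continuous_on_compose2) (auto intro: continuous_intros)
      then show "continuous_on ({0..1} \<times> {0..1}) (\<lambda>(s, t). ?k s t)"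
        unfolding case_prod_unfold by (intro continuous_intros) auto
      fix s :: real assume s: "s \<in> {0..1}"
      show "f (g (?k s 0)) = (f \<circ> d) 0 \<and> f (g (?k s 1)) = (f \<circ> d) 1"
        using d01 D by (simp flip: scaleR_left_distrib)
      show "(\<forall>t\<in>{0..1} \<inter> {0<..<1}. f (g (?k s t)) \<notin> punctures \<Sigma>') \<or>
          (0::real) = 0 \<and> (1::real) = 1 \<and> (\<forall>t\<in>{0..1}. f (g (?k s t)) = f (g (?k s 0)))"
      proof (cases "s = 1")
        case False
        have "f (g (?k s t)) \<notin> punctures \<Sigma>'" if t: "t \<in> {0<..<1}" for t
        proof
          assume o: "f (g (?k s t)) \<in> punctures \<Sigma>'"
          have t01: "t \<in> {0..1}" using t by simp
          have "g (?k s t) \<in> obstacles"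
            using o D(3) D(8)[OF kC[OF s t01]] by (auto simp: obstacles_def)
          moreover from this have gp: "g (?k s t) = p" using U(2) D(8)[OF kC[OF s t01]] by blast
          ultimately have po: "p \<in> obstacles" by simp
          have "?k s t = z" using gp D(9)[OF kC[OF s t01]] D(6) by simp
          then have "(1 - s) *\<^sub>R (\<phi> (d t) - z) = 0" by (simp add: algebra_simps)
          then have "\<phi> (d t) = z" using False by simp
          then have "d t = p" using D(11)[OF dU[OF t01]] D(5) by simp
          then show False using po d(1) t by (auto simp: curves_avoiding_def)
        qed
        then show ?thesis by blast
      qed auto
    qed (use D dU d01 in auto)
    then show ?thesis by (simp add: reduced_class_eq_iff curve_homotopy_reduced)
  qed
  moreover have "openin time_space ({0..1} \<times> U)" using D(1) by (simp add: openin_prod_Times_iff)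
  moreover have "\<forall>t\<in>{0..1}. (t, c t) \<in> {0..1} \<times> U" using c D(2) by simp
  ultimately show ?thesis unfolding limit_class_def by blast
qed

lemma limit_class_exists:
  assumes c: "c \<in> curves \<Sigma>"
  shows "\<exists>\<kappa>. limit_class c \<kappa>"
proof (cases "c \<in> proper_curves \<Sigma>")
  case True
  then show ?thesis by (rule limit_class_proper)
next
  case False
  then have "\<forall>t\<in>{0..1}. c t = c 0"
    using c unfolding curves_def curves_avoiding_def by blast
  then show ?thesis using limit_class_constant[of "c 0" c] curvesD[OF c] by blast
qed

text \<open>By the tube lemma, a neighbourhood that determines the limit class at stage s contains
  the graphs of all stages near s. As the ends do not move, it determines their limit classes too,
  and [0,1] is connected.\<close>

lemma limit_class_homotopy:
  assumes cd: "(c, d) \<in> curve_homotopy \<Sigma>" and \<kappa>: "limit_class c \<kappa>"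
  shows "limit_class d \<kappa>"
proof -
  let ?I = "top_of_set {0..1::real}"
  obtain h :: "real \<times> real \<Rightarrow> 'a" where h: "continuous_map (prod_topology ?I ?I) X h"
    "\<And>t. h (0, t) = c t" "\<And>t. h (1, t) = d t"
    "\<And>s. s \<in> {0..1} \<Longrightarrow> (\<lambda>t. h (s, t)) \<in> curves \<Sigma> \<and> h (s, 0) = c 0 \<and> h (s, 1) = c 1"
    by (rule curve_homotopyE[OF cd]) (rule that)
  define F where "F = (\<lambda>s. THE \<kappa>. limit_class (\<lambda>t. h (s, t)) \<kappa>)"
  have F: "limit_class (\<lambda>t. h (s, t)) (F s)" if "s \<in> {0..1}" for s
  proof -
    have "\<exists>!\<kappa>. limit_class (\<lambda>t. h (s, t)) \<kappa>"
      using limit_class_exists limit_class_unique h(4)[OF that] by blast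
    then show ?thesis unfolding F_def by (rule theI')
  qed
  have F_eq: "F s = \<kappa>" if "s \<in> {0..1}" "limit_class (\<lambda>t. h (s, t)) \<kappa>" for s \<kappa>
    using limit_class_unique[OF _ F[OF that(1)] that(2)] h(4)[OF that(1)] by blast
  have "F constant_on {0..1}"
  proof (rule locally_constant_imp_constant)
    fix s :: real assume s: "s \<in> {0..1}"
    obtain N where N: "openin time_space N" "\<forall>t\<in>{0..1}. (t, h (s, t)) \<in> N"
      "\<forall>e\<in>generic_curves. e 0 = h (s, 0) \<longrightarrow> e 1 = h (s, 1) \<longrightarrow> (\<forall>t\<in>{0..1}. (t, e t) \<in> N) \<longrightarrow>
        reduced_class \<Sigma>' (f \<circ> e) = F s"
      using F[OF s] unfolding limit_class_def by blast
    have "continuous_map (prod_topology ?I ?I) time_space (\<lambda>x. (snd x, h x))"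
      using h(1) continuous_map_snd[of ?I ?I] by (simp only: continuous_map_pairwise o_def fst_conv snd_conv eta_contract_eq simp_thms)
    then have op: "openin (prod_topology ?I ?I) {x \<in> topspace (prod_topology ?I ?I). (snd x, h x) \<in> N}"
      using N(1) by (rule openin_continuous_map_preimage)
    have "{s} \<times> {0..1} \<subseteq> {x \<in> topspace (prod_topology ?I ?I). (snd x, h x) \<in> N}"
      using N(2) s by auto
    then obtain S V where SV: "openin ?I S" "openin ?I V" "s \<in> S" "{0..1} \<subseteq> V"
      "S \<times> V \<subseteq> {x \<in> topspace (prod_topology ?I ?I). (snd x, h x) \<in> N}"
      using tube_lemma_right[OF op, of "{0..1}" s] s
      by (auto simp: compactin_subtopology)
    have "F s' = F s" if s': "s' \<in> S" for s'
    proof (rule F_eq)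
      show s'I: "s' \<in> {0..1}" using openin_subset[OF SV(1)] s' by auto
      have "\<forall>t\<in>{0..1}. (t, h (s', t)) \<in> N"
      proof
        fix t :: real assume "t \<in> {0..1}"
        then have "(s', t) \<in> S \<times> V" using SV(4) s' by blast
        then have "(s', t) \<in> {x \<in> topspace (prod_topology ?I ?I). (snd x, h x) \<in> N}" using SV(5) by blast
        then show "(t, h (s', t)) \<in> N" by simp
      qed
      then show "limit_class (\<lambda>t. h (s', t)) (F s)"
        unfolding limit_class_def using N(1,3) h(4)[OF s'I] h(4)[OF s] by auto
    qed
    then show "\<exists>T. openin (top_of_set {0..1}) T \<and> s \<in> T \<and> (\<forall>x\<in>T. F x = F s)"
      using SV by blast
  qed auto
  then have "F 0 = F 1" unfolding constant_on_def by (metis atLeastAtMost_iff order_refl zero_le_one)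
  moreover have "F 0 = \<kappa>" using \<kappa> h(2) by (intro F_eq) auto
  moreover have "limit_class d (F 1)" using F[of 1] h(3) by simp
  ultimately show ?thesis by simp
qed

end

section \<open>Limit classes and crossing resolutions\<close>

lemma curve_homotopy_cong:
  assumes c: "c \<in> curves \<Sigma>" and eq: "\<And>t. t \<in> {0..1} \<Longrightarrow> d t = c t"
  shows "(c, d) \<in> curve_homotopy \<Sigma>"
proof (rule curve_homotopyI)
  have "pathin (surface_space \<Sigma>) c" using c by (simp add: curves_def)
  then show "continuous_map (prod_topology (top_of_set {0..1}) (top_of_set {0..1})) (surface_space \<Sigma>)
      (\<lambda>x::real \<times> real. c (snd x))"
    unfolding pathin_def by (rule continuous_map_comp[OF continuous_map_snd])
qed (use c eq in auto)

text \<open>\<open>h\<close> parametrises the disc bounded by the loop and \<open>w\<close> is the parameter of the enclosed puncture;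
  the loop is pulled inwards, towards \<open>w\<close>, along a path that is traversed back and forth.\<close>

lemma shrink_loop:
  fixes G :: "real \<Rightarrow> complex" and w :: complex
  assumes e: "e \<in> proper_curves \<Sigma>" and ab: "0 \<le> a" "a < b" "b \<le> 1" and w: "w \<in> ball 0 1"
    and h: "continuous_map (top_of_set (cball 0 1)) (surface_space \<Sigma>) h" "inj_on h (cball 0 1)"
      "h ` ball 0 1 \<inter> (marked_points \<Sigma> \<union> special_punctures \<Sigma>) = {h w}"
    and G: "continuous_on {a..b} G" "\<And>t. t \<in> {a..b} \<Longrightarrow> w + exp (G t) \<in> cball 0 1"
    and eG: "\<And>t. t \<in> {a..b} \<Longrightarrow> e t = h (w + exp (G t))" and M: "0 < M"
    and \<mu>: "continuous_on {a..b} \<mu>" "\<mu> a = a" "\<mu> b = b" "\<And>t. t \<in> {a..b} \<Longrightarrow> \<mu> t \<in> {a..b}"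
    and \<beta>: "continuous_on {a..b} \<beta>" "\<beta> a = 0" "\<beta> b = 0" "\<And>t. t \<in> {a<..<b} \<Longrightarrow> 0 < \<beta> t"
    and e1: "\<And>t. t \<in> {a..b} \<Longrightarrow> e1 t = h (w + exp (G (\<mu> t) - of_real (M * \<beta> t)))"
      "\<And>t. t \<in> {0..1} - {a..b} \<Longrightarrow> e1 t = e t"
  shows "(e, e1) \<in> curve_homotopy \<Sigma>"
proof -
  define \<tau> where "\<tau> = (\<lambda>s t. (1 - s) *\<^sub>R t + s *\<^sub>R \<mu> t)"
  define k where "k = (\<lambda>s t. w + exp (G (\<tau> s t) - of_real (s * M * \<beta> t)))"
  let ?D = "{0..1} \<times> {a..b}"
  have \<beta>0: "0 \<le> \<beta> t" if "t \<in> {a..b}" for t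
    using \<beta>(2,3) \<beta>(4)[of t] that by (cases "t = a"; cases "t = b") auto
  have \<tau>: "\<tau> s t \<in> {a..b}" if "s \<in> {0..1}" "t \<in> {a..b}" for s t
    unfolding \<tau>_def using that \<mu>(4)[OF that(2)] by (intro convexD_alt) (simp_all only: atLeastAtMost_iff convex_real_interval)
  have snd_cont: "continuous_on ?D (\<lambda>x. j (snd x))" if "continuous_on {a..b} j" for j :: "real \<Rightarrow> real"
    by (rule continuous_on_compose2[OF that]) (auto intro: continuous_intros)
  have \<tau>c: "continuous_on ?D (\<lambda>x. \<tau> (fst x) (snd x))"
    unfolding \<tau>_def by (intro continuous_intros snd_cont \<mu>)
  have G\<tau>: "continuous_on ?D (\<lambda>x. G (\<tau> (fst x) (snd x)))"
    by (rule continuous_on_compose2[OF G(1) \<tau>c]) (use \<tau> in auto)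
  have kc: "continuous_on ?D (\<lambda>(s, t). k s t)"
    unfolding k_def case_prod_unfold by (intro continuous_intros G\<tau> snd_cont \<beta>)
  \<comment> \<open>Scaling the exponential forms a convex combination of w and a point of the loop.
    So the homotopy stays in the closed disc, and it enters the open disc as soon as s * \<beta> t >
    0, because w lies in the open disc.\<close>
  have kform: "k s t = (1 - exp (- (s * M * \<beta> t))) *\<^sub>R w + exp (- (s * M * \<beta> t)) *\<^sub>R (w + exp (G (\<tau> s t)))" for s t
  proof -
    have "exp (G (\<tau> s t) - of_real (s * M * \<beta> t)) = exp (- (s * M * \<beta> t)) *\<^sub>R exp (G (\<tau> s t))"
      by (simp add: exp_diff exp_minus scaleR_conv_of_real divide_inverse flip: exp_of_real)
    then show ?thesis by (simp add: k_def algebra_simps)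
  qed
  have kC: "k s t \<in> cball 0 1" if "s \<in> {0..1}" "t \<in> {a..b}" for s t
  proof -
    have "0 \<le> s * M * \<beta> t" using that \<beta>0[OF that(2)] M by auto
    then show ?thesis
      unfolding kform using w G(2)[OF \<tau>[OF that]] by (intro convexD_alt) auto
  qed
  have kB: "k s t \<in> ball 0 1" if "s \<in> {0..1}" "t \<in> {a..b}" "0 < s * \<beta> t" for s t
  proof -
    define l where "l = exp (- (s * M * \<beta> t))"
    have "0 < s * \<beta> t * M" using that(3) M by (rule mult_pos_pos)
    then have l: "0 < l" "l < 1" by (auto simp: l_def ac_simps)
    have "norm (k s t) \<le> norm ((1 - l) *\<^sub>R w) + norm (l *\<^sub>R (w + exp (G (\<tau> s t))))"
      unfolding kform l_def by (rule norm_triangle_ineq)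
    also have "\<dots> = (1 - l) * norm w + l * norm (w + exp (G (\<tau> s t)))" using l by simp
    also have "\<dots> < (1 - l) * 1 + l * 1"
      using l w G(2)[OF \<tau>[OF that(1,2)]] by (intro add_less_le_mono mult_strict_left_mono mult_left_mono) auto
    finally show ?thesis by simp
  qed
  have k0: "k 0 t = w + exp (G t)" for t by (simp add: k_def \<tau>_def)
  have k1: "k 1 t = w + exp (G (\<mu> t) - of_real (M * \<beta> t))" for t by (simp add: k_def \<tau>_def)
  have ka: "k s a = w + exp (G a)" "k s b = w + exp (G b)" for s
    using \<mu>(2,3) \<beta>(2,3) by (simp_all add: k_def \<tau>_def flip: scaleR_left_distrib distrib_right)
  have eav: "e t \<notin> punctures \<Sigma>" if "t \<in> {0<..<1}" for t
    using e that by (auto simp: curves_avoiding_def)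
  show ?thesis
  proof (rule curve_homotopy_patch[OF e ab(1) less_imp_le[OF ab(2)] ab(3) h(1) kc kC])
    show "h (k s a) = e a \<and> h (k s b) = e b" for s
      using ka eG[of a] eG[of b] ab by simp
    show "h (k 0 t) = e t" if "t \<in> {a..b}" for t using k0 eG[OF that] by simp
    show "h (k 1 t) = e1 t" if "t \<in> {a..b}" for t using k1 e1(1)[OF that] by simp
    show "e1 t = e t" if "t \<in> {0..1} - {a..b}" for t using e1(2)[OF that] .
    fix s :: real assume s: "s \<in> {0..1}"
    show "(\<forall>t\<in>{a..b} \<inter> {0<..<1}. h (k s t) \<notin> punctures \<Sigma>) \<or>
        a = 0 \<and> b = 1 \<and> (\<forall>t\<in>{0..1}. h (k s t) = h (k s 0))"
    proof (intro disjI1 ballI)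
      fix t assume t: "t \<in> {a..b} \<inter> {0<..<1}"
      show "h (k s t) \<notin> punctures \<Sigma>"
      proof (cases "s = 0 \<or> t = a \<or> t = b")
        case True
        then have "h (k s t) = e t" using k0 ka eG[of t] t by auto
        then show ?thesis using eav t by simp
      next
        case False
        then have "0 < s * \<beta> t" using s t \<beta>(4)[of t] by auto
        then have kb: "k s t \<in> ball 0 1" using kB s t by blast
        have "k s t \<noteq> w" by (simp add: k_def)
        then have "h (k s t) \<noteq> h w" using inj_onD[OF h(2), of "k s t" w] kb w by auto
        then show ?thesis using h(3) kb by (auto simp: marked_points_def)
      qed
    qed
  qed
qed

context tame_morphism
begin

text \<open>Both c and its reversal are shrunk, along common tails, into a small disc around the
  enclosed puncture q. There f is injective, and the images of the two small loops turn k and -k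
  times around the special puncture f q. The difference 2 k is even whatever k is, so
  \<open>even_turns_reduced_equiv\<close> identifies the images.\<close>

lemma limit_class_crossing:
  assumes c: "c \<in> curves \<Sigma>" and enc: "encloses_one_special \<Sigma> c a b" and \<kappa>: "limit_class c \<kappa>"
  shows "limit_class (reverse_loop a b c) \<kappa>"
proof -
  define d where "d = reverse_loop a b c"
  have ab: "0 \<le> a" "a < b" "b \<le> 1" "c a = c b" "inj_on c {a..<b}"
    using enc by (auto simp: encloses_one_special_def)
  obtain h :: "complex \<Rightarrow> 'a" and q where emb: "embedding_map (top_of_set (cball 0 1)) X h"
    and hs: "h ` sphere 0 1 = c ` {a..b}" and q: "q \<in> special_punctures \<Sigma>"
    and hq: "h ` ball 0 1 \<inter> (marked_points \<Sigma> \<union> special_punctures \<Sigma>) = {q}"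
    using enc unfolding encloses_one_special_def by (elim conjE exE bexE) (rule that)
  have cp: "c \<in> proper_curves \<Sigma>" using loop_proper[OF c ab(1-3,5)] .
  have dc: "d \<in> curves \<Sigma>" unfolding d_def using reverse_loop_curve[OF c ab(1-5)] .
  have d_in: "d t = c (a + b - t)" if "t \<in> {a..b}" for t using that by (simp add: d_def reverse_loop_def)
  have d_out: "d t = c t" if "t \<notin> {a<..<b}" for t
    using that ab(2,4) by (cases "t = a"; cases "t = b") (auto simp: d_def reverse_loop_def)
  have "inj_on d {a..<b}"
  proof (rule inj_onI)
    have inj: "x = y" if "x \<in> {a<..b}" "y \<in> {a<..b}" "c x = c y" for x y
      using that ab unfolding inj_on_def
      by (smt (verit) atLeastLessThan_iff greaterThanAtMost_iff)
    fix x y assume "x \<in> {a..<b}" "y \<in> {a..<b}" "d x = d y"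
    then show "x = y" using inj[of "a + b - x" "a + b - y"] d_in[of x] d_in[of y] by auto
  qed
  then have dp: "d \<in> proper_curves \<Sigma>" using loop_proper[OF dc ab(1-3)] by blast
  obtain hi where hi: "homeomorphic_maps (top_of_set (cball 0 1)) (subtopology X (h ` cball 0 1)) h hi"
    using emb unfolding embedding_map_def homeomorphic_map_maps topspace_euclidean_subtopology by blast
  have hc: "continuous_map (top_of_set (cball 0 1)) X h"
    by (rule continuous_map_into_fulltopology[of _ _ "h ` cball 0 1"]) (use hi in \<open>simp add: homeomorphic_maps_def\<close>)
  have hil: "hi (h z) = z" if "z \<in> cball 0 1" for z
    using hi that by (auto simp: homeomorphic_maps_def)
  have hinj: "inj_on h (cball 0 1)" using hil by (rule inj_on_inverseI)
  have "q \<in> h ` ball 0 1 \<inter> (marked_points \<Sigma> \<union> special_punctures \<Sigma>)" unfolding hq by (rule singletonI)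
  then obtain w where w: "w \<in> ball 0 1" "h w = q" by (auto simp del: mem_ball)
  have ct: "\<exists>z\<in>sphere 0 1. c t = h z" if "t \<in> {a..b}" for t using hs that by (metis imageE imageI)
  define cc where "cc = (\<lambda>t. hi (c t))"
  have cc: "cc t \<in> sphere 0 1" "h (cc t) = c t" if "t \<in> {a..b}" for t
    using ct[OF that] hil by (force simp: cc_def)+
  have pc: "pathin X c" using cp by (simp add: curves_avoiding_def)
  have ccc: "continuous_on {a..b} cc"
  proof -
    have "c t \<in> h ` cball 0 1" if "t \<in> {a..b}" for t
      using ct[OF that] by auto
    then have "continuous_map (top_of_set {a..b}) (subtopology X (h ` cball 0 1)) c"
      using path_restrict[OF pc ab(1,3)] by (auto simp: continuous_map_in_subtopology)
    moreover have "continuous_map (subtopology X (h ` cball 0 1)) (top_of_set (cball 0 1)) hi"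
      using hi by (simp add: homeomorphic_maps_def)
    ultimately have "continuous_map (top_of_set {a..b}) (top_of_set (cball 0 1)) cc"
      unfolding cc_def by (rule continuous_map_comp)
    then show ?thesis by simp
  qed
  have "continuous_on {a..b} (\<lambda>t. cc t - w)" by (intro continuous_intros ccc)
  moreover have "cc t - w \<noteq> 0" if "t \<in> {a..b}" for t using cc(1)[OF that] w(1) by auto
  ultimately obtain G where G: "continuous_on {a..b} G" "\<And>t. t \<in> {a..b} \<Longrightarrow> cc t - w = exp (G t)"
    using continuous_logarithm_on_contractible[of "{a..b}" "\<lambda>t. cc t - w"] convex_imp_contractible
    by (metis convex_real_interval(5))
  have wG: "w + exp (G t) = cc t" if "t \<in> {a..b}" for t using G(2)[OF that] by (simp add: algebra_simps)
  have "exp (G b) = exp (G a)" using G(2)[of a] G(2)[of b] ab by (simp add: cc_def)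
  then obtain k :: int where k: "G b = G a + of_int (2 * k) * of_real pi * \<i>"
    unfolding exp_eq by (metis of_int_mult of_int_numeral of_real_mult of_real_of_int_eq)
  have per: "exp (z + of_int (2 * n) * of_real pi * \<i>) = exp z" for z n
  proof -
    have "z + of_int (2 * n) * of_real pi * \<i> = z + \<i> * (of_int n * (of_real pi * 2))" by simp
    then show ?thesis by (simp only: exp_plus_2pin)
  qed
  \<comment> \<open>A special puncture of \<Sigma> is not a branch point, so f is injective near q
    and carries a small disc around it to a special disc of \<Sigma>'.\<close>
  obtain \<rho> where \<rho>: "0 < \<rho>" "\<rho> \<le> 1" "ball w \<rho> \<subseteq> ball 0 1" "special_disc \<Sigma>' (\<lambda>z. f (h (w + z))) \<rho>"
    "\<And>z. z \<in> ball w \<rho> - {w} \<Longrightarrow> h z \<notin> obstacles"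
  proof -
    have qX: "q \<in> topspace X" "q \<notin> branch_points \<Sigma> \<Sigma>' f"
      using q tame_source by (auto simp: branch_points_def)
    obtain U1 where U1: "openin X U1" "q \<in> U1" "inj_on f U1" using locally_injective qX by blast
    define F where "F = marked_points \<Sigma>' \<union> special_punctures \<Sigma>' - {f q}"
    have F: "closedin Y F"
    proof -
      have "F \<subseteq> topspace Y" "finite F" using tame_target by (auto simp: F_def)
      then show ?thesis using Hausdorff_imp_t1_space[OF tame_target(1)] t1_space_closedin_finite by blast
    qed
    have U2: "openin X {x \<in> topspace X. f x \<in> topspace Y - F}"
      using F by (intro openin_continuous_map_preimage[OF continuous_f]) auto
    have "closedin X (obstacles - {q})"
      using finite_obstacles obstacles_subset Hausdorff_imp_t1_space[OF tame_source(1)]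
      by (meson Diff_subset finite_Diff order_trans t1_space_closedin_finite)
    then have U3: "openin X (topspace X - (obstacles - {q}))" by blast
    define U where "U = U1 \<inter> {x \<in> topspace X. f x \<in> topspace Y - F} \<inter> (topspace X - (obstacles - {q}))"
    have U: "openin X U" unfolding U_def using U1(1) U2 U3 by (intro openin_Int)
    have fq: "f q \<in> special_punctures \<Sigma>'" using q special_image by blast
    have qU: "q \<in> U"
      using U1(2) qX continuous_map_image_subset_topspace[OF continuous_f] by (auto simp: U_def F_def)
    have "openin (top_of_set (cball 0 1)) {z \<in> topspace (top_of_set (cball 0 1)). h z \<in> U}"
      using hc U by (rule openin_continuous_map_preimage)
    moreover have "w \<in> {z \<in> topspace (top_of_set (cball 0 1)). h z \<in> U}" using w qU by auto
    ultimately obtain r where r: "0 < r" "ball w r \<inter> cball 0 1 \<subseteq> {z \<in> topspace (top_of_set (cball 0 1)). h z \<in> U}"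
      unfolding openin_contains_ball by blast
    obtain r' where r': "0 < r'" "ball w r' \<subseteq> ball 0 1" using w(1) open_contains_ball open_ball by blast
    define \<rho> where "\<rho> = min 1 (min r r')"
    have \<rho>: "0 < \<rho>" "\<rho> \<le> 1" using r r' by (auto simp: \<rho>_def)
    have sub: "ball w \<rho> \<subseteq> ball 0 1" using r'(2) by (auto simp: \<rho>_def)
    have inU: "h z \<in> U" if "z \<in> ball w \<rho>" for z
    proof -
      have "z \<in> ball w r \<inter> cball 0 1" using that sub by (auto simp: \<rho>_def)
      then show ?thesis using r(2) by blast
    qed
    have fh: "z = z'" if "z \<in> ball w \<rho>" "z' \<in> ball w \<rho>" "f (h z) = f (h z')" for z z'
    proof -
      have "h z = h z'" using inj_onD[OF U1(3)] inU that by (auto simp: U_def)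
      moreover have "z \<in> cball 0 1" "z' \<in> cball 0 1" using that(1,2) sub by auto
      ultimately show ?thesis using inj_onD[OF hinj] by blast
    qed
    show thesis
    proof (rule that[OF \<rho> sub])
      show "special_disc \<Sigma>' (\<lambda>z. f (h (w + z))) \<rho>"
        unfolding special_disc_def
      proof (intro conjI ballI)
        show "Hausdorff_space Y" by (rule tame_target)
        have tr: "w + z \<in> ball w \<rho>" if "z \<in> ball 0 \<rho>" for z using that by (simp add: dist_norm)
        show "continuous_map (top_of_set (ball 0 \<rho>)) Y (\<lambda>z. f (h (w + z)))"
        proof (rule continuous_map_comp[OF continuous_map_comp[OF _ hc] continuous_f])
          have "w + z \<in> cball 0 1" if "z \<in> ball 0 \<rho>" for z :: complex
            using tr[OF that] sub by (meson ball_subset_cball subsetD)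
          then show "continuous_map (top_of_set (ball 0 \<rho>)) (top_of_set (cball 0 1)) (\<lambda>z. w + z)"
            by (auto simp: continuous_map_in_subtopology simp del: mem_ball mem_cball intro!: continuous_intros)
        qed
        show "inj_on (\<lambda>z. f (h (w + z))) (ball 0 \<rho>)"
        proof (rule inj_onI)
          fix x y assume "x \<in> ball 0 \<rho>" "y \<in> ball 0 \<rho>" "f (h (w + x)) = f (h (w + y))"
          then have "w + x = w + y" using fh tr by blast
          then show "x = y" by simp
        qed
        show "f (h (w + 0)) \<in> special_punctures \<Sigma>'" using w fq by simp
        fix z :: complex assume z: "z \<in> ball 0 \<rho> - {0}"
        then have "f (h (w + z)) \<noteq> f q" using fh[OF tr[of z], of w] w \<rho>(1) by auto
        moreover have "f (h (w + z)) \<notin> F" using inU[OF tr[of z]] z by (auto simp: U_def)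
        ultimately show "f (h (w + z)) \<notin> marked_points \<Sigma>' \<union> special_punctures \<Sigma>'" by (auto simp: F_def)
      qed
      show "h z \<notin> obstacles" if z: "z \<in> ball w \<rho> - {w}" for z
      proof -
        have "h z \<noteq> q" using inj_onD[OF hinj, of z w] z w sub by auto
        then show ?thesis using inU[of z] z by (auto simp: U_def)
      qed
    qed
  qed
  \<comment> \<open>Points of the unit disc have distance at most 2 from w, so Re (G t) \<le> ln 2.
    Subtracting M brings the real part below ln \<rho>, that is, the loop into the disc of radius
    \<rho> around w.\<close>
  define M where "M = ln (2 / \<rho>) + 1"
  have M: "0 < M" using \<rho> by (simp add: M_def add_pos_pos)
  have small: "Re (g - of_real M) < ln \<rho>" if "norm (exp g) \<le> 2" for g :: complex
  proof -
    have "Re g \<le> ln 2" using that by (simp add: norm_exp_eq_Re ln_ge_iff)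
    then show ?thesis using \<rho> by (simp add: M_def ln_div)
  qed
  define a' b' where "a' = (2 * a + b) / 3" and "b' = (a + 2 * b) / 3"
  have ab': "a < a'" "a' < b'" "b' < b" using ab by (auto simp: a'_def b'_def)
  \<comment> \<open>Over [a,a'] the parameter \<mu> rests at a while \<beta> rises to 1, so the
    curve runs inwards from the base point. Over [a',b'] the whole loop is run at the reduced size,
    and over [b',b] the curve runs back out.\<close>
  define \<beta> where "\<beta> = (\<lambda>t. min 1 (min ((t - a) / (a' - a)) ((b - t) / (b - b'))))"
  define \<mu> where "\<mu> = (\<lambda>t. a + (b - a) * max 0 (min 1 ((t - a') / (b' - a'))))"
  have \<beta>: "continuous_on {a..b} \<beta>" "\<beta> a = 0" "\<beta> b = 0" "\<And>t. t \<in> {a<..<b} \<Longrightarrow> 0 < \<beta> t"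
    and \<beta>1: "\<And>t. t \<in> {a'..b'} \<Longrightarrow> \<beta> t = 1"
  proof -
    show "continuous_on {a..b} \<beta>" unfolding \<beta>_def by (intro continuous_intros) (use ab' in auto)
    have "0 \<le> (b - a) / (a' - a)" "0 \<le> (b - a) / (b - b')" using ab(2) ab' by simp_all
    then show "\<beta> a = 0" "\<beta> b = 0" by (simp_all add: \<beta>_def)
    show "0 < \<beta> t" if "t \<in> {a<..<b}" for t using that ab' by (auto simp: \<beta>_def)
    show "\<beta> t = 1" if "t \<in> {a'..b'}" for t
    proof -
      have "1 \<le> (t - a) / (a' - a)" "1 \<le> (b - t) / (b - b')" using that ab' by (auto simp: field_simps)
      then show ?thesis by (simp add: \<beta>_def)
    qed
  qed
  have \<mu>: "continuous_on {a..b} \<mu>" "\<mu> a = a" "\<mu> b = b" "\<And>t. t \<in> {a..b} \<Longrightarrow> \<mu> t \<in> {a..b}"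
    and \<mu>l: "\<And>t. t \<le> a' \<Longrightarrow> \<mu> t = a" and \<mu>r: "\<And>t. b' \<le> t \<Longrightarrow> \<mu> t = b"
  proof -
    show "continuous_on {a..b} \<mu>" unfolding \<mu>_def by (intro continuous_intros) (use ab' in auto)
    show l: "\<mu> t = a" if "t \<le> a'" for t
    proof -
      have "(t - a') / (b' - a') \<le> 0" using that ab' by (simp add: divide_le_0_iff)
      then show ?thesis by (simp add: \<mu>_def)
    qed
    show r: "\<mu> t = b" if "b' \<le> t" for t
    proof -
      have "1 \<le> (t - a') / (b' - a')" using that ab' by (simp add: field_simps)
      then show ?thesis by (simp add: \<mu>_def)
    qed
    show "\<mu> a = a" "\<mu> b = b" using l[of a] r[of b] ab' by auto
    show "\<mu> t \<in> {a..b}" for t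
    proof -
      have "0 \<le> max 0 (min 1 ((t - a') / (b' - a')))" "max 0 (min 1 ((t - a') / (b' - a'))) \<le> 1" by auto
      then have "0 \<le> (b - a) * max 0 (min 1 ((t - a') / (b' - a')))"
        "(b - a) * max 0 (min 1 ((t - a') / (b' - a'))) \<le> (b - a) * 1"
        using ab(2) by (auto intro!: mult_left_mono simp del: max_less_iff_conj)
      then show ?thesis by (simp add: \<mu>_def)
    qed
  qed
  have refl_in: "a + b - t \<in> {a..b}" if "t \<in> {a..b}" for t using that by auto
  define G' where "G' = (\<lambda>t. G (a + b - t))"
  have G'c: "continuous_on {a..b} G'"
    unfolding G'_def by (rule continuous_on_compose2[OF G(1)]) (auto intro!: continuous_intros)
  define c1 where "c1 = patch a b (\<lambda>t. h (w + exp (G (\<mu> t) - of_real (M * \<beta> t)))) c"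
  define d1 where "d1 = patch a b (\<lambda>t. h (w + exp (G' (\<mu> t) - of_real (M * \<beta> t)))) d"
  have c1_in: "c1 t = h (w + exp (G (\<mu> t) - of_real (M * \<beta> t)))" if "t \<in> {a..b}" for t
    using that by (simp add: c1_def)
  have d1_in: "d1 t = h (w + exp (G' (\<mu> t) - of_real (M * \<beta> t)))" if "t \<in> {a..b}" for t
    using that by (simp add: d1_def)
  have c1_out: "c1 t = c t" if "t \<notin> {a..b}" for t unfolding c1_def using that by (rule patch_outside)
  have d1_out: "d1 t = d t" if "t \<notin> {a..b}" for t unfolding d1_def using that by (rule patch_outside)
  have hq': "h ` ball 0 1 \<inter> (marked_points \<Sigma> \<union> special_punctures \<Sigma>) = {h w}" using hq w by simp
  have cG: "c t = h (w + exp (G t))" "w + exp (G t) \<in> cball 0 1" if "t \<in> {a..b}" for t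
    using cc[OF that] wG[OF that] by auto
  have cc1: "(c, c1) \<in> curve_homotopy \<Sigma>"
  proof (rule shrink_loop[OF cp ab(1-3) w(1) hc hinj hq' G(1) cG(2,1) M \<mu> \<beta> c1_in])
    show "c1 t = c t" if "t \<in> {0..1} - {a..b}" for t using c1_out that by blast
  qed
  have dG: "d t = h (w + exp (G' t))" "w + exp (G' t) \<in> cball 0 1" if "t \<in> {a..b}" for t
    using cG[OF refl_in[OF that]] d_in[OF that] by (auto simp: G'_def)
  have dd1: "(d, d1) \<in> curve_homotopy \<Sigma>"
  proof (rule shrink_loop[OF dp ab(1-3) w(1) hc hinj hq' G'c dG(2,1) M \<mu> \<beta> d1_in])
    show "d1 t = d t" if "t \<in> {0..1} - {a..b}" for t using d1_out that by blast
  qed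
  obtain \<kappa>' where \<kappa>': "limit_class d \<kappa>'" using limit_class_exists[OF dc] by blast
  obtain N where N: "openin time_space N" "\<forall>t\<in>{0..1}. (t, c1 t) \<in> N"
    "\<forall>e\<in>generic_curves. e 0 = c1 0 \<longrightarrow> e 1 = c1 1 \<longrightarrow> (\<forall>t\<in>{0..1}. (t, e t) \<in> N) \<longrightarrow> reduced_class \<Sigma>' (f \<circ> e) = \<kappa>"
    using limit_class_homotopy[OF cc1 \<kappa>] unfolding limit_class_def by blast
  obtain N' where N': "openin time_space N'" "\<forall>t\<in>{0..1}. (t, d1 t) \<in> N'"
    "\<forall>e\<in>generic_curves. e 0 = d1 0 \<longrightarrow> e 1 = d1 1 \<longrightarrow> (\<forall>t\<in>{0..1}. (t, e t) \<in> N') \<longrightarrow> reduced_class \<Sigma>' (f \<circ> e) = \<kappa>'"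
    using limit_class_homotopy[OF dd1 \<kappa>'] unfolding limit_class_def by blast
  \<comment> \<open>\<open>G a\<close> and \<open>G b\<close> differ by a multiple of 2 pi i, so the
    way in and the way out are the same for both curves.\<close>
  have c1d1: "d1 t = c1 t" if tm: "t \<notin> {a'<..<b'}" for t
  proof -
    consider "t \<notin> {a..b}" | "t \<in> {a..a'}" | "t \<in> {b'..b}" using tm by fastforce
    then show ?thesis
    proof cases
      case 1
      then show ?thesis using c1_out[OF 1] d1_out[OF 1] d_out[of t] by auto
    next
      case 2
      have "G' (\<mu> t) - of_real (M * \<beta> t) = (G (\<mu> t) - of_real (M * \<beta> t)) + of_int (2 * k) * of_real pi * \<i>"
        using \<mu>l[of t] 2 k by (simp add: G'_def)
      then have "exp (G' (\<mu> t) - of_real (M * \<beta> t)) = exp (G (\<mu> t) - of_real (M * \<beta> t))"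
        by (simp only: per)
      then show ?thesis using c1_in[of t] d1_in[of t] 2 ab' by simp
    next
      case 3
      have "G (\<mu> t) - of_real (M * \<beta> t) = (G' (\<mu> t) - of_real (M * \<beta> t)) + of_int (2 * k) * of_real pi * \<i>"
        using \<mu>r[of t] 3 k by (simp add: G'_def)
      then have "exp (G (\<mu> t) - of_real (M * \<beta> t)) = exp (G' (\<mu> t) - of_real (M * \<beta> t))"
        by (simp only: per)
      then show ?thesis using c1_in[of t] d1_in[of t] 3 ab' by simp
    qed
  qed
  have c1c: "c1 \<in> curves \<Sigma>" using reduced_equiv_curves[OF curve_homotopy_reduced[OF cc1]] c by blast
  have d1c: "d1 \<in> curves \<Sigma>" using reduced_equiv_curves[OF curve_homotopy_reduced[OF dd1]] dc by blast
  have p1: "pathin X c1" "pathin X d1" using curvesD c1c d1c by blast+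
  have NN: "openin time_space (N \<inter> N')" using N(1) N'(1) by (rule openin_Int)
  have near: "(t, c1 t) \<in> N \<inter> N'" if "t \<in> {0..1}" "t \<notin> {a'<..<b'}" for t
    using N(2) N'(2) c1d1[OF that(2)] that(1) by (metis IntI)
  \<comment> \<open>The outer parts may meet obstacles and are replaced by approximations that avoid
    them at inner times, the same for \<open>c1\<close> and \<open>d1\<close>. The middle parts can
    stay, because the small disc contains no obstacle apart from its centre.\<close>
  obtain l where l: "continuous_map (top_of_set {0..a'}) X l" "l 0 = c1 0" "l a' = c1 a'"
    "\<And>t. t \<in> {0..a'} \<Longrightarrow> (t, l t) \<in> N \<inter> N'" "\<And>t. t \<in> {0<..<a'} \<Longrightarrow> l t \<notin> obstacles"
  proof (rule close_generic[OF finite_obstacles obstacles_subset p1(1) order_refl _ _ NN, of a'])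
    show "(t, c1 t) \<in> N \<inter> N'" if "t \<in> {0..a'}" for t using near[of t] that ab' ab by auto
  qed (use ab' ab that in auto)
  obtain r where r: "continuous_map (top_of_set {b'..1}) X r" "r b' = c1 b'" "r 1 = c1 1"
    "\<And>t. t \<in> {b'..1} \<Longrightarrow> (t, r t) \<in> N \<inter> N'" "\<And>t. t \<in> {b'<..<1} \<Longrightarrow> r t \<notin> obstacles"
  proof (rule close_generic[OF finite_obstacles obstacles_subset p1(1) _ _ order_refl NN, of b'])
    show "(t, c1 t) \<in> N \<inter> N'" if "t \<in> {b'..1}" for t using near[of t] that ab' ab by auto
  qed (use ab' ab that in auto)
  have disc: "h (w + exp (g - of_real M)) \<notin> obstacles" if "norm (exp g) \<le> 2" for g
  proof (rule \<rho>(5))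
    show "w + exp (g - of_real M) \<in> ball w \<rho> - {w}"
      using exp_in_ball[OF small[OF that] \<rho>(1)] by (simp add: dist_norm)
  qed
  have G2: "norm (exp (G t)) \<le> 2" if "t \<in> {a..b}" for t
  proof -
    have "norm (exp (G t)) \<le> norm (cc t) + norm w" unfolding G(2)[OF that, symmetric] by (rule norm_triangle_ineq4)
    then show ?thesis using cc(1)[OF that] w(1) by auto
  qed
  have G'2: "norm (exp (G' t)) \<le> 2" if "t \<in> {a..b}" for t
    using G2[OF refl_in[OF that]] by (simp add: G'_def)
  have mid: "c1 t = h (w + exp (G (\<mu> t) - of_real M))" "d1 t = h (w + exp (G' (\<mu> t) - of_real M))"
    "c1 t \<notin> obstacles" "d1 t \<notin> obstacles" if "t \<in> {a'..b'}" for t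
  proof -
    have t: "t \<in> {a..b}" using that ab' by auto
    show e: "c1 t = h (w + exp (G (\<mu> t) - of_real M))" "d1 t = h (w + exp (G' (\<mu> t) - of_real M))"
      using c1_in[OF t] d1_in[OF t] \<beta>1[OF that] by simp_all
    show "c1 t \<notin> obstacles" "d1 t \<notin> obstacles"
      unfolding e using disc G2 G'2 \<mu>(4)[OF t] by blast+
  qed
  define E where "E = (\<lambda>m t. if t \<le> a' then l t else if t \<le> b' then m t else r t)"
  have E_mid: "E m t = m t" if "t \<in> {a'..b'}" "m a' = c1 a'" for m t
    using that l(3) by (cases "t = a'") (auto simp: E_def)
  have E_gen: "E m \<in> generic_curves"
    if m: "pathin X m" "m a' = c1 a'" "m b' = c1 b'" "\<And>t. t \<in> {a'..b'} \<Longrightarrow> m t \<notin> obstacles" for m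
  proof -
    have mp: "continuous_map (top_of_set {a'..b'}) X m"
      using path_restrict[OF m(1)] ab ab' by simp
    have "continuous_map (top_of_set {a'..1}) X (\<lambda>t. if t \<le> b' then m t else r t)"
      by (rule continuous_map_join[OF mp r(1)]) (use m r ab ab' in auto)
    then have "continuous_map (top_of_set {0..1}) X (E m)"
      unfolding E_def by (rule continuous_map_join[OF l(1)]) (use m l ab ab' in auto)
    moreover have "E m t \<notin> obstacles" if "t \<in> {0<..<1}" for t
    proof -
      consider "t < a'" | "t \<in> {a'..b'}" | "b' < t" by fastforce
      then show ?thesis
        using that l(5)[of t] r(5)[of t] m(4)[of t] E_mid[of t m] m(2) ab' by cases (auto simp: E_def)
    qed
    moreover have "E m 0 = c1 0" "E m 1 = c1 1" using l(2) r(3) ab ab' by (auto simp: E_def)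
    ultimately show ?thesis
      using curvesD[OF c1c] by (simp add: curves_avoiding_def pathin_def)
  qed
  have E_ends: "E m 0 = c1 0" "E m 1 = c1 1" for m using l(2) r(3) ab ab' by (auto simp: E_def)
  have d1ab: "d1 a' = c1 a'" "d1 b' = c1 b'" "d1 0 = c1 0" "d1 1 = c1 1"
    using c1d1[of a'] c1d1[of b'] c1d1[of 0] c1d1[of 1] ab ab' by auto
  have E1: "E c1 \<in> generic_curves" using mid(3) p1 by (intro E_gen) auto
  have E2: "E d1 \<in> generic_curves" using mid(4) p1 d1ab by (intro E_gen) auto
  have "(t, E c1 t) \<in> N" "(t, E d1 t) \<in> N'" if "t \<in> {0..1}" for t
    using that l(4)[of t] r(4)[of t] N(2) N'(2) by (auto simp: E_def)
  then have k1: "reduced_class \<Sigma>' (f \<circ> E c1) = \<kappa>" and k2: "reduced_class \<Sigma>' (f \<circ> E d1) = \<kappa>'"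
    using N(3) N'(3) E1 E2 E_ends d1ab by metis+
  have \<mu>c: "continuous_on {a'..b'} (\<lambda>t. j (\<mu> t))" if "continuous_on {a..b} j" for j :: "real \<Rightarrow> complex"
  proof (rule continuous_on_compose2[OF that])
    show "continuous_on {a'..b'} \<mu>" using \<mu>(1) by (rule continuous_on_subset) (use ab' in auto)
    show "\<mu> ` {a'..b'} \<subseteq> {a..b}" using \<mu>(4) ab' by auto
  qed
  have \<mu>in: "\<mu> t \<in> {a..b}" if "t \<in> {a'..b'}" for t using \<mu>(4)[of t] that ab' by auto
  have "(f \<circ> E c1, f \<circ> E d1) \<in> reduced_equiv \<Sigma>'"
  \<comment> \<open>The logarithm \<open>G'\<close> starts at G b = G a + 2 pi i k; the shift by -k
    turns lets both start at G a. Up to the common -M they then end at G a + 2 pi i k and at G a - 2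
    pi i k, hence 4 pi i k apart.\<close>
  proof (rule even_turns_reduced_equiv[OF generic_image[OF E1] generic_image[OF E2] _ ab'(2) _ \<rho>(4,1),
        where G = "\<lambda>t. G (\<mu> t) - of_real M" and k = "- k"
          and G' = "\<lambda>t. G' (\<mu> t) - of_real M + of_int (2 * (- k)) * of_real pi * \<i>"])
    show "continuous_on {a'..b'} (\<lambda>t. G (\<mu> t) - of_real M)"
      "continuous_on {a'..b'} (\<lambda>t. G' (\<mu> t) - of_real M + of_int (2 * (- k)) * of_real pi * \<i>)"
      by (intro continuous_intros \<mu>c G(1) G'c)+
    show "G' (\<mu> a') - of_real M + of_int (2 * (- k)) * of_real pi * \<i> = G (\<mu> a') - of_real M"
      using \<mu>l[of a'] k by (simp add: G'_def)
    show "G' (\<mu> b') - of_real M + of_int (2 * (- k)) * of_real pi * \<i>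
        = G (\<mu> b') - of_real M + 4 * of_int (- k) * of_real pi * \<i>"
      using \<mu>r[of b'] k by (simp add: G'_def)
    show "Re (G (\<mu> t) - of_real M) < ln \<rho>" if "t \<in> {a'..b'}" for t
      using G2[OF \<mu>in[OF that]] by (rule small)
    show "Re (G' (\<mu> t) - of_real M + of_int (2 * (- k)) * of_real pi * \<i>) < ln \<rho>" if "t \<in> {a'..b'}" for t
      using small[OF G'2[OF \<mu>in[OF that]]] by simp
    show "(f \<circ> E c1) t = f (h (w + exp (G (\<mu> t) - of_real M)))" if "t \<in> {a'..b'}" for t
      using E_mid[OF that, of c1] mid(1)[OF that] by simp
    show "(f \<circ> E d1) t = f (h (w + exp (G' (\<mu> t) - of_real M + of_int (2 * (- k)) * of_real pi * \<i>)))"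
      if "t \<in> {a'..b'}" for t
      unfolding per using E_mid[OF that, of d1] mid(2)[OF that] d1ab by simp
    show "(f \<circ> E d1) t = (f \<circ> E c1) t" if "t \<in> {0..1} - {a'..b'}" for t
      using that by (auto simp: E_def)
  qed (use ab ab' in auto)
  then have "\<kappa> = \<kappa>'" using k1 k2 reduced_class_eq_iff by metis
  then show ?thesis using \<kappa>' by (simp add: d_def)
qed

text \<open>\<open>limit_class_homotopy\<close> and \<open>limit_class_crossing\<close> give one
  direction; existence and uniqueness of limit classes give the other.\<close>

lemma limit_class_reduced:
  assumes "(c, d) \<in> reduced_equiv \<Sigma>" "c \<in> curves \<Sigma>"
  shows "limit_class c \<kappa> \<longleftrightarrow> limit_class d \<kappa>"
proof -
  have step: "limit_class c \<kappa> \<longleftrightarrow> limit_class d \<kappa>"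
    if "\<And>\<kappa>. limit_class c \<kappa> \<Longrightarrow> limit_class d \<kappa>" "c \<in> curves \<Sigma>" "d \<in> curves \<Sigma>" for c d \<kappa>
    using that limit_class_exists[of c] limit_class_unique[of d] by metis
  \<comment> \<open>Membership in \<open>reduced_equiv\<close> is carried along because the
    symmetric and the transitive case have to move membership in \<open>curves\<close> from one
    curve to the other.\<close>
  have "(c \<in> curves \<Sigma> \<longrightarrow> (\<forall>\<kappa>. limit_class c \<kappa> \<longleftrightarrow> limit_class d \<kappa>)) \<and> (c, d) \<in> reduced_equiv \<Sigma>"
    using assms(1)
  proof (induction rule: reduced_equiv_induct)
    case (homotopy c d)
    then show ?case
      using step limit_class_homotopy reduced_equiv_curves curve_homotopy_reduced by metis
  next
    case (crossing c d)
    then have "(c, d) \<in> reduced_equiv \<Sigma>" by (rule crossing_resolution_reduced)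
    moreover have "limit_class d \<kappa>" if "limit_class c \<kappa>" for \<kappa>
      using crossing that limit_class_crossing by (auto simp: crossing_resolution_def)
    ultimately show ?case using step reduced_equiv_curves by metis
  next
    case (sym c d)
    then show ?case using reduced_equiv_sym reduced_equiv_curves by metis
  next
    case (trans c d e)
    then show ?case using reduced_equiv_trans reduced_equiv_curves by metis
  qed (auto intro: reduced_equiv_refl)
  then show ?thesis using assms(2) by blast
qed

end

section \<open>Images of reduced classes\<close>

text \<open>For the identity, limit classes are reduced classes of the surface itself; approximation
  then becomes a change of representative in \<open>reduced_generic\<close>.\<close>

lemma tame_morphism_id:
  assumes "tame_surface \<Sigma>"
  shows "tame_morphism \<Sigma> \<Sigma> (\<lambda>x. x)"
proof
  let ?X = "surface_space \<Sigma>"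
  have sub: "marked_points \<Sigma> \<subseteq> topspace ?X" using assms by (auto simp: tame_surface_def Let_def)
  have fib: "{x \<in> topspace ?X. x = y} = {y}" if "y \<in> topspace ?X" for y using that by auto
  show "surface_morphism \<Sigma> \<Sigma> (\<lambda>x. x)"
    unfolding surface_morphism_def Let_def
  proof (intro conjI ballI)
    fix y assume y: "y \<in> topspace ?X"
    show "subtopology ?X {x \<in> topspace ?X. x = y} = discrete_topology {x \<in> topspace ?X. x = y}"
      unfolding fib[OF y] using y by (simp add: subtopology_eq_discrete_topology_sing)
  next
    fix p assume "p \<in> topspace ?X - branch_points \<Sigma> \<Sigma> (\<lambda>x. x)"
    then show "\<exists>U. openin ?X U \<and> p \<in> U \<and> inj_on (\<lambda>x. x) U" by (intro exI[of _ "topspace ?X"]) auto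
  next
    fix p assume "p \<in> branch_points \<Sigma> \<Sigma> (\<lambda>x. x)"
    then show "ramified_double_cover_at ?X ?X (\<lambda>x. x) p" by (simp add: branch_points_def)
  qed (use sub in auto)
qed (use assms in auto)

context tame_morphism
begin

text \<open>A connected subset of a discrete fibre is a point. So if c is not constant,
  \<open>f \<circ> c\<close> cannot pass for a curve merely by being constant at a puncture.\<close>

lemma image_constant:
  assumes c: "pathin X c" and fc: "\<And>t. t \<in> {0..1} \<Longrightarrow> f (c t) = y"
  shows "\<forall>t\<in>{0..1}. c t = c 0"
proof -
  let ?S = "{x \<in> topspace X. f x = y}"
  have cS: "c t \<in> ?S" if "t \<in> {0..1}" for t using pathin_topspace[OF c that] fc[OF that] by simp
  have y: "y \<in> topspace Y"
    using cS[of 0] continuous_map_image_subset_topspace[OF continuous_f] by auto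
  have "continuous_map (top_of_set {0..1}) (subtopology X ?S) c"
    using c cS by (auto simp: pathin_def continuous_map_in_subtopology)
  then have "connectedin (subtopology X ?S) (c ` {0..1})"
    by (rule connectedin_continuous_map_image) (simp add: connectedin_subtopology)
  then obtain a where "c ` {0..1} \<subseteq> {a}"
    unfolding fibre_discrete[OF y] connectedin_discrete_topology by blast
  then have "c t = a" if "t \<in> {0..1}" for t using that by blast
  then show ?thesis by simp
qed

text \<open>The curve c is either constant or, by \<open>image_constant\<close>, generic for f, and
  limit classes of both kinds are known.\<close>

lemma limit_class_image:
  assumes c: "c \<in> curves \<Sigma>" and fc: "f \<circ> c \<in> curves \<Sigma>'"
  shows "limit_class c (reduced_class \<Sigma>' (f \<circ> c))"
proof (cases "\<forall>t\<in>{0..1}. c t = c 0")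
  case True
  have "(f \<circ> c, \<lambda>t. f (c 0)) \<in> curve_homotopy \<Sigma>'"
  proof (rule curve_homotopy_cong[OF fc])
    show "f (c 0) = (f \<circ> c) t" if "t \<in> {0..1}" for t using bspec[OF True that] by simp
  qed
  then have "reduced_class \<Sigma>' (f \<circ> c) = reduced_class \<Sigma>' (\<lambda>t. f (c 0))"
    by (simp add: reduced_class_eq_iff curve_homotopy_reduced)
  moreover have "limit_class c (reduced_class \<Sigma>' (\<lambda>t. f (c 0)))"
    using curvesD[OF c] True by (intro limit_class_constant) blast+
  ultimately show ?thesis by simp
next
  case False
  have p: "pathin X c" using curvesD[OF c] by blast
  have "\<not> (\<forall>t\<in>{0..1}. (f \<circ> c) t = (f \<circ> c) 0)"
  proof
    assume H: "\<forall>t\<in>{0..1}. (f \<circ> c) t = (f \<circ> c) 0"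
    have "f (c t) = f (c 0)" if "t \<in> {0..1}" for t
      using bspec[OF H that] by (simp only: comp_apply)
    then have "\<forall>t\<in>{0..1}. c t = c 0" by (rule image_constant[OF p])
    then show False using False by blast
  qed
  then have "\<forall>t\<in>{0<..<1}. f (c t) \<notin> punctures \<Sigma>'" using fc unfolding curves_def by auto
  moreover have "\<forall>t\<in>{0<..<1}. c t \<notin> punctures \<Sigma>" using c False unfolding curves_def by auto
  ultimately have "c \<in> generic_curves"
    using curvesD[OF c] unfolding curves_avoiding_def obstacles_def by blast
  then show ?thesis by (rule limit_class_generic)
qed

text \<open>Under the identity the limit class of c is the class of c, so generic curves near c with
  the same ends represent it.\<close>

lemma reduced_generic:
  assumes c: "c \<in> curves \<Sigma>" and F: "finite F" "F \<subseteq> topspace X"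
  obtains d where "d \<in> generic_curves" "(c, d) \<in> reduced_equiv \<Sigma>" "\<And>t. t \<in> {0<..<1} \<Longrightarrow> d t \<notin> F"
proof -
  interpret i: tame_morphism \<Sigma> \<Sigma> "\<lambda>x. x" using tame(1) by (rule tame_morphism_id)
  have "i.limit_class c (reduced_class \<Sigma> ((\<lambda>x. x) \<circ> c))"
    using c by (intro i.limit_class_image) (simp_all add: o_def)
  then obtain N where N: "openin time_space N" "\<forall>t\<in>{0..1}. (t, c t) \<in> N"
    "\<forall>d\<in>i.generic_curves. d 0 = c 0 \<longrightarrow> d 1 = c 1 \<longrightarrow> (\<forall>t\<in>{0..1}. (t, d t) \<in> N) \<longrightarrow>
        reduced_class \<Sigma> d = reduced_class \<Sigma> c"
    unfolding i.limit_class_def o_def by blast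
  have cD: "pathin X c" "c 0 \<in> marked_points \<Sigma>" "c 1 \<in> marked_points \<Sigma>" using curvesD[OF c] by auto
  have cN: "(t, c t) \<in> N" if "t \<in> {0..1}" for t using N(2) that by blast
  obtain d where d: "d \<in> generic_curves" "d 0 = c 0" "d 1 = c 1" "\<And>t. t \<in> {0..1} \<Longrightarrow> (t, d t) \<in> N"
    "\<And>t. t \<in> {0<..<1} \<Longrightarrow> d t \<notin> F"
    by (rule approximate_generic[OF cD N(1) cN F]) (assumption | rule that)+
  have "i.obstacles \<subseteq> obstacles" by (auto simp: i.obstacles_def obstacles_def)
  then have "d \<in> i.generic_curves" using d(1) unfolding curves_avoiding_def by blast
  then have "reduced_class \<Sigma> d = reduced_class \<Sigma> c" using N(3) d by blast
  then show thesis using that d by (metis reduced_class_eq_iff)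
qed

text \<open>For every admissible representative c' the class of \<open>f \<circ> c'\<close> is a
  limit class of c, and limit classes are unique. This is what makes the image of a reduced class
  well defined.\<close>

lemma class_image_eq:
  assumes c: "c \<in> curves \<Sigma>" and fc: "f \<circ> c \<in> curves \<Sigma>'"
  shows "class_image \<Sigma> \<Sigma>' f (reduced_class \<Sigma> c) = reduced_class \<Sigma>' (f \<circ> c)"
  unfolding class_image_def
proof (rule the_equality)
  show "\<exists>c'\<in>reduced_class \<Sigma> c. f \<circ> c' \<in> curves \<Sigma>' \<and> reduced_class \<Sigma>' (f \<circ> c) = reduced_class \<Sigma>' (f \<circ> c')"
    using fc by (intro bexI[of _ c]) (auto simp: in_reduced_class_iff reduced_equiv_refl)
  fix \<kappa> assume "\<exists>c'\<in>reduced_class \<Sigma> c. f \<circ> c' \<in> curves \<Sigma>' \<and> \<kappa> = reduced_class \<Sigma>' (f \<circ> c')"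
  then obtain c' where c': "(c, c') \<in> reduced_equiv \<Sigma>" "f \<circ> c' \<in> curves \<Sigma>'" "\<kappa> = reduced_class \<Sigma>' (f \<circ> c')"
    by (auto simp: in_reduced_class_iff)
  have "c' \<in> curves \<Sigma>" using reduced_equiv_curves[OF c'(1)] c by blast
  then have "limit_class c' \<kappa>" using c'(2,3) limit_class_image by blast
  then have "limit_class c \<kappa>" using limit_class_reduced[OF c'(1) c] by blast
  then show "\<kappa> = reduced_class \<Sigma>' (f \<circ> c)"
    using limit_class_image[OF c fc] limit_class_unique[OF c] by blast
qed

lemma generic_curves_image:
  assumes "d \<in> generic_curves"
  shows "d \<in> curves \<Sigma>" "f \<circ> d \<in> curves \<Sigma>'"
  using generic_proper[OF assms] generic_image[OF assms] proper_curves_subset by blast+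

lemma reduced_class_generic:
  assumes "\<gamma> \<in> reduced_classes \<Sigma>" "finite F" "F \<subseteq> topspace X"
  obtains d where "d \<in> generic_curves" "\<gamma> = reduced_class \<Sigma> d"
    "class_image \<Sigma> \<Sigma>' f \<gamma> = reduced_class \<Sigma>' (f \<circ> d)" "\<And>t. t \<in> {0<..<1} \<Longrightarrow> d t \<notin> F"
proof -
  obtain c where c: "c \<in> curves \<Sigma>" "\<gamma> = reduced_class \<Sigma> c" using assms(1) reduced_classes_iff by blast
  obtain d where d: "d \<in> generic_curves" "(c, d) \<in> reduced_equiv \<Sigma>" "\<And>t. t \<in> {0<..<1} \<Longrightarrow> d t \<notin> F"
    by (rule reduced_generic[OF c(1) assms(2,3)]) (assumption | rule that)+
  have "\<gamma> = reduced_class \<Sigma> d" using c(2) d(2) by (simp add: reduced_class_eq_iff)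
  then show thesis using that d class_image_eq generic_curves_image by metis
qed

lemma class_image_in:
  assumes "\<gamma> \<in> reduced_classes \<Sigma>"
  shows "class_image \<Sigma> \<Sigma>' f \<gamma> \<in> reduced_classes \<Sigma>'"
proof -
  obtain d where d: "d \<in> generic_curves" "class_image \<Sigma> \<Sigma>' f \<gamma> = reduced_class \<Sigma>' (f \<circ> d)"
    by (rule reduced_class_generic[OF assms finite.emptyI empty_subsetI]) (rule that)
  then show ?thesis using generic_curves_image reduced_classes_iff by metis
qed

lemma class_image_reversed:
  assumes "\<gamma> \<in> reduced_classes \<Sigma>"
  shows "class_image \<Sigma> \<Sigma>' f (reversed_class \<gamma>) = reversed_class (class_image \<Sigma> \<Sigma>' f \<gamma>)"
proof -
  obtain d where d: "d \<in> generic_curves" "\<gamma> = reduced_class \<Sigma> d" "class_image \<Sigma> \<Sigma>' f \<gamma> = reduced_class \<Sigma>' (f \<circ> d)"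
    by (rule reduced_class_generic[OF assms finite.emptyI empty_subsetI]) (rule that)
  have "(\<lambda>t. d (1 - t)) \<in> generic_curves" using d(1) by (rule curves_avoiding_reversed)
  from class_image_eq[OF generic_curves_image[OF this]] show ?thesis
    unfolding d(3) unfolding d(2) by (simp add: reversed_class_reduced_class o_def)
qed

lemma constant_curve: "p \<in> marked_points \<Sigma> \<Longrightarrow> (\<lambda>t. p) \<in> curves \<Sigma>"
  using tame_source by (auto simp: curves_def)

lemma class_image_trivial:
  assumes "\<gamma> \<in> trivial_classes \<Sigma>"
  shows "class_image \<Sigma> \<Sigma>' f \<gamma> \<in> trivial_classes \<Sigma>'"
proof -
  obtain p where p: "p \<in> marked_points \<Sigma>" "\<gamma> = reduced_class \<Sigma> (\<lambda>t. p)"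
    using assms by (auto simp: trivial_classes_def)
  have fp: "f p \<in> marked_points \<Sigma>'" using p(1) marked_preimage by blast
  then have "f \<circ> (\<lambda>t. p) \<in> curves \<Sigma>'" using tame_target by (auto simp: curves_def o_def)
  from class_image_eq[OF constant_curve[OF p(1)] this] show ?thesis
    using fp unfolding p(2) trivial_classes_def o_def by blast
qed

end

lemma trivial_classes_subset: "tame_surface \<Sigma> \<Longrightarrow> trivial_classes \<Sigma> \<subseteq> reduced_classes \<Sigma>"
  using tame_morphism.constant_curve[OF tame_morphism_id]
  by (fastforce simp: trivial_classes_def reduced_classes_iff)

lemma reversed_class_in: "\<gamma> \<in> reduced_classes \<Sigma> \<Longrightarrow> reversed_class \<gamma> \<in> reduced_classes \<Sigma>"
  unfolding reduced_classes_iff by (metis reversed_class_reduced_class reversed_curve)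

text \<open>A representative that avoids the obstacles of g and those of \<open>f \<circ> g\<close>
  computes all three images.\<close>

lemma class_image_comp:
  assumes g: "tame_morphism \<Sigma>1 \<Sigma>2 g" and f: "tame_morphism \<Sigma>2 \<Sigma>3 f" and fg: "tame_morphism \<Sigma>1 \<Sigma>3 (f \<circ> g)"
    and \<gamma>: "\<gamma> \<in> reduced_classes \<Sigma>1"
  shows "class_image \<Sigma>1 \<Sigma>3 (f \<circ> g) \<gamma> = class_image \<Sigma>2 \<Sigma>3 f (class_image \<Sigma>1 \<Sigma>2 g \<gamma>)"
proof -
  interpret g: tame_morphism \<Sigma>1 \<Sigma>2 g by fact
  interpret f: tame_morphism \<Sigma>2 \<Sigma>3 f by fact
  interpret fg: tame_morphism \<Sigma>1 \<Sigma>3 "f \<circ> g" by fact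
  obtain d where d: "d \<in> g.generic_curves" "\<gamma> = reduced_class \<Sigma>1 d"
      "class_image \<Sigma>1 \<Sigma>2 g \<gamma> = reduced_class \<Sigma>2 (g \<circ> d)" "\<And>t. t \<in> {0<..<1} \<Longrightarrow> d t \<notin> fg.obstacles"
    by (rule g.reduced_class_generic[OF \<gamma> fg.finite_obstacles fg.obstacles_subset]) (assumption | rule that)+
  have "d \<in> fg.generic_curves" using d(1,4) by (simp add: curves_avoiding_def)
  then have fgd: "(f \<circ> g) \<circ> d \<in> curves \<Sigma>3" by (rule fg.generic_curves_image)
  have "class_image \<Sigma>1 \<Sigma>3 (f \<circ> g) \<gamma> = reduced_class \<Sigma>3 ((f \<circ> g) \<circ> d)"
    unfolding d(2) using g.generic_curves_image(1)[OF d(1)] fgd by (rule fg.class_image_eq)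
  moreover have "class_image \<Sigma>2 \<Sigma>3 f (reduced_class \<Sigma>2 (g \<circ> d)) = reduced_class \<Sigma>3 (f \<circ> (g \<circ> d))"
    using g.generic_curves_image(2)[OF d(1)] fgd by (intro f.class_image_eq) (simp_all add: comp_assoc)
  ultimately show ?thesis unfolding d(3) by (simp add: comp_assoc)
qed

section \<open>Images of polygons\<close>

lemma homeomorphic_map_scale_ball:
  fixes r :: real
  assumes "0 < r"
  shows "homeomorphic_map (top_of_set (ball 0 r)) (top_of_set (ball (0::complex) 1)) (\<lambda>w. w / of_real r)"
  unfolding homeomorphic_map_maps
proof
  show "homeomorphic_maps (top_of_set (ball 0 r)) (top_of_set (ball (0::complex) 1)) (\<lambda>w. w / of_real r) (\<lambda>w. of_real r * w)"
    unfolding homeomorphic_maps_def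
    using assms by (auto simp: continuous_map_in_subtopology norm_divide norm_mult intro!: continuous_intros)
qed

text \<open>The new source coordinate is \<phi> after m, which is open on a neighbourhood of p by
  invariance of domain; after shrinking, the source and target discs are rescaled to unit discs, by
  r and by its square. That B is open in the plane excludes the points on the sides of a polygon,
  which have no disc neighbourhoods; hence the sides have to be pulled inwards.\<close>

lemma ramified_precompose:
  assumes ram: "ramified_double_cover_at X Y f (m p)" and fY: "f ` topspace X \<subseteq> topspace Y"
    and S: "open B" "B \<subseteq> S" "p \<in> B" and m: "continuous_map (top_of_set S) X m" "inj_on m B"
  shows "ramified_double_cover_at (top_of_set S) Y (f \<circ> m) (p::complex)"
proof -
  obtain U \<phi> \<psi> where U: "openin X U" "m p \<in> U"
      and \<phi>: "homeomorphic_map (subtopology X U) (top_of_set (ball (0::complex) 1)) \<phi>" "\<phi> (m p) = 0"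
      and \<psi>: "homeomorphic_map (subtopology Y (f ` U)) (top_of_set (ball (0::complex) 1)) \<psi>"
      and sq: "\<And>x. x \<in> U \<Longrightarrow> \<psi> (f x) = (\<phi> x)\<^sup>2"
    using ram unfolding ramified_double_cover_at_def by blast
  have Ut: "U \<subseteq> topspace X" using U openin_subset by blast
  have tU: "topspace (subtopology Y (f ` U)) = f ` U" using Ut fY by auto
  have \<phi>inj: "inj_on \<phi> U"
    using homeomorphic_imp_injective_map[OF \<phi>(1)] Ut by (simp add: Int_absorb1)
  obtain T where T: "open T" "{z \<in> topspace (top_of_set S). m z \<in> U} = S \<inter> T"
    using openin_continuous_map_preimage[OF m(1) U(1)] unfolding openin_open by blast
  define D where "D = B \<inter> T"
  have D: "open D" using S(1) T(1) by (simp add: D_def open_Int)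
  have mD: "m z \<in> U" if "z \<in> D" for z
  proof -
    have "z \<in> S \<inter> T" using that S by (auto simp: D_def)
    then show ?thesis unfolding T(2)[symmetric] by simp
  qed
  have pD: "p \<in> D"
  proof -
    have "p \<in> {z \<in> topspace (top_of_set S). m z \<in> U}" using S U(2) by auto
    then show ?thesis unfolding T(2) using S by (simp add: D_def)
  qed
  have DS: "D \<subseteq> S" "D \<subseteq> B" using S by (auto simp: D_def)
  define \<alpha> where "\<alpha> = (\<lambda>z. \<phi> (m z))"
  have \<alpha>m: "continuous_map (top_of_set D) (top_of_set (ball 0 1)) \<alpha>"
  proof -
    have "continuous_map (top_of_set D) X m"
      using m(1) DS(1) by (rule continuous_map_from_subtopology_mono)
    then have "continuous_map (top_of_set D) (subtopology X U) m"
      using mD by (auto simp: continuous_map_in_subtopology)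
    then show ?thesis
      unfolding \<alpha>_def using homeomorphic_imp_continuous_map[OF \<phi>(1)] by (rule continuous_map_comp)
  qed
  then have \<alpha>c: "continuous_on D \<alpha>" by simp
  have \<alpha>1: "\<alpha> ` D \<subseteq> ball 0 1"
    using continuous_map_image_subset_topspace[OF \<alpha>m] by simp
  have \<alpha>inj: "inj_on \<alpha> D"
  proof (rule inj_onI)
    fix x y assume xy: "x \<in> D" "y \<in> D" "\<alpha> x = \<alpha> y"
    then have "m x = m y" using inj_onD[OF \<phi>inj] mD by (simp add: \<alpha>_def)
    then show "x = y" using inj_onD[OF m(2)] xy(1,2) DS(2) by blast
  qed
  have "open (\<alpha> ` D)" using invariance_of_domain[OF \<alpha>c D \<alpha>inj] .
  moreover have "0 \<in> \<alpha> ` D"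
  proof (rule image_eqI)
    show "0 = \<alpha> p" using \<phi>(2) by (simp add: \<alpha>_def)
  qed (rule pD)
  ultimately obtain r where r: "0 < r" "ball 0 r \<subseteq> \<alpha> ` D" using open_contains_ball by blast
  have "ball 0 r \<subseteq> ball (0::complex) 1" using r(2) \<alpha>1 by blast
  then have r1: "r \<le> 1" using r(1) by (simp add: ball_subset_ball_iff)
  obtain \<alpha>i where \<alpha>i: "homeomorphism D (\<alpha> ` D) \<alpha> \<alpha>i"
    using invariance_of_domain_homeomorphism[OF D \<alpha>c _ \<alpha>inj] by auto
  define V where "V = D \<inter> \<alpha> -` ball 0 r"
  have "open V" unfolding V_def using \<alpha>c D by (intro continuous_open_preimage) auto
  then have V: "openin (top_of_set S) V" using DS by (intro open_subset) (auto simp: V_def)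
  have VS: "S \<inter> V = V" using DS by (auto simp: V_def)
  have pV: "p \<in> V" using pD r(1) \<phi>(2) by (simp add: V_def \<alpha>_def)
  have VU: "m z \<in> U" if "z \<in> V" for z using that mD by (simp add: V_def)
  have sur: "\<exists>z\<in>V. \<alpha> z = w" if w: "w \<in> ball 0 r" for w
  proof -
    obtain z where "z \<in> D" "\<alpha> z = w" using r(2) w by blast
    then show ?thesis using w by (auto simp: V_def)
  qed
  have "homeomorphic_map (top_of_set V) (top_of_set (ball 0 r)) \<alpha>"
  proof -
    have "homeomorphic_maps (top_of_set D) (top_of_set (\<alpha> ` D)) \<alpha> \<alpha>i"
      using \<alpha>i by (auto simp: homeomorphic_maps_def homeomorphism_def continuous_map_in_subtopology)
    then have "homeomorphic_map (top_of_set D) (top_of_set (\<alpha> ` D)) \<alpha>"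
      using homeomorphic_map_maps by blast
    then have "homeomorphic_map (subtopology (top_of_set D) V) (subtopology (top_of_set (\<alpha> ` D)) (ball 0 r)) \<alpha>"
      by (rule homeomorphic_map_subtopologies_alt) (auto simp: V_def)
    moreover have "D \<inter> V = V" "\<alpha> ` D \<inter> ball 0 r = ball 0 r" using r(2) by (auto simp: V_def)
    ultimately show ?thesis by (simp add: subtopology_subtopology)
  qed
  from homeomorphic_map_compose[OF this homeomorphic_map_scale_ball[OF r(1)]]
  have hV: "homeomorphic_map (subtopology (top_of_set S) V) (top_of_set (ball 0 1)) (\<lambda>z. \<alpha> z / of_real r)"
    by (simp add: o_def subtopology_subtopology VS)
  have r2: "0 < r\<^sup>2" "r\<^sup>2 \<le> 1" using r(1) r1 by (auto simp: power_le_one)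
  have key: "\<psi> y \<in> ball 0 (r\<^sup>2) \<longleftrightarrow> y \<in> (f \<circ> m) ` V" if y: "y \<in> f ` U" for y
  proof
    assume b: "\<psi> y \<in> ball 0 (r\<^sup>2)"
    have "csqrt (\<psi> y) \<in> ball 0 r" using b r(1) real_sqrt_less_mono[of "norm (\<psi> y)" "r\<^sup>2"] by simp
    then obtain z where z: "z \<in> V" "\<alpha> z = csqrt (\<psi> y)" using sur by blast
    have "\<psi> (f (m z)) = \<psi> y" using sq[OF VU[OF z(1)]] z(2) by (simp add: \<alpha>_def)
    then have "f (m z) = y"
      using homeomorphic_imp_injective_map[OF \<psi>, unfolded tU] y VU[OF z(1)] by (meson inj_onD imageI)
    then show "y \<in> (f \<circ> m) ` V" using z(1) by auto
  next
    assume "y \<in> (f \<circ> m) ` V"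
    then obtain z where z: "z \<in> V" "y = f (m z)" by auto
    have "norm (\<alpha> z) < r" using z(1) by (simp add: V_def)
    then have "norm (\<alpha> z) ^ 2 < r\<^sup>2" using power_strict_mono[of "norm (\<alpha> z)" r 2] by simp
    then show "\<psi> y \<in> ball 0 (r\<^sup>2)" using sq[OF VU[OF z(1)]] z(2) by (simp add: \<alpha>_def norm_power)
  qed
  have "homeomorphic_map (subtopology (subtopology Y (f ` U)) ((f \<circ> m) ` V))
      (subtopology (top_of_set (ball 0 1)) (ball 0 (r\<^sup>2))) \<psi>"
    by (rule homeomorphic_map_subtopologies_alt[OF \<psi>]) (use key tU in blast)
  moreover have "f ` U \<inter> (f \<circ> m) ` V = (f \<circ> m) ` V" using VU by auto
  moreover have "ball 0 1 \<inter> ball 0 (r\<^sup>2) = ball (0::complex) (r\<^sup>2)" using r2 by auto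
  ultimately have "homeomorphic_map (subtopology Y ((f \<circ> m) ` V)) (top_of_set (ball 0 (r\<^sup>2))) \<psi>"
    by (simp only: subtopology_subtopology)
  from homeomorphic_map_compose[OF this homeomorphic_map_scale_ball[OF r2(1)]]
  have h\<psi>: "homeomorphic_map (subtopology Y ((f \<circ> m) ` V)) (top_of_set (ball 0 1)) (\<lambda>y. \<psi> y / of_real (r\<^sup>2))"
    by (simp add: o_def)
  have "\<psi> ((f \<circ> m) z) / of_real (r\<^sup>2) = (\<alpha> z / of_real r)\<^sup>2" if "z \<in> V" for z
    using sq[OF VU[OF that]] by (simp add: \<alpha>_def power_divide)
  then show ?thesis
    unfolding ramified_double_cover_at_def using V pV hV h\<psi> \<phi>(2)
    by (intro exI[of _ V] exI[of _ "\<lambda>z. \<alpha> z / of_real r"] exI[of _ "\<lambda>y. \<psi> y / of_real (r\<^sup>2)"]) (simp add: \<alpha>_def)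
qed

text \<open>Compactness turns local injectivity into an embedding: a small closed disc in the
  coordinate \<psi> is mapped by f homeomorphically to its image, and the inverse, rescaled, serves
  as the new target coordinate.\<close>

lemma ramified_postcompose:
  assumes ram: "ramified_double_cover_at X Y g p" and g: "continuous_map X Y g"
    and f: "continuous_map Y Z f" and W: "openin Y W" "g p \<in> W" "inj_on f W" and Z: "Hausdorff_space Z"
  shows "ramified_double_cover_at X Z (f \<circ> g) p"
proof -
  obtain U \<phi> \<psi> where U: "openin X U" "p \<in> U"
      and \<phi>: "homeomorphic_map (subtopology X U) (top_of_set (ball (0::complex) 1)) \<phi>" "\<phi> p = 0"
      and \<psi>: "homeomorphic_map (subtopology Y (g ` U)) (top_of_set (ball (0::complex) 1)) \<psi>"
      and sq: "\<And>x. x \<in> U \<Longrightarrow> \<psi> (g x) = (\<phi> x)\<^sup>2"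
    using ram unfolding ramified_double_cover_at_def by blast
  have Ut: "U \<subseteq> topspace X" using U openin_subset by blast
  have gU: "g ` U \<subseteq> topspace Y" using Ut continuous_map_image_subset_topspace[OF g] by blast
  obtain \<xi> where \<xi>: "homeomorphic_maps (subtopology Y (g ` U)) (top_of_set (ball 0 1)) \<psi> \<xi>"
    using \<psi> homeomorphic_map_maps by blast
  have \<xi>l: "\<xi> (\<psi> y) = y" if "y \<in> g ` U" for y
    using \<xi> that gU by (auto simp: homeomorphic_maps_def)
  have \<xi>r: "\<psi> (\<xi> w) = w" if "w \<in> ball 0 1" for w
    using \<xi> that by (auto simp: homeomorphic_maps_def)
  have \<xi>c: "continuous_map (top_of_set (ball 0 1)) Y \<xi>"
    by (rule continuous_map_into_fulltopology[of _ _ "g ` U"]) (use \<xi> in \<open>simp add: homeomorphic_maps_def\<close>)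
  have gp0: "\<psi> (g p) = 0" using sq[OF U(2)] \<phi>(2) by simp
  have \<xi>0: "\<xi> 0 = g p" using \<xi>l[of "g p"] gp0 U(2) by simp
  have "openin (top_of_set (ball 0 1)) {w \<in> topspace (top_of_set (ball 0 1)). \<xi> w \<in> W}"
    using \<xi>c W(1) by (rule openin_continuous_map_preimage)
  moreover have "0 \<in> {w \<in> topspace (top_of_set (ball 0 1)). \<xi> w \<in> W}" using \<xi>0 W(2) by simp
  ultimately obtain r where r: "0 < r" "ball 0 r \<inter> ball 0 1 \<subseteq> {w \<in> topspace (top_of_set (ball 0 1)). \<xi> w \<in> W}"
    unfolding openin_contains_ball by blast
  define R where "R = min r 1 / 2"
  have R: "0 < R" "R < 1" "R < r" using r(1) by (auto simp: R_def)
  have cR: "cball 0 R \<subseteq> ball (0::complex) 1" "cball 0 R \<subseteq> ball (0::complex) r" using R by auto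
  have \<xi>W: "\<xi> w \<in> W" if "w \<in> cball 0 R" for w
  proof -
    have "w \<in> ball 0 r \<inter> ball 0 1" using that cR by blast
    then show ?thesis using r(2) by blast
  qed
  define F where "F = (\<lambda>w. f (\<xi> w))"
  have Finj: "inj_on F (cball 0 R)"
  proof (rule inj_onI)
    fix x y assume xy: "x \<in> cball 0 R" "y \<in> cball 0 R" "F x = F y"
    then have "\<xi> x = \<xi> y" using inj_onD[OF W(3)] \<xi>W by (simp add: F_def)
    then show "x = y" using \<xi>r[of x] \<xi>r[of y] xy cR(1) by (metis subsetD)
  qed
  have "continuous_map (top_of_set (cball 0 R)) Z F"
    unfolding F_def using continuous_map_from_subtopology_mono[OF \<xi>c cR(1)] f by (rule continuous_map_comp)
  then have "embedding_map (top_of_set (cball 0 R)) Z F"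
    using Finj Z by (intro continuous_imp_embedding_map) (auto simp: compact_space_subtopology)
  then obtain Fi where Fi: "homeomorphic_maps (top_of_set (cball 0 R)) (subtopology Z (F ` cball 0 R)) F Fi"
    unfolding embedding_map_def homeomorphic_map_maps topspace_euclidean_subtopology by blast
  have Fil: "Fi (F w) = w" if "w \<in> cball 0 R" for w
    using Fi that by (auto simp: homeomorphic_maps_def)
  have bc: "ball 0 R \<subseteq> cball (0::complex) R" by auto
  have "homeomorphic_map (subtopology Z (F ` cball 0 R)) (top_of_set (cball 0 R)) Fi"
    using Fi homeomorphic_maps_sym homeomorphic_map_maps by blast
  then have "homeomorphic_map (subtopology (subtopology Z (F ` cball 0 R)) (F ` ball 0 R))
      (subtopology (top_of_set (cball 0 R)) (ball 0 R)) Fi"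
  proof (rule homeomorphic_map_subtopologies_alt)
    fix y assume "y \<in> topspace (subtopology Z (F ` cball 0 R))"
    then obtain w where w: "w \<in> cball 0 R" "y = F w" by auto
    have "y \<in> F ` ball 0 R \<longleftrightarrow> w \<in> ball 0 R"
      unfolding w(2) using inj_on_image_mem_iff[OF Finj w(1) bc] .
    then show "Fi y \<in> ball 0 R \<longleftrightarrow> y \<in> F ` ball 0 R" using Fil[OF w(1)] w(2) by simp
  qed
  moreover have "F ` cball 0 R \<inter> F ` ball 0 R = F ` ball 0 R" "cball 0 R \<inter> ball 0 R = ball (0::complex) R" using bc by blast+
  ultimately have "homeomorphic_map (subtopology Z (F ` ball 0 R)) (top_of_set (ball 0 R)) Fi"
    by (simp only: subtopology_subtopology)
  from homeomorphic_map_compose[OF this homeomorphic_map_scale_ball[OF R(1)]]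
  have hF: "homeomorphic_map (subtopology Z (F ` ball 0 R)) (top_of_set (ball 0 1)) (\<lambda>y. Fi y / of_real R)"
    by (simp add: o_def)
  \<comment> \<open>Squaring maps the disc of radius sqrt R onto the disc of radius R.\<close>
  have sR: "0 < sqrt R" "sqrt R < 1" using R by auto
  have subS: "ball 0 (sqrt R) \<subseteq> ball (0::complex) 1" using sR(2) by (intro subset_ball) simp
  define V where "V = {x \<in> topspace (subtopology X U). \<phi> x \<in> ball 0 (sqrt R)}"
  have "openin (top_of_set (ball 0 1)) (ball (0::complex) (sqrt R))"
    using subS by (intro open_subset) auto
  then have "openin (subtopology X U) V"
    unfolding V_def using homeomorphic_imp_continuous_map[OF \<phi>(1)] by (intro openin_continuous_map_preimage)
  then have V: "openin X V" using U(1) openin_trans_full by blast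
  have VU: "V \<subseteq> U" by (auto simp: V_def)
  have pV: "p \<in> V" using U Ut \<phi>(2) sR by (auto simp: V_def)
  have "homeomorphic_map (subtopology (subtopology X U) V) (subtopology (top_of_set (ball 0 1)) (ball 0 (sqrt R))) \<phi>"
    by (rule homeomorphic_map_subtopologies_alt[OF \<phi>(1)]) (auto simp: V_def)
  moreover have "U \<inter> V = V" "ball 0 1 \<inter> ball 0 (sqrt R) = ball (0::complex) (sqrt R)" using VU subS by blast+
  ultimately have "homeomorphic_map (subtopology X V) (top_of_set (ball 0 (sqrt R))) \<phi>"
    by (simp only: subtopology_subtopology)
  from homeomorphic_map_compose[OF this homeomorphic_map_scale_ball[OF sR(1)]]
  have hV: "homeomorphic_map (subtopology X V) (top_of_set (ball 0 1)) (\<lambda>x. \<phi> x / of_real (sqrt R))"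
    by (simp add: o_def)
  have gF: "(f \<circ> g) x = F ((\<phi> x)\<^sup>2)" "(\<phi> x)\<^sup>2 \<in> ball 0 R" if "x \<in> V" for x
  proof -
    have "\<xi> ((\<phi> x)\<^sup>2) = g x" using \<xi>l[of "g x"] sq[of x] that VU by auto
    then show "(f \<circ> g) x = F ((\<phi> x)\<^sup>2)" by (simp add: F_def)
    have "norm (\<phi> x) < sqrt R" using that by (simp add: V_def)
    then have "norm (\<phi> x) ^ 2 < sqrt R ^ 2" by (intro power_strict_mono) auto
    then show "(\<phi> x)\<^sup>2 \<in> ball 0 R" using R by (simp add: norm_power)
  qed
  have img: "(f \<circ> g) ` V = F ` ball 0 R"
  proof
    show "(f \<circ> g) ` V \<subseteq> F ` ball 0 R" using gF by auto
    show "F ` ball 0 R \<subseteq> (f \<circ> g) ` V"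
    proof
      fix y assume "y \<in> F ` ball 0 R"
      then obtain w where w: "w \<in> ball 0 R" "y = F w" by blast
      have "csqrt w \<in> ball 0 (sqrt R)" using w(1) by simp
      moreover from this have "csqrt w \<in> ball 0 1" using subS by blast
      then have "csqrt w \<in> \<phi> ` topspace (subtopology X U)"
        using homeomorphic_imp_surjective_map[OF \<phi>(1)] by simp
      ultimately obtain x where "x \<in> V" "\<phi> x = csqrt w" by (force simp: V_def simp del: mem_ball)
      then show "y \<in> (f \<circ> g) ` V" using gF(1)[of x] w(2) by (intro image_eqI[of _ _ x]) auto
    qed
  qed
  have "Fi ((f \<circ> g) x) / of_real R = (\<phi> x / of_real (sqrt R))\<^sup>2" if "x \<in> V" for x
  proof -
    have "Fi ((f \<circ> g) x) = (\<phi> x)\<^sup>2" using gF[OF that] Fil bc by (metis subsetD)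
    moreover have "(of_real (sqrt R))\<^sup>2 = (of_real R :: complex)" using R(1) by (simp flip: of_real_power)
    ultimately show ?thesis by (simp add: power_divide)
  qed
  then show ?thesis
    unfolding ramified_double_cover_at_def using V pV hV hF img \<phi>(2)
    by (intro exI[of _ V] exI[of _ "\<lambda>x. \<phi> x / of_real (sqrt R)"] exI[of _ "\<lambda>y. Fi y / of_real R"]) simp
qed

text \<open>The Cayley transform that sends \<open>u\<close> to \<open>0\<close> and \<open>- u\<close> to infinity.\<close>

lemma surface_chart_cball:
  fixes u :: complex
  assumes u: "norm u = 1"
  shows "surface_chart (top_of_set (cball 0 1)) (cball 0 1 - {- u}) (\<lambda>z. \<i> * (u - z) / (u + z))"
proof -
  let ?U = "cball 0 1 - {- u}" and ?\<phi> = "\<lambda>z. \<i> * (u - z) / (u + z)" and ?g = "\<lambda>w. u * (\<i> - w) / (\<i> + w)"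
  have nz: "u + z \<noteq> 0" if "z \<in> ?U" for z using that by (auto simp: add_eq_0_iff)
  have nz': "\<i> + w \<noteq> 0" if "w \<in> half_plane" for w using that by (auto simp: complex_eq_iff)
  have u0: "u \<noteq> 0" using u by auto
  have \<phi>: "?\<phi> z \<in> half_plane" if "z \<in> ?U" for z
  proof -
    have "Im (?\<phi> z) = Re ((u - z) / (u + z))"
      unfolding times_divide_eq_right[symmetric] by (rule Im_i_times)
    also have "\<dots> = ((norm u)\<^sup>2 - (norm z)\<^sup>2) / ((Re (u + z))\<^sup>2 + (Im (u + z))\<^sup>2)"
    proof -
      have "Re (u - z) * Re (u + z) + Im (u - z) * Im (u + z) = (norm u)\<^sup>2 - (norm z)\<^sup>2"
        unfolding cmod_power2 by (simp add: power2_eq_square algebra_simps)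
      then show ?thesis unfolding Re_divide by (simp only:)
    qed
    finally have "Im (?\<phi> z) = ((norm u)\<^sup>2 - (norm z)\<^sup>2) / ((Re (u + z))\<^sup>2 + (Im (u + z))\<^sup>2)" .
    moreover have "(norm z)\<^sup>2 \<le> (norm u)\<^sup>2" using that u by (simp add: power_le_one)
    ultimately show ?thesis by simp
  qed
  have g: "?g w \<in> ?U" if w: "w \<in> half_plane" for w
  proof -
    have "(norm (\<i> - w))\<^sup>2 \<le> (norm (\<i> + w))\<^sup>2"
      unfolding cmod_power2 using w by (simp add: power2_eq_square algebra_simps)
    then have "norm (\<i> - w) \<le> norm (\<i> + w)" by (rule power2_le_imp_le) simp
    then have "norm (?g w) \<le> 1" using nz'[OF w] u by (simp add: norm_divide norm_mult divide_le_eq_1)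
    moreover have "?g w \<noteq> - u"
    proof
      assume "?g w = - u"
      then have "u * (\<i> - w) = u * (- (\<i> + w))" using nz'[OF w] by (simp add: field_simps)
      then have "\<i> - w = - (\<i> + w)" using u0 mult_left_cancel by blast
      then show False by (simp add: complex_eq_iff)
    qed
    ultimately show ?thesis by simp
  qed
  have gl: "?g (?\<phi> z) = z" if z: "z \<in> ?U" for z
  proof -
    have "\<i> - ?\<phi> z = \<i> * (2 * z) / (u + z)" "\<i> + ?\<phi> z = \<i> * (2 * u) / (u + z)"
      using nz[OF z] by (simp_all add: field_simps)
    then show ?thesis using nz[OF z] u0 by simp
  qed
  have gr: "?\<phi> (?g w) = w" if w: "w \<in> half_plane" for w
  proof -
    have "u - ?g w = u * (2 * w) / (\<i> + w)" "u + ?g w = u * (2 * \<i>) / (\<i> + w)"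
      using nz'[OF w] by (simp_all add: field_simps)
    then show ?thesis using nz'[OF w] u0 by simp
  qed
  have "continuous_on ?U ?\<phi>" "continuous_on half_plane ?g"
    using nz nz' by (intro continuous_intros; blast)+
  then have "homeomorphic_maps (top_of_set ?U) (top_of_set half_plane) ?\<phi> ?g"
    unfolding homeomorphic_maps_def continuous_map_in_subtopology using \<phi> g gl gr
    by (auto simp del: mem_cball)
  then have hom: "homeomorphic_map (top_of_set ?U) (top_of_set half_plane) ?\<phi>"
    using homeomorphic_map_maps by blast
  then have "?\<phi> ` ?U = half_plane" using homeomorphic_imp_surjective_map by fastforce
  moreover have "openin (top_of_set (cball 0 1)) ?U"
    using assms by (intro openin_diff) (auto simp: closedin_singleton)
  moreover have "subtopology (top_of_set (cball 0 1)) ?U = top_of_set ?U"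
    by (simp add: subtopology_subtopology Int_absorb1)
  ultimately show ?thesis using hom by (simp add: surface_chart_def)
qed

section \<open>The polygon as a surface\<close>

lemma norm_polygon_vertex: "norm (polygon_vertex n i) = 1"
  by (simp add: polygon_vertex_def)

lemma polygon_simps [simp]:
  "surface_space (polygon n) = top_of_set (cball 0 1)"
  "boundary_marked (polygon n) = polygon_vertex n ` {1..n}"
  "ordinary_punctures (polygon n) = {}" "special_punctures (polygon n) = {}"
  "marked_points (polygon n) = polygon_vertex n ` {1..n}"
  by (simp_all add: polygon_def marked_points_def)

text \<open>The Cayley charts for 1 and -1 miss one point each and together cover the disc. The
  chart for a vertex sends that vertex to 0 and so exhibits it as a boundary point.\<close>

lemma tame_polygon: "tame_surface (polygon n)"
proof -
  have ch: "\<exists>V \<phi>. surface_chart (top_of_set (cball 0 1)) V \<phi> \<and> z \<in> V" if z: "z \<in> cball 0 1" for z :: complex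
  proof (cases "z = - 1")
    case True
    then show ?thesis using surface_chart_cball[of "-1"] by force
  next
    case False
    then show ?thesis using surface_chart_cball[of 1] z by force
  qed
  have "polygon_vertex n i \<in> surface_boundary (top_of_set (cball 0 1))" for i
  proof -
    have "polygon_vertex n i \<noteq> - polygon_vertex n i" using norm_polygon_vertex[of n i] by auto
    then show ?thesis
      unfolding surface_boundary_def using surface_chart_cball[OF norm_polygon_vertex[of n i]] norm_polygon_vertex[of n i]
      by (intro CollectI exI[of _ "cball 0 1 - {- polygon_vertex n i}"] exI conjI) auto
  qed
  then show ?thesis
    unfolding tame_surface_def Let_def using ch norm_polygon_vertex
    by (auto simp: Hausdorff_space_subtopology compact_space_subtopology)
qed


lemma polygon_curvesD:
  assumes "c \<in> curves (polygon n)"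
  shows "continuous_on {0..1} c" "\<And>t. t \<in> {0..1} \<Longrightarrow> c t \<in> cball 0 1"
  using curvesD[OF assms] by (auto simp: pathin_def simp del: mem_cball)

lemma polygon_proper: "c \<in> curves (polygon n) \<Longrightarrow> c \<in> proper_curves (polygon n)"
  by (simp add: curves_def curves_avoiding_def)

text \<open>The disc is convex and has no punctures, so straight lines join any two curves with
  common ends. Hence \<open>push_in\<close> applied to a chord stays in the class of the
  chord.\<close>

lemma polygon_curves_homotopic:
  assumes c: "c \<in> curves (polygon n)" and d: "d \<in> curves (polygon n)" and ends: "c 0 = d 0" "c 1 = d 1"
  shows "(c, d) \<in> curve_homotopy (polygon n)"
proof (rule curve_homotopy_patch[OF polygon_proper[OF c] order_refl zero_le_one order_refl])
  show "continuous_map (top_of_set (cball 0 1)) (surface_space (polygon n)) (\<lambda>z. z)" by simp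
  have "continuous_on ({0..1::real} \<times> {0..1}) (\<lambda>x. h (snd x))" if "continuous_on {0..1} h" for h :: "real \<Rightarrow> complex"
    by (rule continuous_on_compose2[OF that]) (auto intro: continuous_intros)
  then show "continuous_on ({0..1} \<times> {0..1}) (\<lambda>(s, t). (1 - s) *\<^sub>R c t + s *\<^sub>R d t)"
    unfolding case_prod_unfold using polygon_curvesD(1)[OF c] polygon_curvesD(1)[OF d] by (intro continuous_intros) auto
  show "(1 - s) *\<^sub>R c t + s *\<^sub>R d t \<in> cball 0 1" if "s \<in> {0..1}" "t \<in> {0..1}" for s t
    using that polygon_curvesD(2)[OF c] polygon_curvesD(2)[OF d]
    by (intro convexD_alt convex_cball) (simp_all only: atLeastAtMost_iff)
  show "(1 - s) *\<^sub>R c 0 + s *\<^sub>R d 0 = c 0 \<and> (1 - s) *\<^sub>R c 1 + s *\<^sub>R d 1 = c 1" for s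
    using ends by (simp flip: scaleR_left_distrib)
qed auto

lemma chord_curve:
  assumes "i \<in> {1..n}" "j \<in> {1..n}"
  shows "linepath (polygon_vertex n i) (polygon_vertex n j) \<in> curves (polygon n)"
proof -
  have "linepath (polygon_vertex n i) (polygon_vertex n j) ` {0..1} \<subseteq> cball 0 1"
    using closed_segment_subset[OF _ _ convex_cball, of "polygon_vertex n i" 0 1 "polygon_vertex n j"]
    by (simp add: linepath_image_01 norm_polygon_vertex)
  then have "pathin (top_of_set (cball 0 1)) (linepath (polygon_vertex n i) (polygon_vertex n j))"
    by (auto simp: pathin_def continuous_map_in_subtopology simp del: mem_cball intro!: continuous_on_linepath)
  then show ?thesis
    using assms by (auto simp: curves_def linepath_def)
qed

lemma chord_in: "i \<in> {1..n} \<Longrightarrow> j \<in> {1..n} \<Longrightarrow> chord n i j \<in> reduced_classes (polygon n)"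
  unfolding chord_def reduced_classes_iff using chord_curve by blast

text \<open>Pulls the sides of a polygon with vertex set \<open>V\<close> inwards and fixes the vertices.\<close>

definition push_in :: "complex set \<Rightarrow> real \<Rightarrow> complex \<Rightarrow> complex" where
  "push_in V \<epsilon> z = (1 - \<epsilon> * infdist (sgn z) V) *\<^sub>R z"

text \<open>Each ray from 0 is scaled by a positive factor that depends on the direction only,
  whence injectivity. \<open>sgn\<close> is not continuous at 0, so continuity there comes from the
  bound on the norm. A point moved into V has the same image as a fixed point, so it already lies in
  V.\<close>

lemma push_in:
  assumes V: "finite V" "V \<noteq> {}" "V \<subseteq> sphere 0 1" and \<epsilon>: "0 < \<epsilon>" "\<epsilon> < 1/4"
  shows "continuous_on UNIV (push_in V \<epsilon>)" "inj (push_in V \<epsilon>)"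
    "\<And>z. norm (push_in V \<epsilon> z) \<le> norm z" "\<And>z. z \<in> V \<Longrightarrow> push_in V \<epsilon> z = z"
    "\<And>z. norm z \<le> 1 \<Longrightarrow> push_in V \<epsilon> z \<in> V \<Longrightarrow> z \<in> V"
proof -
  have d: "0 \<le> infdist (sgn z) V" "infdist (sgn z) V \<le> 2" for z
  proof -
    show "0 \<le> infdist (sgn z) V" by (rule infdist_nonneg)
    obtain v where v: "v \<in> V" using V by blast
    have "infdist (sgn z) V \<le> dist (sgn z) v" using v by (rule infdist_le)
    also have "\<dots> \<le> norm (sgn z) + norm v" by (simp add: dist_norm norm_triangle_ineq4)
    also have "\<dots> \<le> 2" using v V(3) by (auto simp: norm_sgn)
    finally show "infdist (sgn z) V \<le> 2" .
  qed
  define q where "q = (\<lambda>z. 1 - \<epsilon> * infdist (sgn z) V)"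
  have q: "0 < q z" "q z \<le> 1" for z
  proof -
    \<comment> \<open>Distances to V are at most 2, so \<epsilon> < 1/4 keeps the scaling factor at
      1/2 or more.\<close>
    have "\<epsilon> * infdist (sgn z) V \<le> (1/4) * 2" using d[of z] \<epsilon> by (intro mult_mono) auto
    then show "0 < q z" by (simp add: q_def)
    show "q z \<le> 1" using d[of z] \<epsilon> by (simp add: q_def)
  qed
  have pq: "push_in V \<epsilon> z = q z *\<^sub>R z" for z by (simp add: push_in_def q_def)
  show le: "norm (push_in V \<epsilon> z) \<le> norm z" for z
    unfolding pq using q[of z] by (simp add: mult_left_le_one_le)
  show "continuous_on UNIV (push_in V \<epsilon>)"
    unfolding continuous_on_eq_continuous_within
  proof
    fix z :: complex
    show "continuous (at z) (push_in V \<epsilon>)"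
    proof (cases "z = 0")
      case True
      have "(push_in V \<epsilon> \<longlongrightarrow> 0) (at 0)"
      proof (rule Lim_null_comparison)
        show "\<forall>\<^sub>F x in at 0. norm (push_in V \<epsilon> x) \<le> norm x" using le by simp
        show "((\<lambda>x::complex. norm x) \<longlongrightarrow> 0) (at 0)" using tendsto_norm_zero tendsto_ident_at by blast
      qed
      then show ?thesis using True by (simp add: continuous_within pq)
    next
      case False
      then have "continuous (at z) (\<lambda>z. sgn z)" by (intro continuous_intros)
      then have "continuous (at z) (\<lambda>z. infdist (sgn z) V)" by (rule continuous_infdist)
      then show ?thesis unfolding push_in_def using False by (intro continuous_intros)
    qed
  qed
  have sq: "sgn (q z *\<^sub>R z) = sgn z" for z using q[of z] by (simp add: sgn_scaleR)
  show "inj (push_in V \<epsilon>)"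
  proof (rule injI)
    fix x y assume xy: "push_in V \<epsilon> x = push_in V \<epsilon> y"
    then have "sgn x = sgn y" unfolding pq using sq by metis
    then have "q x = q y" by (simp add: q_def)
    then show "x = y" using xy q[of y] by (simp add: pq)
  qed
  have sV: "sgn z = z" if "z \<in> V" for z using that V(3) by (auto simp: sgn_div_norm)
  show fixV: "push_in V \<epsilon> z = z" if "z \<in> V" for z
    using sV[OF that] that by (simp add: push_in_def)
  show "z \<in> V" if z: "norm z \<le> 1" "push_in V \<epsilon> z \<in> V" for z
  proof -
    have "push_in V \<epsilon> (push_in V \<epsilon> z) = push_in V \<epsilon> z" using fixV[OF z(2)] .
    then have "push_in V \<epsilon> z = z" using \<open>inj (push_in V \<epsilon>)\<close> by (simp add: inj_eq)
    then show ?thesis using z(2) by simp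
  qed
qed

text \<open>A point y of F is reached from the unit circle for at most one \<epsilon>: its direction
  determines the distance d to V, and 1 - \<epsilon> d has to be the norm of y. So only finitely
  many values of \<epsilon> are excluded.\<close>

lemma push_in_avoid:
  assumes V: "finite V" "V \<noteq> {}" "V \<subseteq> sphere 0 1" and F: "finite F" "F \<inter> V = {}"
  obtains \<epsilon> where "0 < \<epsilon>" "\<epsilon> < 1/4" "\<And>z. norm z = 1 \<Longrightarrow> push_in V \<epsilon> z \<notin> F"
proof -
  define E where "E = (\<lambda>y. (1 - norm y) / infdist (sgn y) V) ` F"
  have "finite E" using F by (simp add: E_def)
  then have "infinite ({0<..<1/4} - E)" by (simp add: Diff_infinite_finite infinite_Ioo)
  then obtain \<epsilon> where "\<epsilon> \<in> {0<..<1/4} - E" using infinite_imp_nonempty by blast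
  then have \<epsilon>: "0 < \<epsilon>" "\<epsilon> < 1/4" "\<epsilon> \<notin> E" by auto
  show thesis
  proof (rule that[OF \<epsilon>(1,2)])
    fix z :: complex assume z: "norm z = 1"
    show "push_in V \<epsilon> z \<notin> F"
    proof
      assume yF: "push_in V \<epsilon> z \<in> F"
      define d where "d = infdist (sgn z) V"
      have sz: "sgn z = z" using z by (simp add: sgn_div_norm)
      have "z \<notin> V" using push_in(4)[OF V \<epsilon>(1,2), of z] yF F(2) by auto
      then have d0: "d \<noteq> 0"
        unfolding d_def sz using V finite_imp_closed in_closed_iff_infdist_zero by blast
      have "d \<le> 2"
      proof -
        obtain v where v: "v \<in> V" using V by blast
        have "d \<le> dist z v" unfolding d_def sz using v by (rule infdist_le)
        also have "\<dots> \<le> norm z + norm v" by (simp add: dist_norm norm_triangle_ineq4)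
        finally show ?thesis using v V(3) z by auto
      qed
      moreover have "0 \<le> d" unfolding d_def by (rule infdist_nonneg)
      ultimately have "\<epsilon> * d \<le> (1/4) * 2" using \<epsilon> by (intro mult_mono) auto
      then have pos: "0 < 1 - \<epsilon> * d" by simp
      have y: "push_in V \<epsilon> z = (1 - \<epsilon> * d) *\<^sub>R z" by (simp add: push_in_def d_def)
      have "sgn (push_in V \<epsilon> z) = sgn z" "norm (push_in V \<epsilon> z) = 1 - \<epsilon> * d"
        unfolding y using pos z by (simp_all add: sgn_scaleR)
      then have "\<epsilon> = (1 - norm (push_in V \<epsilon> z)) / infdist (sgn (push_in V \<epsilon> z)) V"
        using d0 by (simp add: d_def[symmetric])
      then have "\<epsilon> \<in> E" unfolding E_def using yF by (rule image_eqI)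
      then show False using \<epsilon>(3) by blast
    qed
  qed
qed

text \<open>Discreteness of fibres is hard to follow through a composition while finiteness is easy;
  this converts the latter into the former.\<close>

lemma finite_discrete_subtopology:
  assumes "Hausdorff_space X" "finite S" "S \<subseteq> topspace X"
  shows "subtopology X S = discrete_topology S"
proof -
  have "openin (subtopology X S) {x}" if "x \<in> S" for x
  proof -
    have "closedin X (S - {x})"
      using assms t1_space_closedin_finite Hausdorff_imp_t1_space by (metis Diff_subset finite_Diff order_trans)
    then have "openin (subtopology X S) (S \<inter> (topspace X - (S - {x})))" by (intro openin_subtopology_Int2) blast
    moreover have "S \<inter> (topspace X - (S - {x})) = {x}" using that assms(3) by blast
    ultimately show ?thesis by simp
  qed
  then show ?thesis
    using assms(3) discrete_topology_unique[of S "subtopology X S"] by (auto simp: Int_absorb1)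
qed

text \<open>Composing with a morphism need not turn a morphism of a polygon into another one, since a side of the polygon may run
  through a branch point. Pulling the sides inwards avoids this without changing the classes of the chords.\<close>

lemma polygon_push_in:
  assumes f: "tame_morphism \<Sigma> \<Sigma>' f" and g: "surface_morphism (polygon n) \<Sigma> g" and n: "1 \<le> n"
  obtains g' where "tame_morphism (polygon n) \<Sigma> g'" "tame_morphism (polygon n) \<Sigma>' (f \<circ> g')"
    "\<And>i j. i \<in> {1..n} \<Longrightarrow> j \<in> {1..n} \<Longrightarrow> chord_image n \<Sigma> g' i j = chord_image n \<Sigma> g i j"
proof -
  interpret f: tame_morphism \<Sigma> \<Sigma>' f by fact
  interpret g: tame_morphism "polygon n" \<Sigma> g
    using f.tame(1) g tame_polygon by unfold_locales
  let ?P = "top_of_set (cball (0::complex) 1)"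
  let ?X = "surface_space \<Sigma>" and ?Y = "surface_space \<Sigma>'"
  define V where "V = polygon_vertex n ` {1..n}"
  have V: "finite V" "V \<noteq> {}" "V \<subseteq> sphere 0 1"
    using n norm_polygon_vertex by (auto simp: V_def)
  have gc: "continuous_map ?P ?X g" using g.continuous_f by simp
  \<comment> \<open>Special punctures go to special punctures, so this set includes the points that
    g sends to special punctures of \<Sigma>. Keeping the pushed sides off it serves both g' and
    \<open>f \<circ> g'\<close>.\<close>
  define bad where "bad = {z \<in> cball 0 1. f (g z) \<in> special_punctures \<Sigma>'}"
  have "bad \<subseteq> {z \<in> topspace ?P. g z \<in> {x \<in> topspace ?X. f x \<in> special_punctures \<Sigma>'}}"
    using continuous_map_image_subset_topspace[OF gc] by (auto simp: bad_def)
  moreover have "finite {z \<in> topspace ?P. g z \<in> {x \<in> topspace ?X. f x \<in> special_punctures \<Sigma>'}}"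
    using g.finite_preimage[OF f.finite_preimage[OF f.tame_target(3)]] by simp
  ultimately have "finite bad" by (rule finite_subset)
  have gV: "{z \<in> cball 0 1. g z \<in> marked_points \<Sigma>} = V" using g.marked_preimage by (simp add: V_def)
  have fV: "{x \<in> topspace ?X. f x \<in> marked_points \<Sigma>'} = marked_points \<Sigma>" by (rule f.marked_preimage)
  have "bad \<inter> V = {}"
    using gV fV f.tame_target(6) by (auto simp: bad_def simp flip: gV)
  obtain \<epsilon> where \<epsilon>: "0 < \<epsilon>" "\<epsilon> < 1/4" "\<And>z. norm z = 1 \<Longrightarrow> push_in V \<epsilon> z \<notin> bad"
    using push_in_avoid[OF V \<open>finite bad\<close> \<open>bad \<inter> V = {}\<close>] by blast
  define e where "e = push_in V \<epsilon>"
  note E = push_in[OF V \<epsilon>(1,2), folded e_def]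
  have e1: "norm (e z) \<le> 1" if "norm z \<le> 1" for z using E(3)[of z] that by simp
  have ec: "continuous_map ?P ?P e"
    using e1 continuous_on_subset[OF E(1)] by (auto simp: continuous_map_in_subtopology)
  have interior: "norm z < 1" if "norm z \<le> 1" "f (g (e z)) \<in> special_punctures \<Sigma>'" for z
  proof -
    have "e z \<in> bad" using that e1 by (simp add: bad_def)
    then have "norm z \<noteq> 1" using \<epsilon>(3)[of z] by (auto simp: e_def)
    then show ?thesis using that(1) by simp
  qed
  define g' where "g' = g \<circ> e"
  have g'c: "continuous_map ?P ?X g'" unfolding g'_def using ec gc by (rule continuous_map_compose)
  have fin: "finite {z \<in> topspace ?P. g' z \<in> S}" if "finite S" for S
  proof -
    have "finite {z \<in> topspace ?P. g z \<in> S}" using g.finite_preimage[OF that] by simp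
    then have "finite (e -` {z \<in> topspace ?P. g z \<in> S})"
      using E(2) by (rule finite_vimageI)
    moreover have "{z \<in> topspace ?P. g' z \<in> S} \<subseteq> e -` {z \<in> topspace ?P. g z \<in> S}"
      using e1 by (auto simp: g'_def)
    ultimately show ?thesis by (rule rev_finite_subset)
  qed
  have marked: "{z \<in> topspace ?P. g' z \<in> marked_points \<Sigma>} = V"
  proof -
    have "g' z \<in> marked_points \<Sigma> \<longleftrightarrow> z \<in> V" if z: "norm z \<le> 1" for z
    proof -
      have "g' z \<in> marked_points \<Sigma> \<longleftrightarrow> e z \<in> V" unfolding gV[symmetric] using e1[OF z] by (simp add: g'_def)
      then show ?thesis using E(4,5) z by metis
    qed
    then show ?thesis using V(3) by auto
  qed
  have Hp: "Hausdorff_space ?P" by (rule Hausdorff_space_subtopology) simp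
  have g'_inj: "\<exists>U. openin ?P U \<and> p \<in> U \<and> inj_on g' U"
    if p: "p \<in> cball 0 1" "g' p \<notin> special_punctures \<Sigma>" for p
  proof -
    have "e p \<in> topspace (surface_space (polygon n)) - branch_points (polygon n) \<Sigma> g"
      using p e1 by (auto simp: branch_points_def g'_def)
    then obtain U where U: "openin ?P U" "e p \<in> U" "inj_on g U" using g.locally_injective by auto
    have "openin ?P {z \<in> topspace ?P. e z \<in> U}" using ec U(1) by (rule openin_continuous_map_preimage)
    moreover have "inj_on g' {z \<in> topspace ?P. e z \<in> U}"
    proof (rule inj_onI)
      fix x y assume "x \<in> {z \<in> topspace ?P. e z \<in> U}" "y \<in> {z \<in> topspace ?P. e z \<in> U}" "g' x = g' y"
      then have "e x = e y" using inj_onD[OF U(3)] by (simp add: g'_def)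
      then show "x = y" by (rule injD[OF E(2)])
    qed
    ultimately show ?thesis using U(2) p(1) by (intro exI[of _ "{z \<in> topspace ?P. e z \<in> U}"]) auto
  qed
  have g'_ram: "ramified_double_cover_at ?P ?X g' p" if p: "p \<in> cball 0 1" "g' p \<in> special_punctures \<Sigma>" for p
  proof -
    have "norm p < 1" using interior[of p] p f.special_image by (auto simp: g'_def)
    have "e p \<in> branch_points (polygon n) \<Sigma> g" using p e1 by (auto simp: branch_points_def g'_def)
    then have "ramified_double_cover_at ?P ?X g (e p)" using g.ramified by simp
    then show ?thesis
      unfolding g'_def
    proof (rule ramified_precompose)
      show "g ` topspace ?P \<subseteq> topspace ?X" using continuous_map_image_subset_topspace[OF gc] .
      show "open (ball (0::complex) 1)" "ball (0::complex) 1 \<subseteq> cball 0 1" by auto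
      show "p \<in> ball 0 1" using \<open>norm p < 1\<close> by simp
      show "inj_on e (ball 0 1)" using E(2) by (rule inj_on_subset) simp
    qed (rule ec)
  qed
  have mg': "surface_morphism (polygon n) \<Sigma> g'"
    unfolding surface_morphism_def Let_def polygon_simps
  proof (intro conjI ballI)
    show "subtopology ?P {x \<in> topspace ?P. g' x = y} = discrete_topology {x \<in> topspace ?P. g' x = y}" for y
      using fin[of "{y}"] by (intro finite_discrete_subtopology Hp) auto
  qed (use g'c marked g'_inj g'_ram in \<open>auto simp: branch_points_def V_def\<close>)
  then interpret g': tame_morphism "polygon n" \<Sigma> g'
    using f.tame(1) tame_polygon by unfold_locales
  have "surface_morphism (polygon n) \<Sigma>' (f \<circ> g')"
    unfolding surface_morphism_def Let_def polygon_simps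
  proof (intro conjI ballI)
    show "continuous_map ?P ?Y (f \<circ> g')" using g'c f.continuous_f by (rule continuous_map_compose)
    have g't: "g' z \<in> topspace ?X" if "z \<in> cball 0 1" for z
      using continuous_map_image_subset_topspace[OF g'c] that by auto
    show "subtopology ?P {x \<in> topspace ?P. (f \<circ> g') x = y} = discrete_topology {x \<in> topspace ?P. (f \<circ> g') x = y}" for y
    proof (rule finite_discrete_subtopology[OF Hp])
      have "{x \<in> topspace ?P. (f \<circ> g') x = y} \<subseteq> {z \<in> topspace ?P. g' z \<in> {x \<in> topspace ?X. f x \<in> {y}}}"
        using g't by auto
      moreover have "finite {z \<in> topspace ?P. g' z \<in> {x \<in> topspace ?X. f x \<in> {y}}}"
        by (intro fin f.finite_preimage) simp
      ultimately show "finite {x \<in> topspace ?P. (f \<circ> g') x = y}" by (rule finite_subset)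
    qed auto
    have "(f \<circ> g') z \<in> marked_points \<Sigma>' \<longleftrightarrow> g' z \<in> marked_points \<Sigma>" if "z \<in> cball 0 1" for z
      unfolding fV[symmetric] using g't[OF that] by simp
    then show "{x \<in> topspace ?P. (f \<circ> g') x \<in> marked_points \<Sigma>'} = polygon_vertex n ` {1..n}"
      using marked by (auto simp: V_def)
    fix p
    {
      assume "p \<in> topspace ?P - branch_points (polygon n) \<Sigma>' (f \<circ> g')"
      then have p: "p \<in> cball 0 1" "f (g' p) \<notin> special_punctures \<Sigma>'" by (auto simp: branch_points_def)
      then have "g' p \<notin> special_punctures \<Sigma>" using f.special_image by blast
      then obtain U where U: "openin ?P U" "p \<in> U" "inj_on g' U" using g'_inj[OF p(1)] by blast
      have "g' p \<in> topspace ?X - branch_points \<Sigma> \<Sigma>' f" using p g't by (auto simp: branch_points_def)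
      then obtain W where W: "openin ?X W" "g' p \<in> W" "inj_on f W" using f.locally_injective by blast
      have "openin ?P (U \<inter> {z \<in> topspace ?P. g' z \<in> W})"
        using U(1) openin_continuous_map_preimage[OF g'c W(1)] by (rule openin_Int)
      moreover have "inj_on (f \<circ> g') (U \<inter> {z \<in> topspace ?P. g' z \<in> W})"
        using U(3) W(3) by (auto simp: inj_on_def)
      ultimately show "\<exists>U. openin ?P U \<and> p \<in> U \<and> inj_on (f \<circ> g') U"
        using U(2) W(2) p(1) by (intro exI[of _ "U \<inter> {z \<in> topspace ?P. g' z \<in> W}"]) auto
    }
    {
      assume "p \<in> branch_points (polygon n) \<Sigma>' (f \<circ> g')"
      then have p: "p \<in> cball 0 1" "f (g' p) \<in> special_punctures \<Sigma>'" by (auto simp: branch_points_def)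
      have p1: "norm p < 1" using interior[of p] p by (auto simp: g'_def)
      show "ramified_double_cover_at ?P ?Y (f \<circ> g') p"
      \<comment> \<open>Exactly one of the two maps ramifies here: a special puncture of \<Sigma> is
        not a branch point of f, and elsewhere g' is locally injective. Fourfold ramification cannot
        occur.\<close>
      proof (cases "g' p \<in> special_punctures \<Sigma>")
        case True
        then have "g' p \<in> topspace ?X - branch_points \<Sigma> \<Sigma>' f" using p g't by (auto simp: branch_points_def)
        then obtain W where W: "openin ?X W" "g' p \<in> W" "inj_on f W" using f.locally_injective by blast
        show ?thesis
          by (rule ramified_postcompose[OF g'_ram[OF p(1) True] g'c f.continuous_f W f.tame_target(1)])
      next
        case False
        then obtain U where U: "openin ?P U" "p \<in> U" "inj_on g' U" using g'_inj[OF p(1)] by blast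
        have "g' p \<in> branch_points \<Sigma> \<Sigma>' f" using p False g't by (auto simp: branch_points_def)
        then have "ramified_double_cover_at ?X ?Y f (g' p)" by (rule f.ramified)
        then show ?thesis
        proof (rule ramified_precompose)
          show "f ` topspace ?X \<subseteq> topspace ?Y" using continuous_map_image_subset_topspace[OF f.continuous_f] .
          obtain T where T: "open T" "U = cball 0 1 \<inter> T" using U(1) openin_open by blast
          then have "U \<inter> ball 0 1 = T \<inter> ball 0 1" by auto
          then show "open (U \<inter> ball 0 1)" using T(1) by (simp add: open_Int)
          show "U \<inter> ball 0 1 \<subseteq> cball 0 1" by auto
          show "p \<in> U \<inter> ball 0 1" using U(2) p1 by simp
          show "inj_on g' (U \<inter> ball 0 1)" using U(3) by (rule inj_on_subset) simp
        qed (rule g'c)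
      qed
    }
  qed auto
  then have tfg': "tame_morphism (polygon n) \<Sigma>' (f \<circ> g')"
    using f.tame(2) tame_polygon by unfold_locales
  show thesis
  proof (rule that[OF g'.tame_morphism_axioms tfg'])
    fix i j assume ij: "i \<in> {1..n}" "j \<in> {1..n}"
    obtain d where d: "d \<in> g'.generic_curves" "chord n i j = reduced_class (polygon n) d"
      "class_image (polygon n) \<Sigma> g' (chord n i j) = reduced_class \<Sigma> (g' \<circ> d)"
      by (rule g'.reduced_class_generic[OF chord_in[OF ij] finite.emptyI empty_subsetI]) (rule that)
    note dc = g'.generic_curves_image[OF d(1)]
    have "(linepath (polygon_vertex n i) (polygon_vertex n j), d) \<in> reduced_equiv (polygon n)"
      using d(2) by (simp add: chord_def reduced_class_eq_iff)
    then have ends: "d 0 = polygon_vertex n i" "d 1 = polygon_vertex n j"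
      using reduced_equiv_ends by (fastforce simp: linepath_def)+
    have "d 0 \<in> V" "d 1 \<in> V" using ends ij by (auto simp: V_def)
    then have e_ends: "(e \<circ> d) 0 = d 0" "(e \<circ> d) 1 = d 1" using E(4) by auto
    have "pathin ?P (e \<circ> d)" using curvesD[OF dc(1)] ec by (intro pathin_compose) auto
    then have edc: "e \<circ> d \<in> curves (polygon n)" using \<open>d 0 \<in> V\<close> \<open>d 1 \<in> V\<close> e_ends by (auto simp: curves_def V_def)
    \<comment> \<open>The image of d under g' is the image of \<open>e \<circ> d\<close> under g, so
      both computations concern the same chord once d and \<open>e \<circ> d\<close> are known to be
      equivalent.\<close>
    have "(e \<circ> d, d) \<in> reduced_equiv (polygon n)"
      by (intro curve_homotopy_reduced polygon_curves_homotopic edc dc(1) e_ends)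
    then have "chord n i j = reduced_class (polygon n) (e \<circ> d)"
      using d(2) by (simp add: reduced_class_eq_iff reduced_equiv_sym)
    then have "class_image (polygon n) \<Sigma> g (chord n i j) = reduced_class \<Sigma> (g \<circ> (e \<circ> d))"
      using g.class_image_eq[OF edc] dc(2) by (simp add: g'_def comp_assoc)
    then show "chord_image n \<Sigma> g' i j = chord_image n \<Sigma> g i j"
      using d(3) by (simp add: chord_image_def g'_def comp_assoc)
  qed
qed

text \<open>All chords are tracked, not only the sides, because the quadrilateral relations contain
  the diagonals of a particular polygon map.\<close>

lemma polygon_via_image:
  assumes f: "tame_morphism \<Sigma> \<Sigma>' f" and g: "polygon_via \<Sigma> g \<gamma>s" and n: "1 \<le> length \<gamma>s"
  obtains g' where "polygon_via \<Sigma>' g' (map (class_image \<Sigma> \<Sigma>' f) \<gamma>s)"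
    "\<And>i j. i \<in> {1..length \<gamma>s} \<Longrightarrow> j \<in> {1..length \<gamma>s} \<Longrightarrow>
       chord_image (length \<gamma>s) \<Sigma>' g' i j = class_image \<Sigma> \<Sigma>' f (chord_image (length \<gamma>s) \<Sigma> g i j)"
proof -
  interpret f: tame_morphism \<Sigma> \<Sigma>' f by fact
  define n where "n = length \<gamma>s"
  have gD: "set \<gamma>s \<subseteq> reduced_classes \<Sigma>" "surface_morphism (polygon n) \<Sigma> g"
    "\<And>i. i \<in> {1..n} \<Longrightarrow> chord_image n \<Sigma> g i (next_vertex n i) = \<gamma>s ! (i - 1)"
    using g by (auto simp: polygon_via_def Let_def n_def)
  have n1: "1 \<le> n" using n by (simp add: n_def)
  obtain g' where g': "tame_morphism (polygon n) \<Sigma> g'" "tame_morphism (polygon n) \<Sigma>' (f \<circ> g')"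
    "\<And>i j. i \<in> {1..n} \<Longrightarrow> j \<in> {1..n} \<Longrightarrow> chord_image n \<Sigma> g' i j = chord_image n \<Sigma> g i j"
    using polygon_push_in[OF f gD(2) n1] by blast
  have ci: "chord_image n \<Sigma>' (f \<circ> g') i j = class_image \<Sigma> \<Sigma>' f (chord_image n \<Sigma> g i j)"
    if ij: "i \<in> {1..n}" "j \<in> {1..n}" for i j
    unfolding chord_image_def class_image_comp[OF g'(1) f g'(2) chord_in[OF ij]]
    using g'(3)[OF ij] by (simp add: chord_image_def)
  have nv: "next_vertex n i \<in> {1..n}" if "i \<in> {1..n}" for i using that by (auto simp: next_vertex_def)
  have "polygon_via \<Sigma>' (f \<circ> g') (map (class_image \<Sigma> \<Sigma>' f) \<gamma>s)"
    unfolding polygon_via_def Let_def length_map n_def[symmetric]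
  proof (intro conjI ballI)
    show "set (map (class_image \<Sigma> \<Sigma>' f) \<gamma>s) \<subseteq> reduced_classes \<Sigma>'" using gD(1) f.class_image_in by auto
    show "surface_morphism (polygon n) \<Sigma>' (f \<circ> g')" using g'(2) by (rule tame_morphism.morphism)
    fix i assume i: "i \<in> {1..n}"
    then have "i - 1 < length \<gamma>s" by (auto simp: n_def)
    then show "chord_image n \<Sigma>' (f \<circ> g') i (next_vertex n i) = map (class_image \<Sigma> \<Sigma>' f) \<gamma>s ! (i - 1)"
      using ci[OF i nv[OF i]] gD(3)[OF i] by simp
  qed
  then show thesis using that ci unfolding n_def by blast
qed

section \<open>Presented groups\<close>

definition relabel :: "('g \<Rightarrow> 'h) \<Rightarrow> 'g letter free_word \<Rightarrow> 'h letter free_word" where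
  "relabel m = map_free_word (map_letter m)"

lemma relabel_Word [simp]: "relabel m (Word ls) = Word (map (map_letter m) ls)"
  by (simp add: relabel_def)

lemma relabel_zero [simp]: "relabel m 0 = 0"
  by (simp add: zero_free_word_def)

lemma relabel_add: "relabel m (u + v) = relabel m u + relabel m v"
  by (cases u; cases v) (simp add: plus_free_word_def)

lemma letters_zero [simp]: "letters 0 = []"
  by (simp add: zero_free_word_def)

lemma letters_add [simp]: "letters (u + v) = letters u @ letters v"
  by (simp add: plus_free_word_def)

lemma words_over_zero [simp]: "0 \<in> words_over G"
  by (simp add: words_over_def)

lemma words_over_add [simp]: "u + v \<in> words_over G \<longleftrightarrow> u \<in> words_over G \<and> v \<in> words_over G"
  by (auto simp: words_over_def)

lemma words_over_Word: "Word ls \<in> words_over G \<longleftrightarrow> set ls \<subseteq> Gen ` G \<union> Inv ` G"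
  by (simp add: words_over_def)

lemma relabel_words_over:
  assumes "m ` G \<subseteq> G'" "w \<in> words_over G"
  shows "relabel m w \<in> words_over G'"
proof (cases w)
  case (Word ls)
  have "map_letter m l \<in> Gen ` G' \<union> Inv ` G'" if "l \<in> Gen ` G \<union> Inv ` G" for l
    using that assms(1) by auto
  moreover have "set ls \<subseteq> Gen ` G \<union> Inv ` G" using assms(2) Word by (simp add: words_over_Word)
  ultimately have "map_letter m ` set ls \<subseteq> Gen ` G' \<union> Inv ` G'" by blast
  then show ?thesis using Word by (simp add: words_over_Word)
qed

lemma word_induct [consumes 1, case_names zero cons]:
  assumes "w \<in> words_over G" "P 0"
    and "\<And>l w. l \<in> Gen ` G \<union> Inv ` G \<Longrightarrow> w \<in> words_over G \<Longrightarrow> P w \<Longrightarrow> P (Word [l] + w)"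
  shows "P w"
proof -
  have "set ls \<subseteq> Gen ` G \<union> Inv ` G \<Longrightarrow> P (Word ls)" for ls
  proof (induction ls)
    case Nil
    then show ?case using assms(2) by (simp add: zero_free_word_def)
  next
    case (Cons l ls)
    then have "P (Word [l] + Word ls)" by (intro assms(3)) (auto simp: words_over_Word)
    then show ?case by (simp add: plus_free_word_def)
  qed
  then show ?thesis using assms(1) by (cases w) (auto simp: words_over_Word)
qed

lemma word_cong_words:
  assumes "R \<subseteq> words_over G \<times> words_over G" "word_cong G R u v"
  shows "u \<in> words_over G \<and> v \<in> words_over G"
  using assms(2) by induction (use assms(1) in \<open>auto simp: words_over_Word\<close>)

lemma word_class_eqI:
  assumes "word_cong G R u v"
  shows "word_class G R u = word_class G R v"
  using assms unfolding word_class_def by (blast intro: word_cong.sym word_cong.trans)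

lemma word_class_eq_iff:
  assumes "u \<in> words_over G" "v \<in> words_over G"
  shows "word_class G R u = word_class G R v \<longleftrightarrow> word_cong G R u v"
proof
  assume "word_class G R u = word_class G R v"
  then have "u \<in> word_class G R v" using word_cong.refl[OF assms(1), of R] by (simp add: word_class_def set_eq_iff)
  then show "word_cong G R u v" by (auto simp: word_class_def intro: word_cong.sym)
qed (rule word_class_eqI)

lemma presented_group_simps:
  "carrier (presented_group G R) = word_class G R ` words_over G"
  "\<one>\<^bsub>presented_group G R\<^esub> = word_class G R 0"
  by (simp_all add: presented_group_def)

lemma presented_group_mult:
  assumes "u \<in> words_over G" "v \<in> words_over G"
  shows "word_class G R u \<otimes>\<^bsub>presented_group G R\<^esub> word_class G R v = word_class G R (u + v)"
proof -
  have "word_class G R (a + b) = word_class G R (u + v)" if "a \<in> word_class G R u" "b \<in> word_class G R v" for a b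
  proof -
    have "word_cong G R (u + v) (a + b)" using that by (auto simp: word_class_def intro: word_cong.concat)
    then show ?thesis by (rule word_class_eqI[symmetric])
  qed
  moreover have "u \<in> word_class G R u" "v \<in> word_class G R v"
    using assms by (auto simp: word_class_def intro: word_cong.refl)
  ultimately have "(\<Union>a\<in>word_class G R u. \<Union>b\<in>word_class G R v. word_class G R (a + b)) = word_class G R (u + v)"
    by (intro UN_constant_eq ballI)
  then show ?thesis by (simp add: presented_group_def)
qed

lemma word_cong_inverse_letter:
  assumes "l \<in> Gen ` G \<union> Inv ` G"
  shows "\<exists>l'\<in>Gen ` G \<union> Inv ` G. word_cong G R (Word [l'] + Word [l]) 0"
  using assms word_cong.left_inverse[of _ G R] word_cong.right_inverse[of _ G R]
  by (fastforce simp: plus_free_word_def)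

lemma word_cong_left_inverse:
  assumes "w \<in> words_over G"
  shows "\<exists>w'\<in>words_over G. word_cong G R (w' + w) 0"
  using assms
proof (induction rule: word_induct)
  case zero
  have "word_cong G R (0 + 0) 0" using word_cong.refl[of 0 G R] by simp
  then show ?case using words_over_zero by blast
next
  case (cons l w)
  obtain w' where w': "w' \<in> words_over G" "word_cong G R (w' + w) 0" using cons.IH by blast
  obtain l' where l': "l' \<in> Gen ` G \<union> Inv ` G" "word_cong G R (Word [l'] + Word [l]) 0"
    using word_cong_inverse_letter[OF cons.hyps(1)] by blast
  have r: "word_cong G R w w" "word_cong G R w' w'" using cons.hyps(2) w'(1) by (auto intro: word_cong.refl)
  have "word_cong G R (w' + (Word [l'] + Word [l]) + w) (w' + 0 + w)"
    by (intro word_cong.concat r l')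
  then have "word_cong G R (w' + (Word [l'] + Word [l]) + w) 0"
    using w'(2) word_cong.trans by fastforce
  then have "word_cong G R ((w' + Word [l']) + (Word [l] + w)) 0"
    by (simp only: add.assoc)
  moreover have "w' + Word [l'] \<in> words_over G" using w'(1) l'(1) by (simp add: words_over_Word)
  ultimately show ?case by blast
qed

lemma group_presented_group: "group (presented_group G R)"
proof (rule groupI)
  show "\<one>\<^bsub>presented_group G R\<^esub> \<in> carrier (presented_group G R)"
    by (auto simp: presented_group_simps)
  fix x assume "x \<in> carrier (presented_group G R)"
  then obtain u where u: "u \<in> words_over G" "x = word_class G R u" by (auto simp: presented_group_simps)
  show "\<one>\<^bsub>presented_group G R\<^esub> \<otimes>\<^bsub>presented_group G R\<^esub> x = x"
    using u by (simp add: presented_group_simps presented_group_mult)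
  obtain u' where "u' \<in> words_over G" "word_cong G R (u' + u) 0" using word_cong_left_inverse[OF u(1)] by blast
  then show "\<exists>y\<in>carrier (presented_group G R). y \<otimes>\<^bsub>presented_group G R\<^esub> x = \<one>\<^bsub>presented_group G R\<^esub>"
    using u by (intro bexI[of _ "word_class G R u'"])
      (auto simp: presented_group_simps presented_group_mult word_class_eq_iff)
  fix y assume "y \<in> carrier (presented_group G R)"
  then obtain v where v: "v \<in> words_over G" "y = word_class G R v" by (auto simp: presented_group_simps)
  show "x \<otimes>\<^bsub>presented_group G R\<^esub> y \<in> carrier (presented_group G R)"
    using u v by (simp add: presented_group_simps presented_group_mult)
  fix z assume "z \<in> carrier (presented_group G R)"
  then obtain w where w: "w \<in> words_over G" "z = word_class G R w" by (auto simp: presented_group_simps)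
  show "x \<otimes>\<^bsub>presented_group G R\<^esub> y \<otimes>\<^bsub>presented_group G R\<^esub> z = x \<otimes>\<^bsub>presented_group G R\<^esub> (y \<otimes>\<^bsub>presented_group G R\<^esub> z)"
    using u v w by (simp add: presented_group_mult add.assoc)
qed

lemma word_cong_relabel:
  assumes m: "m ` G \<subseteq> G'" and R: "\<And>u v. (u, v) \<in> R \<Longrightarrow> (relabel m u, relabel m v) \<in> R'"
    and c: "word_cong G R u v"
  shows "word_cong G' R' (relabel m u) (relabel m v)"
  using c
proof induction
  case (refl w)
  then show ?case by (intro word_cong.refl relabel_words_over[OF m])
next
  case (concat u v u' v')
  then show ?case by (simp add: relabel_add word_cong.concat)
next
  case (right_inverse s)
  then have "m s \<in> G'" using m by blast
  then show ?case using word_cong.right_inverse by simp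
next
  case (left_inverse s)
  then have "m s \<in> G'" using m by blast
  then show ?case using word_cong.left_inverse by simp
qed (auto intro: word_cong.sym word_cong.trans word_cong.relation R)

text \<open>A union of sets that all coincide once relations go to relations, in the style of the
  product of \<open>presented_group\<close>; no representative has to be chosen.\<close>

definition group_relabel ::
    "('g \<Rightarrow> 'h) \<Rightarrow> 'h set \<Rightarrow> ('h letter free_word \<times> 'h letter free_word) set \<Rightarrow>
     'g letter free_word set \<Rightarrow> 'h letter free_word set" where
  "group_relabel m G' R' A = (\<Union>w\<in>A. word_class G' R' (relabel m w))"

lemma group_relabel_class:
  assumes m: "m ` G \<subseteq> G'" and R: "\<And>u v. (u, v) \<in> R \<Longrightarrow> (relabel m u, relabel m v) \<in> R'"
    and w: "w \<in> words_over G"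
  shows "group_relabel m G' R' (word_class G R w) = word_class G' R' (relabel m w)"
proof -
  have "word_class G' R' (relabel m v) = word_class G' R' (relabel m w)" 
    if "v \<in> word_class G R w" for v
  proof -
    have "word_cong G R v w" using that unfolding word_class_def by (blast intro: word_cong.sym)
    then have "word_cong G' R' (relabel m v) (relabel m w)" by (rule word_cong_relabel[OF m, rotated]) (rule R)
    then show ?thesis by (rule word_class_eqI)
  qed
  moreover have "w \<in> word_class G R w" using word_cong.refl[OF w] by (simp add: word_class_def)
  ultimately show ?thesis
    unfolding group_relabel_def by (intro UN_constant_eq ballI)
qed

lemma group_relabel_hom:
  assumes m: "m ` G \<subseteq> G'" and R: "\<And>u v. (u, v) \<in> R \<Longrightarrow> (relabel m u, relabel m v) \<in> R'"
  shows "group_relabel m G' R' \<in> hom (presented_group G R) (presented_group G' R')"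
proof (rule homI)
  note [simp] = group_relabel_class[OF m R]
  fix x assume "x \<in> carrier (presented_group G R)"
  then obtain u where u: "u \<in> words_over G" "x = word_class G R u" by (auto simp: presented_group_simps)
  show "group_relabel m G' R' x \<in> carrier (presented_group G' R')"
    using u relabel_words_over[OF m u(1)] by (simp add: presented_group_simps)
  fix y assume "y \<in> carrier (presented_group G R)"
  then obtain v where v: "v \<in> words_over G" "y = word_class G R v" by (auto simp: presented_group_simps)
  show "group_relabel m G' R' (x \<otimes>\<^bsub>presented_group G R\<^esub> y) =
      group_relabel m G' R' x \<otimes>\<^bsub>presented_group G' R'\<^esub> group_relabel m G' R' y"
    using u v relabel_words_over[OF m u(1)] relabel_words_over[OF m v(1)]
    by (simp add: presented_group_mult relabel_add)
qed

text \<open>In the presented group the letter \<open>Inv s\<close> is the inverse of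
  \<open>Gen s\<close>, so the values on generators force those on inverse letters and then on all
  words.\<close>

lemma presented_group_hom_unique:
  assumes H: "group H" and h: "h \<in> hom (presented_group G R) H" "h' \<in> hom (presented_group G R) H"
    and eq: "\<And>s. s \<in> G \<Longrightarrow> h (word_class G R (Word [Gen s])) = h' (word_class G R (Word [Gen s]))"
    and x: "x \<in> carrier (presented_group G R)"
  shows "h x = h' x"
proof -
  let ?P = "presented_group G R"
  interpret h: group_hom ?P H h using h(1) H group_presented_group by (intro group_hom.intro group_hom_axioms.intro)
  interpret h': group_hom ?P H h' using h(2) H group_presented_group by (intro group_hom.intro group_hom_axioms.intro)
  have letter: "h (word_class G R (Word [l])) = h' (word_class G R (Word [l]))" if l: "l \<in> Gen ` G \<union> Inv ` G" for l
  proof (cases l)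
    case (Gen s)
    then show ?thesis using l eq by auto
  next
    case (Inv s)
    then have s: "s \<in> G" using l by auto
    have w: "Word [Gen s] \<in> words_over G" "Word [Inv s] \<in> words_over G" using s by (auto simp: words_over_Word)
    have "word_cong G R (Word [Inv s] + Word [Gen s]) 0"
      using word_cong.left_inverse[OF s, of R] by (simp add: plus_free_word_def)
    then have "word_class G R (Word [Inv s]) \<otimes>\<^bsub>?P\<^esub> word_class G R (Word [Gen s]) = \<one>\<^bsub>?P\<^esub>"
      using w by (simp add: presented_group_mult presented_group_simps word_class_eq_iff)
    then have "word_class G R (Word [Inv s]) = inv\<^bsub>?P\<^esub> (word_class G R (Word [Gen s]))"
      using group.inv_equality[OF group_presented_group] w by (metis imageI presented_group_simps(1))
    then show ?thesis
      using Inv eq[OF s] w h.hom_inv[of "word_class G R (Word [Gen s])"] h'.hom_inv[of "word_class G R (Word [Gen s])"]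
      by (simp add: presented_group_simps)
  qed
  obtain w where w: "w \<in> words_over G" "x = word_class G R w" using x by (auto simp: presented_group_simps)
  have "h (word_class G R w) = h' (word_class G R w)"
    using w(1)
  proof (induction rule: word_induct)
    case zero
    then show ?case using h.hom_one h'.hom_one by (simp add: presented_group_simps)
  next
    case (cons l w)
    have lw: "Word [l] \<in> words_over G" using cons.hyps(1) by (simp add: words_over_Word)
    then have "word_class G R (Word [l] + w) = word_class G R (Word [l]) \<otimes>\<^bsub>?P\<^esub> word_class G R w"
      using cons.hyps(2) by (simp add: presented_group_mult)
    moreover have "word_class G R (Word [l]) \<in> carrier ?P" "word_class G R w \<in> carrier ?P"
      using lw cons.hyps(2) by (auto simp: presented_group_simps)
    ultimately show ?case using letter[OF cons.hyps(1)] cons.IH by simp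
  qed
  then show ?thesis using w(2) by simp
qed

section \<open>Presented algebras\<close>

text \<open>Relabelling may identify words, whose coefficients then have to be added; hence a sum of
  monomials instead of a mere change of keys.\<close>

definition poly_relabel :: "('g \<Rightarrow> 'h) \<Rightarrow> 'g free_poly \<Rightarrow> 'h free_poly" where
  "poly_relabel m p = (\<Sum>w\<in>Poly_Mapping.keys p. Poly_Mapping.single (relabel m w) (Poly_Mapping.lookup p w))"

text \<open>Gives p, q and p + q a common index set for the sum, although terms of p + q may
  cancel.\<close>

lemma poly_relabel_superset:
  assumes "finite S" "Poly_Mapping.keys p \<subseteq> S"
  shows "poly_relabel m p = (\<Sum>w\<in>S. Poly_Mapping.single (relabel m w) (Poly_Mapping.lookup p w))"
  unfolding poly_relabel_def using assms by (intro sum.mono_neutral_left) (auto simp: in_keys_iff)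

lemma poly_relabel_add: "poly_relabel m (p + q) = poly_relabel m p + poly_relabel m q"
proof -
  let ?S = "Poly_Mapping.keys p \<union> Poly_Mapping.keys q"
  have S: "finite ?S" "Poly_Mapping.keys (p + q) \<subseteq> ?S" using Poly_Mapping.keys_add[of p q] by simp_all
  show ?thesis
    using S poly_relabel_superset[of ?S "p + q" m] poly_relabel_superset[of ?S p m] poly_relabel_superset[of ?S q m]
    by (simp add: lookup_add single_add sum.distrib)
qed

lemma poly_relabel_single [simp]: "poly_relabel m (Poly_Mapping.single w c) = Poly_Mapping.single (relabel m w) c"
  by (simp add: poly_relabel_def)

lemma poly_relabel_zero [simp]: "poly_relabel m 0 = 0"
  by (simp add: poly_relabel_def)

lemma poly_relabel_sum: "poly_relabel m (sum g A) = (\<Sum>a\<in>A. poly_relabel m (g a))"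
  by (induction A rule: infinite_finite_induct) (simp_all add: poly_relabel_add)

lemma poly_relabel_diff: "poly_relabel m (p - q) = poly_relabel m p - poly_relabel m q"
  using poly_relabel_add[of m "p - q" q] by simp

lemma free_poly_expand: "p = (\<Sum>w\<in>Poly_Mapping.keys p. Poly_Mapping.single w (Poly_Mapping.lookup p w))"
  by (rule poly_mapping_eqI) (simp add: lookup_sum lookup_single when_def in_keys_iff)

lemma poly_relabel_mult: "poly_relabel m (p * q) = poly_relabel m p * poly_relabel m q"
proof -
  let ?s = "\<lambda>p w. Poly_Mapping.single w (Poly_Mapping.lookup p w)"
  have "p * q = (\<Sum>a\<in>Poly_Mapping.keys p. ?s p a) * (\<Sum>b\<in>Poly_Mapping.keys q. ?s q b)"
    by (simp flip: free_poly_expand)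
  also have "\<dots> = (\<Sum>a\<in>Poly_Mapping.keys p. \<Sum>b\<in>Poly_Mapping.keys q. ?s p a * ?s q b)"
    by (rule sum_product)
  finally have "poly_relabel m (p * q) =
      (\<Sum>a\<in>Poly_Mapping.keys p. \<Sum>b\<in>Poly_Mapping.keys q. poly_relabel m (?s p a * ?s q b))"
    by (simp add: poly_relabel_sum)
  also have "\<dots> = poly_relabel m p * poly_relabel m q"
    unfolding poly_relabel_def[of m p] poly_relabel_def[of m q] sum_product
    by (simp add: mult_single relabel_add)
  finally show ?thesis .
qed

lemma poly_relabel_one [simp]: "poly_relabel m 1 = 1"
  using poly_relabel_single[of m 0 1] by (simp add: single_one)

lemma poly_relabel_monomial [simp]: "poly_relabel m (monomial ls) = monomial (map (map_letter m) ls)"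
  by (simp add: monomial_def)

lemma free_algebra_simps [simp]:
  "carrier (free_algebra G) = {p. Poly_Mapping.keys p \<subseteq> words_over G}"
  "x \<otimes>\<^bsub>free_algebra G\<^esub> y = x * y" "\<one>\<^bsub>free_algebra G\<^esub> = 1" "\<zero>\<^bsub>free_algebra G\<^esub> = 0"
  "x \<oplus>\<^bsub>free_algebra G\<^esub> y = x + y" "q \<odot>\<^bsub>free_algebra G\<^esub> x = Poly_Mapping.single 0 q * x"
  by (simp_all add: free_algebra_def)

lemma keys_words_add: "Poly_Mapping.keys p \<subseteq> W \<Longrightarrow> Poly_Mapping.keys q \<subseteq> W \<Longrightarrow> Poly_Mapping.keys (p + q) \<subseteq> W"
  using Poly_Mapping.keys_add[of p q] by blast

lemma keys_words_mult:
  assumes "Poly_Mapping.keys p \<subseteq> words_over G" "Poly_Mapping.keys q \<subseteq> words_over G"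
  shows "Poly_Mapping.keys (p * q) \<subseteq> words_over G"
  using Poly_Mapping.keys_mult[of p q] assms by fastforce

lemma keys_words_uminus:
  fixes p :: "'g free_poly"
  shows "Poly_Mapping.keys (- p) = Poly_Mapping.keys p"
  by (auto simp: in_keys_iff)

lemma keys_words_one: "Poly_Mapping.keys (1 :: 'g free_poly) \<subseteq> words_over G"
  by simp

lemma keys_words_diff:
  fixes p q :: "'g free_poly"
  shows "Poly_Mapping.keys p \<subseteq> W \<Longrightarrow> Poly_Mapping.keys q \<subseteq> W \<Longrightarrow> Poly_Mapping.keys (p - q) \<subseteq> W"
  using keys_words_add[of p W "- q"] keys_words_uminus[of q] by simp

lemma keys_words_single: "w \<in> words_over G \<Longrightarrow> Poly_Mapping.keys (Poly_Mapping.single w c) \<subseteq> words_over G"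
  by (cases "c = 0") auto

lemma keys_words_monomial: "set ls \<subseteq> Gen ` G \<union> Inv ` G \<Longrightarrow> Poly_Mapping.keys (monomial ls) \<subseteq> words_over G"
  unfolding monomial_def by (rule keys_words_single) (simp add: words_over_Word)

lemma ring_free_algebra: "ring (free_algebra G)"
proof (rule ringI)
  show "abelian_group (free_algebra G)"
  proof (rule abelian_groupI)
    fix x assume "x \<in> carrier (free_algebra G)"
    then show "\<exists>y\<in>carrier (free_algebra G). y \<oplus>\<^bsub>free_algebra G\<^esub> x = \<zero>\<^bsub>free_algebra G\<^esub>"
      by (intro bexI[of _ "- x"]) (auto simp: keys_words_uminus)
  qed (auto simp: ac_simps intro: keys_words_add[THEN subsetD])
  show "Group.monoid (free_algebra G)"
    by (rule monoidI) (auto simp: mult.assoc intro: keys_words_mult[THEN subsetD])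
qed (auto simp: algebra_simps)

definition ideal_generators :: "'g set \<Rightarrow> 'g free_poly set \<Rightarrow> 'g free_poly set" where
  "ideal_generators G R =
     {monomial [Gen s, Inv s] - 1 | s. s \<in> G} \<union> {monomial [Inv s, Gen s] - 1 | s. s \<in> G} \<union> R"

lemma ideal_generators_carrier:
  assumes "R \<subseteq> carrier (free_algebra G)"
  shows "ideal_generators G R \<subseteq> carrier (free_algebra G)"
proof -
  have "monomial [Gen s, Inv s] - 1 \<in> carrier (free_algebra G)"
    "monomial [Inv s, Gen s] - 1 \<in> carrier (free_algebra G)" if "s \<in> G" for s
    using that keys_words_one
    unfolding free_algebra_simps mem_Collect_eq by (intro keys_words_diff keys_words_monomial; simp)+
  then show ?thesis using assms unfolding ideal_generators_def by blast
qed

text \<open>\<open>genideal\<close> is known to be an ideal containing its generators when these lie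
  in the carrier; this is what the assumption provides.\<close>

locale algebra_presentation =
  fixes G :: "'g set" and R :: "'g free_poly set"
  assumes R: "R \<subseteq> carrier (free_algebra G)"
begin

abbreviation F where "F \<equiv> free_algebra G"
abbreviation J where "J \<equiv> presented_ideal G R"
abbreviation A where "A \<equiv> presented_algebra G R"
abbreviation cls where "cls \<equiv> poly_class G R"

sublocale F: ring F by (rule ring_free_algebra)

lemma presented_ideal_eq: "J = genideal F (ideal_generators G R)"
  by (simp add: presented_ideal_def ideal_generators_def)

sublocale J: ideal J F
  unfolding presented_ideal_eq by (rule F.genideal_ideal[OF ideal_generators_carrier[OF R]])

lemma generators_in_J: "ideal_generators G R \<subseteq> J"
  unfolding presented_ideal_eq by (rule F.genideal_self[OF ideal_generators_carrier[OF R]])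

lemma J_minimal: "ideal I F \<Longrightarrow> ideal_generators G R \<subseteq> I \<Longrightarrow> J \<subseteq> I"
  unfolding presented_ideal_eq by (rule F.genideal_minimal)

lemma J_add: "p \<in> J \<Longrightarrow> q \<in> J \<Longrightarrow> p + q \<in> J"
  using J.a_closed[of p q] by simp

lemma J_zero: "0 \<in> J"
  using J.zero_closed by simp

lemma J_left: "p \<in> J \<Longrightarrow> x \<in> carrier F \<Longrightarrow> x * p \<in> J"
  using J.I_l_closed[of p x] by simp

lemma J_right: "p \<in> J \<Longrightarrow> x \<in> carrier F \<Longrightarrow> p * x \<in> J"
  using J.I_r_closed[of p x] by simp

lemma J_uminus: "p \<in> J \<Longrightarrow> - p \<in> J"
  using J_left[of p "- 1"] by (simp add: keys_words_uminus)

lemma J_diff: "p \<in> J \<Longrightarrow> q \<in> J \<Longrightarrow> p - q \<in> J"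
  using J_add[of p "- q"] J_uminus[of q] by simp

lemma cls_eq: "cls p = (\<lambda>j. j + p) ` J"
  by (auto simp: poly_class_def a_r_coset_def')

lemma cls_self: "p \<in> cls p"
  using J_zero by (force simp: cls_eq)

lemma in_cls_iff: "q \<in> cls p \<longleftrightarrow> q - p \<in> J"
  unfolding cls_eq by (auto intro: image_eqI[of _ _ "q - p"])

lemma cls_eq_iff: "cls p = cls q \<longleftrightarrow> p - q \<in> J"
proof
  assume "cls p = cls q"
  then show "p - q \<in> J" using cls_self[of p] in_cls_iff by blast
next
  assume pq: "p - q \<in> J"
  have "x - p \<in> J \<longleftrightarrow> x - q \<in> J" for x
    using J_add[OF _ pq, of "x - p"] J_diff[OF _ pq, of "x - q"] by auto
  then show "cls p = cls q" by (auto simp: in_cls_iff)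
qed

lemma A_carrier: "carrier A = cls ` carrier F"
  by (auto simp: presented_algebra_def ring.extend_def module.fields_def FactRing_def A_RCOSETS_def'
      poly_class_def image_iff)

lemma A_one: "\<one>\<^bsub>A\<^esub> = cls 1"
  by (simp add: presented_algebra_def ring.extend_def module.fields_def FactRing_def poly_class_def)

lemma A_mult: "p \<in> carrier F \<Longrightarrow> q \<in> carrier F \<Longrightarrow> cls p \<otimes>\<^bsub>A\<^esub> cls q = cls (p * q)"
  using J.rcoset_mult_add[of p q]
  by (simp add: presented_algebra_def ring.extend_def module.fields_def FactRing_def poly_class_def)

lemma A_add: "p \<in> carrier F \<Longrightarrow> q \<in> carrier F \<Longrightarrow> cls p \<oplus>\<^bsub>A\<^esub> cls q = cls (p + q)"
  using J.a_rcos_sum[of p q]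
  by (simp add: presented_algebra_def ring.extend_def module.fields_def FactRing_def poly_class_def)

lemma scalar_carrier: "Poly_Mapping.single 0 c \<in> carrier F"
  unfolding free_algebra_simps mem_Collect_eq by (rule keys_words_single) simp

lemma A_smult: "p \<in> carrier F \<Longrightarrow> c \<odot>\<^bsub>A\<^esub> cls p = cls (Poly_Mapping.single 0 c * p)"
proof -
  assume p: "p \<in> carrier F"
  have "cls (Poly_Mapping.single 0 c * q) = cls (Poly_Mapping.single 0 c * p)" if "q \<in> cls p" for q
  proof -
    have "Poly_Mapping.single 0 c * (q - p) \<in> J"
      using that scalar_carrier by (intro J_left) (simp add: in_cls_iff)
    then show ?thesis by (simp add: cls_eq_iff right_diff_distrib)
  qed
  then have "(\<Union>q\<in>cls p. cls (Poly_Mapping.single 0 c * q)) = cls (Poly_Mapping.single 0 c * p)"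
    using cls_self[of p] by blast
  then show ?thesis
    by (simp add: presented_algebra_def ring.extend_def module.fields_def)
qed

lemma monomial_carrier: "w \<in> words_over G \<Longrightarrow> Poly_Mapping.single w c \<in> carrier F"
  unfolding free_algebra_simps mem_Collect_eq by (rule keys_words_single)

lemma inverse_classes:
  assumes "s \<in> G"
  shows "cls (monomial [Gen s]) \<otimes>\<^bsub>A\<^esub> cls (monomial [Inv s]) = \<one>\<^bsub>A\<^esub>"
    "cls (monomial [Inv s]) \<otimes>\<^bsub>A\<^esub> cls (monomial [Gen s]) = \<one>\<^bsub>A\<^esub>"
proof -
  have c: "monomial [Gen s] \<in> carrier F" "monomial [Inv s] \<in> carrier F"
    using assms unfolding monomial_def by (auto intro!: monomial_carrier simp: words_over_Word simp del: free_algebra_simps)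
  have m: "monomial [l] * monomial [l'] = monomial [l, l']" for l l' :: "'g letter"
    by (simp add: monomial_def mult_single plus_free_word_def)
  have "monomial [Gen s, Inv s] - 1 \<in> J" "monomial [Inv s, Gen s] - 1 \<in> J"
    using assms generators_in_J unfolding ideal_generators_def by blast+
  then show "cls (monomial [Gen s]) \<otimes>\<^bsub>A\<^esub> cls (monomial [Inv s]) = \<one>\<^bsub>A\<^esub>"
    "cls (monomial [Inv s]) \<otimes>\<^bsub>A\<^esub> cls (monomial [Gen s]) = \<one>\<^bsub>A\<^esub>"
    using c by (simp_all add: A_mult A_one m cls_eq_iff del: free_algebra_simps)
qed

end

definition algebra_relabel ::
    "('g \<Rightarrow> 'h) \<Rightarrow> 'h set \<Rightarrow> 'h free_poly set \<Rightarrow> 'g free_poly set \<Rightarrow> 'h free_poly set" where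
  "algebra_relabel m G' R' P = (\<Union>p\<in>P. poly_class G' R' (poly_relabel m p))"

locale algebra_presentation_map =
  S: algebra_presentation G R + T: algebra_presentation G' R'
  for G :: "'g set" and R :: "'g free_poly set" and G' :: "'h set" and R' :: "'h free_poly set" +
  fixes m :: "'g \<Rightarrow> 'h"
  assumes m: "m ` G \<subseteq> G'" and relations: "poly_relabel m ` R \<subseteq> R'"
begin

lemma poly_relabel_carrier:
  assumes "p \<in> carrier S.F"
  shows "poly_relabel m p \<in> carrier T.F"
proof -
  have "Poly_Mapping.keys (Poly_Mapping.single (relabel m w) c) \<subseteq> words_over G'" if "w \<in> Poly_Mapping.keys p" for w c
    using that assms by (intro keys_words_single relabel_words_over[OF m]) auto
  then show ?thesis
    unfolding free_algebra_simps mem_Collect_eq poly_relabel_def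
    by (intro order_trans[OF Poly_Mapping.keys_sum]) blast
qed

lemma poly_relabel_ring_hom: "poly_relabel m \<in> ring_hom S.F T.F"
  using poly_relabel_carrier by (intro ring_hom_memI) (simp_all add: poly_relabel_mult poly_relabel_add)

text \<open>The preimage of the target ideal under a ring homomorphism is an ideal. It contains the
  generators of the source ideal, hence all of it.\<close>

lemma poly_relabel_J:
  assumes "p \<in> S.J"
  shows "poly_relabel m p \<in> T.J"
proof -
  interpret h: ring_hom_ring S.F T.F "poly_relabel m"
    by (rule ring_hom_ringI2[OF ring_free_algebra ring_free_algebra poly_relabel_ring_hom])
  have gen: "poly_relabel m p \<in> ideal_generators G' R'" if p: "p \<in> ideal_generators G R" for p
  proof -
    consider s where "s \<in> G" "p = monomial [Gen s, Inv s] - 1" | s where "s \<in> G" "p = monomial [Inv s, Gen s] - 1" | "p \<in> R"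
      using p unfolding ideal_generators_def by blast
    then show ?thesis
    proof cases
      case 1
      then have "m s \<in> G'" "poly_relabel m p = monomial [Gen (m s), Inv (m s)] - 1"
        using m by (auto simp: poly_relabel_diff)
      then show ?thesis unfolding ideal_generators_def by blast
    next
      case 2
      then have "m s \<in> G'" "poly_relabel m p = monomial [Inv (m s), Gen (m s)] - 1"
        using m by (auto simp: poly_relabel_diff)
      then show ?thesis unfolding ideal_generators_def by blast
    next
      case 3
      then show ?thesis using relations unfolding ideal_generators_def by blast
    qed
  qed
  have "S.J \<subseteq> {r \<in> carrier S.F. poly_relabel m r \<in> T.J}"
  proof (rule S.J_minimal)
    show "ideal {r \<in> carrier S.F. poly_relabel m r \<in> T.J} S.F"
      by (rule h.ideal_vimage[OF T.J.is_ideal])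
    show "ideal_generators G R \<subseteq> {r \<in> carrier S.F. poly_relabel m r \<in> T.J}"
      using gen T.generators_in_J ideal_generators_carrier[OF S.R] by blast
  qed
  then show ?thesis using assms by blast
qed

lemma algebra_relabel_class: "algebra_relabel m G' R' (S.cls p) = T.cls (poly_relabel m p)"
proof -
  have "T.cls (poly_relabel m q) = T.cls (poly_relabel m p)" if "q \<in> S.cls p" for q
    using poly_relabel_J[of "q - p"] that by (simp add: S.in_cls_iff T.cls_eq_iff poly_relabel_diff)
  then show ?thesis
    unfolding algebra_relabel_def using S.cls_self[of p] by blast
qed

lemma algebra_relabel_hom: "algebra_relabel m G' R' \<in> algebra_hom S.A T.A"
proof -
  let ?h = "algebra_relabel m G' R'"
  have "?h \<in> ring_hom S.A T.A"
  proof (rule ring_hom_memI)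
    show "?h \<one>\<^bsub>S.A\<^esub> = \<one>\<^bsub>T.A\<^esub>" by (simp add: S.A_one T.A_one algebra_relabel_class)
    fix x assume "x \<in> carrier S.A"
    then obtain p where p: "p \<in> carrier S.F" "x = S.cls p" unfolding S.A_carrier by blast
    show "?h x \<in> carrier T.A"
      unfolding p(2) algebra_relabel_class T.A_carrier using poly_relabel_carrier[OF p(1)] by blast
    fix y assume "y \<in> carrier S.A"
    then obtain q where q: "q \<in> carrier S.F" "y = S.cls q" unfolding S.A_carrier by blast
    show "?h (x \<otimes>\<^bsub>S.A\<^esub> y) = ?h x \<otimes>\<^bsub>T.A\<^esub> ?h y"
      unfolding p(2) q(2) S.A_mult[OF p(1) q(1)] algebra_relabel_class
        T.A_mult[OF poly_relabel_carrier[OF p(1)] poly_relabel_carrier[OF q(1)]] poly_relabel_mult by simp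
    show "?h (x \<oplus>\<^bsub>S.A\<^esub> y) = ?h x \<oplus>\<^bsub>T.A\<^esub> ?h y"
      unfolding p(2) q(2) S.A_add[OF p(1) q(1)] algebra_relabel_class
        T.A_add[OF poly_relabel_carrier[OF p(1)] poly_relabel_carrier[OF q(1)]] poly_relabel_add by simp
  qed
  moreover have "?h (c \<odot>\<^bsub>S.A\<^esub> x) = c \<odot>\<^bsub>T.A\<^esub> ?h x" if x: "x \<in> carrier S.A" for c x
  proof -
    obtain p where p: "p \<in> carrier S.F" "x = S.cls p" using x unfolding S.A_carrier by blast
    show ?thesis
      unfolding p(2) S.A_smult[OF p(1)] algebra_relabel_class T.A_smult[OF poly_relabel_carrier[OF p(1)]]
      by (simp add: poly_relabel_mult)
  qed
  ultimately show ?thesis by (simp add: algebra_hom_def)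
qed

text \<open>Agreement on generators extends to inverse letters because two-sided inverses are
  unique, and from there to words, to scalar multiples of words and to sums.\<close>

lemma algebra_hom_unique:
  assumes h: "h \<in> algebra_hom S.A T.A" "h' \<in> algebra_hom S.A T.A"
    and eq: "\<And>s. s \<in> G \<Longrightarrow> h (S.cls (monomial [Gen s])) = h' (S.cls (monomial [Gen s]))"
    and x: "x \<in> carrier S.A"
  shows "h x = h' x"
proof -
  have hom: "k \<in> ring_hom S.A T.A" "\<And>c x. x \<in> carrier S.A \<Longrightarrow> k (c \<odot>\<^bsub>S.A\<^esub> x) = c \<odot>\<^bsub>T.A\<^esub> k x"
    if "k \<in> {h, h'}" for k using that h by (auto simp: algebra_hom_def)
  have car: "S.cls p \<in> carrier S.A" if "p \<in> carrier S.F" for p using that unfolding S.A_carrier by blast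
  have mul: "k (S.cls (p * q)) = k (S.cls p) \<otimes>\<^bsub>T.A\<^esub> k (S.cls q)"
    if "k \<in> {h, h'}" "p \<in> carrier S.F" "q \<in> carrier S.F" for k p q
    using ring_hom_mult[OF hom(1)[OF that(1)] car[OF that(2)] car[OF that(3)]] S.A_mult[OF that(2,3)] by simp
  have one: "k (S.cls 1) = \<one>\<^bsub>T.A\<^esub>" if "k \<in> {h, h'}" for k
    using ring_hom_one[OF hom(1)[OF that]] by (simp add: S.A_one)
  have kcar: "\<exists>q\<in>carrier T.F. k (S.cls p) = T.cls q" if "k \<in> {h, h'}" "p \<in> carrier S.F" for k p
    using ring_hom_closed[OF hom(1)[OF that(1)] car[OF that(2)]] unfolding T.A_carrier by blast
  have mono: "monomial [l] \<in> carrier S.F" if "l \<in> Gen ` G \<union> Inv ` G" for l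
    unfolding monomial_def using that by (intro S.monomial_carrier) (simp add: words_over_Word)
  have letter: "h (S.cls (monomial [l])) = h' (S.cls (monomial [l]))" if l: "l \<in> Gen ` G \<union> Inv ` G" for l
  proof (cases l)
    case (Gen s)
    then show ?thesis using l eq by auto
  next
    case (Inv s)
    then have s: "s \<in> G" using l by auto
    have m: "monomial [Gen s] \<in> carrier S.F" "monomial [Inv s] \<in> carrier S.F" using s mono by blast+
    have inv: "k (S.cls (monomial [Gen s])) \<otimes>\<^bsub>T.A\<^esub> k (S.cls (monomial [Inv s])) = \<one>\<^bsub>T.A\<^esub>"
      "k (S.cls (monomial [Inv s])) \<otimes>\<^bsub>T.A\<^esub> k (S.cls (monomial [Gen s])) = \<one>\<^bsub>T.A\<^esub>" if k: "k \<in> {h, h'}" for k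
      using mul[OF k m(1,2)] mul[OF k m(2,1)] one[OF k] S.inverse_classes[OF s] S.A_mult[OF m(1,2)] S.A_mult[OF m(2,1)]
      by (simp_all add: S.A_one)
    \<comment> \<open>c represents the common image of \<open>Gen s\<close>, and a and b represent
      the two candidates for its inverse. Bracketing a * c * b in both ways shows that they agree
      modulo the ideal.\<close>
    obtain a b c where abc: "a \<in> carrier T.F" "b \<in> carrier T.F" "c \<in> carrier T.F"
      "h (S.cls (monomial [Inv s])) = T.cls a" "h' (S.cls (monomial [Inv s])) = T.cls b"
      "h (S.cls (monomial [Gen s])) = T.cls c" "h' (S.cls (monomial [Gen s])) = T.cls c"
      using kcar[of h, OF _ m(2)] kcar[of h', OF _ m(2)] kcar[of h, OF _ m(1)] eq[OF s] by auto
    have 1: "T.cls (c * b) = T.cls 1" "T.cls (a * c) = T.cls 1"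
      using inv(1)[of h'] inv(2)[of h] abc by (auto simp: T.A_mult T.A_one simp del: free_algebra_simps)
    have one_c: "1 \<in> carrier T.F" by simp
    have mc: "a * c \<in> carrier T.F" "c * b \<in> carrier T.F" using abc(1-3) by (simp_all add: keys_words_mult)
    have "T.cls a = T.cls a \<otimes>\<^bsub>T.A\<^esub> T.cls 1" using T.A_mult[OF abc(1) one_c] by simp
    also have "\<dots> = T.cls (a * (c * b))" using T.A_mult[OF abc(1) mc(2)] 1 by simp
    also have "\<dots> = T.cls ((a * c) * b)" by (simp add: mult.assoc)
    also have "\<dots> = T.cls 1 \<otimes>\<^bsub>T.A\<^esub> T.cls b" using T.A_mult[OF mc(1) abc(2)] 1 by simp
    also have "\<dots> = T.cls b" using T.A_mult[OF one_c abc(2)] by simp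
    finally show ?thesis using abc Inv by simp
  qed
  have word: "h (S.cls (Poly_Mapping.single w 1)) = h' (S.cls (Poly_Mapping.single w 1))" if "w \<in> words_over G" for w
    using that
  proof (induction rule: word_induct)
    case zero
    then show ?case using one[of h] one[of h'] by (simp add: single_one)
  next
    case (cons l w)
    have "Poly_Mapping.single (Word [l] + w) 1 = monomial [l] * Poly_Mapping.single w (1::rat)"
      by (simp add: monomial_def mult_single)
    then show ?case
      using mul[of h, OF _ mono[OF cons.hyps(1)] S.monomial_carrier[OF cons.hyps(2)], of 1]
        mul[of h', OF _ mono[OF cons.hyps(1)] S.monomial_carrier[OF cons.hyps(2)], of 1] letter[OF cons.hyps(1)] cons.IH
      by simp
  qed
  have scaled: "h (S.cls (Poly_Mapping.single w c)) = h' (S.cls (Poly_Mapping.single w c))" if "w \<in> words_over G" for w c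
  proof -
    have "Poly_Mapping.single w c = Poly_Mapping.single 0 c * Poly_Mapping.single w (1::rat)"
      by (simp add: mult_single)
    then have "S.cls (Poly_Mapping.single w c) = c \<odot>\<^bsub>S.A\<^esub> S.cls (Poly_Mapping.single w 1)"
      using S.A_smult[OF S.monomial_carrier[OF that]] by simp
    then show ?thesis
      using hom(2)[OF _ car[OF S.monomial_carrier[OF that]], of h c] hom(2)[OF _ car[OF S.monomial_carrier[OF that]], of h' c] word[OF that]
      by simp
  qed
  obtain p where p: "p \<in> carrier S.F" "x = S.cls p" using x unfolding S.A_carrier by blast
  have "(\<Sum>w\<in>W. Poly_Mapping.single w (Poly_Mapping.lookup p w)) \<in> carrier S.F \<and>
      h (S.cls (\<Sum>w\<in>W. Poly_Mapping.single w (Poly_Mapping.lookup p w))) =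
      h' (S.cls (\<Sum>w\<in>W. Poly_Mapping.single w (Poly_Mapping.lookup p w)))"
    if "finite W" "W \<subseteq> words_over G" for W
    using that
  proof (induction W)
    case empty
    then show ?case using scaled[of 0 0] by simp
  next
    case (insert w W)
    let ?s = "Poly_Mapping.single w (Poly_Mapping.lookup p w)" and ?t = "\<Sum>w\<in>W. Poly_Mapping.single w (Poly_Mapping.lookup p w)"
    have w: "w \<in> words_over G" and t: "?t \<in> carrier S.F" "h (S.cls ?t) = h' (S.cls ?t)" using insert by auto
    have s: "?s \<in> carrier S.F" using S.monomial_carrier[OF w] .
    have add: "k (S.cls (?s + ?t)) = k (S.cls ?s) \<oplus>\<^bsub>T.A\<^esub> k (S.cls ?t)" if "k \<in> {h, h'}" for k
      using ring_hom_add[OF hom(1)[OF that] car[OF s] car[OF t(1)]] S.A_add[OF s t(1)] by simp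
    have "?s + ?t \<in> carrier S.F" using s t(1) by (simp add: keys_words_add)
    then show ?case using add[of h] add[of h'] scaled[OF w] t(2) insert.hyps by simp
  qed
  from this[of "Poly_Mapping.keys p"] show ?thesis
    using p by (simp flip: free_poly_expand)
qed

end

text \<open>Each rule of the congruence is matched by a closure property of the ideal. This is what
  makes \<open>canonical_map\<close> independent of the word chosen in a class.\<close>

lemma word_cong_ideal:
  assumes "algebra_presentation G RA" and RT: "RT \<subseteq> words_over G \<times> words_over G"
    and rel: "\<And>u v. (u, v) \<in> RT \<Longrightarrow> Poly_Mapping.single u 1 - Poly_Mapping.single v 1 \<in> RA"
    and c: "word_cong G RT u v"
  shows "Poly_Mapping.single u 1 - Poly_Mapping.single v 1 \<in> presented_ideal G RA"
proof -
  interpret algebra_presentation G RA by fact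
  have gen: "Poly_Mapping.single (Word [Gen s, Inv s]) 1 - Poly_Mapping.single 0 1 \<in> J"
    "Poly_Mapping.single (Word [Inv s, Gen s]) 1 - Poly_Mapping.single 0 1 \<in> J" if "s \<in> G" for s
    using that generators_in_J unfolding ideal_generators_def monomial_def single_one by blast+
  show ?thesis
    using c
  proof induction
    case (refl w)
    then show ?case using J_zero by simp
  next
    case (sym u v)
    then show ?case using J_uminus by fastforce
  next
    case (trans u v w)
    then show ?case using J_add by fastforce
  next
    case (concat u v u' v')
    have w: "u \<in> words_over G" "v' \<in> words_over G"
      using word_cong_words[OF RT] concat.hyps by blast+
    let ?s = "\<lambda>w. Poly_Mapping.single w (1::rat)"
    \<comment> \<open>Uses u u' - v v' = u (u' - v') + (u - v) v', so a left and a right multiple of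
      ideal elements are needed.\<close>
    have "?s u * (?s u' - ?s v') \<in> J" "(?s u - ?s v) * ?s v' \<in> J"
      by (rule J_left[OF concat.IH(2) monomial_carrier[OF w(1)]], rule J_right[OF concat.IH(1) monomial_carrier[OF w(2)]])
    then have "?s u * (?s u' - ?s v') + (?s u - ?s v) * ?s v' \<in> J" by (rule J_add)
    then show ?case by (simp add: right_diff_distrib left_diff_distrib mult_single)
  next
    case (relation u v)
    then show ?case using rel generators_in_J unfolding ideal_generators_def by blast
  qed (use gen in auto)
qed

section \<open>The induced homomorphisms\<close>

lemma polygon_via_classes: "polygon_via \<Sigma> g \<gamma>s \<Longrightarrow> set \<gamma>s \<subseteq> reduced_classes \<Sigma>"
  by (simp add: polygon_via_def Let_def)

lemma chord_image_in:
  assumes "tame_surface \<Sigma>" "polygon_via \<Sigma> g \<gamma>s" "i \<in> {1..length \<gamma>s}" "j \<in> {1..length \<gamma>s}"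
  shows "chord_image (length \<gamma>s) \<Sigma> g i j \<in> reduced_classes \<Sigma>"
proof -
  have "tame_morphism (polygon (length \<gamma>s)) \<Sigma> g"
    using assms(1,2) tame_polygon by (intro tame_morphism.intro) (simp_all add: polygon_via_def Let_def)
  then show ?thesis
    unfolding chord_image_def using chord_in assms(3,4) by (intro tame_morphism.class_image_in)
qed

lemma triangle_group_relations_words:
  assumes "tame_surface \<Sigma>"
  shows "triangle_group_relations \<Sigma> \<subseteq> words_over (reduced_classes \<Sigma>) \<times> words_over (reduced_classes \<Sigma>)"
proof -
  have "{\<gamma>1, \<gamma>2, \<gamma>3} \<subseteq> reduced_classes \<Sigma>" if "is_polygon \<Sigma> [\<gamma>1, \<gamma>2, \<gamma>3]" for \<gamma>1 \<gamma>2 \<gamma>3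
    using that polygon_via_classes unfolding is_polygon_def by fastforce
  then show ?thesis
    unfolding triangle_group_relations_def using trivial_classes_subset[OF assms] reversed_class_in[of _ \<Sigma>]
    by (auto simp: words_over_Word)
qed

lemma surface_algebra_relations_carrier:
  assumes "tame_surface \<Sigma>"
  shows "surface_algebra_relations \<Sigma> \<subseteq> carrier (free_algebra (reduced_classes \<Sigma>))"
proof
  let ?G = "reduced_classes \<Sigma>"
  have mono: "monomial ls \<in> carrier (free_algebra ?G)" if "set ls \<subseteq> Gen ` ?G \<union> Inv ` ?G" for ls
    using keys_words_monomial[OF that] by simp
  have one: "1 \<in> carrier (free_algebra ?G)" by simp
  have diff: "p - q \<in> carrier (free_algebra ?G)" if "p \<in> carrier (free_algebra ?G)" "q \<in> carrier (free_algebra ?G)" for p q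
    using that by (simp add: keys_words_diff)
  have add: "p + q \<in> carrier (free_algebra ?G)" if "p \<in> carrier (free_algebra ?G)" "q \<in> carrier (free_algebra ?G)" for p q
    using that by (simp add: keys_words_add)
  fix p assume "p \<in> surface_algebra_relations \<Sigma>"
  then consider
      (trivial) \<gamma> where "\<gamma> \<in> trivial_classes \<Sigma>" "p = monomial [Gen \<gamma>] - 1"
    | (triangle) \<gamma>1 \<gamma>2 \<gamma>3 where "is_polygon \<Sigma> [\<gamma>1, \<gamma>2, \<gamma>3]"
        "p = monomial [Gen \<gamma>1, Inv (reversed_class \<gamma>2), Gen \<gamma>3]
          - monomial [Gen (reversed_class \<gamma>3), Inv \<gamma>2, Gen (reversed_class \<gamma>1)]"
    | (quad) g \<gamma>1 \<gamma>2 \<gamma>3 \<gamma>4 where "polygon_via \<Sigma> g [\<gamma>1, \<gamma>2, \<gamma>3, \<gamma>4]"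
        "p = (let \<gamma> = chord_image 4 \<Sigma> g in
          monomial [Gen (\<gamma> 2 4)]
          - (monomial [Gen (\<gamma> 2 1), Inv (\<gamma> 3 1), Gen (\<gamma> 3 4)]
             + monomial [Gen (\<gamma> 2 3), Inv (\<gamma> 1 3), Gen (\<gamma> 1 4)]))"
    unfolding surface_algebra_relations_def by blast
  then show "p \<in> carrier (free_algebra ?G)"
  proof cases
    case trivial
    then show ?thesis using trivial_classes_subset[OF assms] by (auto intro!: diff mono one simp del: free_algebra_simps)
  next
    case triangle
    then have "{\<gamma>1, \<gamma>2, \<gamma>3} \<subseteq> ?G" using polygon_via_classes unfolding is_polygon_def by fastforce
    then show ?thesis
      unfolding triangle(2) by (intro diff mono) (auto intro: reversed_class_in)
  next
    case quad
    have "chord_image 4 \<Sigma> g i j \<in> ?G" if "i \<in> {1..4}" "j \<in> {1..4}" for i j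
      using chord_image_in[OF assms quad(1), of i j] that by (simp add: numeral_eq_Suc)
    then show ?thesis
      unfolding quad(2) Let_def by (intro diff add mono) auto
  qed
qed

lemma canonical_map_class:
  assumes "tame_surface \<Sigma>" and w: "w \<in> words_over (reduced_classes \<Sigma>)"
  shows "canonical_map \<Sigma> (word_class (reduced_classes \<Sigma>) (triangle_group_relations \<Sigma>) w) =
    poly_class (reduced_classes \<Sigma>) (surface_algebra_relations \<Sigma>) (Poly_Mapping.single w 1)"
proof -
  let ?G = "reduced_classes \<Sigma>" and ?RT = "triangle_group_relations \<Sigma>" and ?RA = "surface_algebra_relations \<Sigma>"
  interpret algebra_presentation ?G ?RA
    by (rule algebra_presentation.intro[OF surface_algebra_relations_carrier[OF assms(1)]])
  have rel: "Poly_Mapping.single u 1 - Poly_Mapping.single v 1 \<in> ?RA" if "(u, v) \<in> ?RT" for u v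
    using that unfolding triangle_group_relations_def surface_algebra_relations_def monomial_def single_one[symmetric]
    by blast
  have "cls (monomial (letters v)) = cls (Poly_Mapping.single w 1)" if "v \<in> word_class ?G ?RT w" for v
  proof -
    have "word_cong ?G ?RT v w" using that unfolding word_class_def by (blast intro: word_cong.sym)
    then have "Poly_Mapping.single v 1 - Poly_Mapping.single w 1 \<in> J"
      by (rule word_cong_ideal[OF algebra_presentation_axioms triangle_group_relations_words[OF assms(1)], rotated]) (rule rel)
    then show ?thesis by (simp add: cls_eq_iff monomial_def)
  qed
  moreover have "w \<in> word_class ?G ?RT w" using word_cong.refl[OF w] by (simp add: word_class_def)
  ultimately show ?thesis unfolding canonical_map_def by (intro the_equality) auto
qed

context tame_morphism
begin

abbreviation image_class where "image_class \<equiv> class_image \<Sigma> \<Sigma>' f"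

lemma is_polygon_image:
  assumes "is_polygon \<Sigma> \<gamma>s" "1 \<le> length \<gamma>s"
  shows "is_polygon \<Sigma>' (map image_class \<gamma>s)"
proof -
  obtain g where g: "polygon_via \<Sigma> g \<gamma>s" using assms(1) unfolding is_polygon_def by blast
  obtain g' where "polygon_via \<Sigma>' g' (map image_class \<gamma>s)"
    by (rule polygon_via_image[OF tame_morphism_axioms g assms(2)]) (rule that)
  then show ?thesis unfolding is_polygon_def by blast
qed

lemma triangle_image:
  assumes "is_polygon \<Sigma> [\<gamma>1, \<gamma>2, \<gamma>3]"
  shows "is_polygon \<Sigma>' [image_class \<gamma>1, image_class \<gamma>2, image_class \<gamma>3]"
    "i \<in> {\<gamma>1, \<gamma>2, \<gamma>3} \<Longrightarrow> image_class (reversed_class i) = reversed_class (image_class i)"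
proof -
  show "is_polygon \<Sigma>' [image_class \<gamma>1, image_class \<gamma>2, image_class \<gamma>3]"
    using is_polygon_image[OF assms] by simp
  have "{\<gamma>1, \<gamma>2, \<gamma>3} \<subseteq> reduced_classes \<Sigma>" using assms polygon_via_classes unfolding is_polygon_def by fastforce
  then show "i \<in> {\<gamma>1, \<gamma>2, \<gamma>3} \<Longrightarrow> image_class (reversed_class i) = reversed_class (image_class i)"
    using class_image_reversed by blast
qed

lemma triangle_group_relations_image:
  assumes "(u, v) \<in> triangle_group_relations \<Sigma>"
  shows "(relabel image_class u, relabel image_class v) \<in> triangle_group_relations \<Sigma>'"
proof -
  consider (trivial) \<gamma> where "\<gamma> \<in> trivial_classes \<Sigma>" "u = Word [Gen \<gamma>]" "v = 0"
    | (triangle) \<gamma>1 \<gamma>2 \<gamma>3 where "is_polygon \<Sigma> [\<gamma>1, \<gamma>2, \<gamma>3]"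
        "u = Word [Gen \<gamma>1, Inv (reversed_class \<gamma>2), Gen \<gamma>3]"
        "v = Word [Gen (reversed_class \<gamma>3), Inv \<gamma>2, Gen (reversed_class \<gamma>1)]"
    using assms unfolding triangle_group_relations_def by blast
  then show ?thesis
  proof cases
    case trivial
    then show ?thesis using class_image_trivial unfolding triangle_group_relations_def by simp
  next
    case triangle
    then show ?thesis
      using triangle_image[OF triangle(1)] unfolding triangle_group_relations_def by simp
  qed
qed

text \<open>Relations go literally to relations of the target, because the image of classes commutes
  with reversal and with taking chords of a polygon.\<close>

lemma surface_algebra_relations_image:
  "poly_relabel image_class ` surface_algebra_relations \<Sigma> \<subseteq> surface_algebra_relations \<Sigma>'"
proof
  fix q assume "q \<in> poly_relabel image_class ` surface_algebra_relations \<Sigma>"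
  then obtain p where p: "q = poly_relabel image_class p" "p \<in> surface_algebra_relations \<Sigma>" by blast
  from p(2) consider
      (trivial) \<gamma> where "\<gamma> \<in> trivial_classes \<Sigma>" "p = monomial [Gen \<gamma>] - 1"
    | (triangle) \<gamma>1 \<gamma>2 \<gamma>3 where "is_polygon \<Sigma> [\<gamma>1, \<gamma>2, \<gamma>3]"
        "p = monomial [Gen \<gamma>1, Inv (reversed_class \<gamma>2), Gen \<gamma>3]
          - monomial [Gen (reversed_class \<gamma>3), Inv \<gamma>2, Gen (reversed_class \<gamma>1)]"
    | (quad) g \<gamma>1 \<gamma>2 \<gamma>3 \<gamma>4 where "polygon_via \<Sigma> g [\<gamma>1, \<gamma>2, \<gamma>3, \<gamma>4]"
        "p = (let \<gamma> = chord_image 4 \<Sigma> g in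
          monomial [Gen (\<gamma> 2 4)]
          - (monomial [Gen (\<gamma> 2 1), Inv (\<gamma> 3 1), Gen (\<gamma> 3 4)]
             + monomial [Gen (\<gamma> 2 3), Inv (\<gamma> 1 3), Gen (\<gamma> 1 4)]))"
    unfolding surface_algebra_relations_def by blast
  then show "q \<in> surface_algebra_relations \<Sigma>'"
  proof cases
    case trivial
    then show ?thesis
      using class_image_trivial unfolding p(1) surface_algebra_relations_def by (auto simp: poly_relabel_diff)
  next
    case triangle
    have "q = monomial [Gen (image_class \<gamma>1), Inv (reversed_class (image_class \<gamma>2)), Gen (image_class \<gamma>3)]
          - monomial [Gen (reversed_class (image_class \<gamma>3)), Inv (image_class \<gamma>2), Gen (reversed_class (image_class \<gamma>1))]"
      using triangle_image(2)[OF triangle(1)] by (simp add: p(1) triangle(2) poly_relabel_diff)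
    then show ?thesis
      using triangle_image(1)[OF triangle(1)] unfolding surface_algebra_relations_def by blast
  next
    case quad
    obtain g' where g': "polygon_via \<Sigma>' g' (map image_class [\<gamma>1, \<gamma>2, \<gamma>3, \<gamma>4])"
      "\<And>i j. i \<in> {1..length [\<gamma>1, \<gamma>2, \<gamma>3, \<gamma>4]} \<Longrightarrow> j \<in> {1..length [\<gamma>1, \<gamma>2, \<gamma>3, \<gamma>4]} \<Longrightarrow>
        chord_image (length [\<gamma>1, \<gamma>2, \<gamma>3, \<gamma>4]) \<Sigma>' g' i j = image_class (chord_image (length [\<gamma>1, \<gamma>2, \<gamma>3, \<gamma>4]) \<Sigma> g i j)"
      by (rule polygon_via_image[OF tame_morphism_axioms quad(1)]) (simp, rule that)
    have ch: "image_class (chord_image 4 \<Sigma> g i j) = chord_image 4 \<Sigma>' g' i j" if "i \<in> {1..4}" "j \<in> {1..4}" for i j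
      using g'(2)[of i j] that by (simp add: numeral_eq_Suc)
    have "q = (let \<gamma> = chord_image 4 \<Sigma>' g' in
          monomial [Gen (\<gamma> 2 4)]
          - (monomial [Gen (\<gamma> 2 1), Inv (\<gamma> 3 1), Gen (\<gamma> 3 4)]
             + monomial [Gen (\<gamma> 2 3), Inv (\<gamma> 1 3), Gen (\<gamma> 1 4)]))"
      by (simp add: p(1) quad(2) Let_def poly_relabel_diff poly_relabel_add ch)
    then show ?thesis
      using g'(1) unfolding surface_algebra_relations_def list.map by blast
  qed
qed

end

theorem theorem3p16:
  fixes \<Sigma> :: "'a marked_surface" and \<Sigma>' :: "'b marked_surface" and f :: "'a \<Rightarrow> 'b"
  assumes "is_marked_surface \<Sigma>" and "is_marked_surface \<Sigma>'"
    and "surface_morphism \<Sigma> \<Sigma>' f"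
  shows "\<exists>f_grp f_alg.
      (f_grp \<in> hom (triangle_group \<Sigma>) (triangle_group \<Sigma>') \<and>
       (\<forall>\<gamma>\<in>reduced_classes \<Sigma>. f_grp (t_elem \<Sigma> \<gamma>) = t_elem \<Sigma>' (class_image \<Sigma> \<Sigma>' f \<gamma>)) \<and>
       (\<forall>h\<in>hom (triangle_group \<Sigma>) (triangle_group \<Sigma>').
          (\<forall>\<gamma>\<in>reduced_classes \<Sigma>. h (t_elem \<Sigma> \<gamma>) = t_elem \<Sigma>' (class_image \<Sigma> \<Sigma>' f \<gamma>)) \<longrightarrow>
          (\<forall>u\<in>carrier (triangle_group \<Sigma>). h u = f_grp u))) \<and>
      (f_alg \<in> algebra_hom (surface_algebra \<Sigma>) (surface_algebra \<Sigma>') \<and>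
       (\<forall>\<gamma>\<in>reduced_classes \<Sigma>. f_alg (x_elem \<Sigma> \<gamma>) = x_elem \<Sigma>' (class_image \<Sigma> \<Sigma>' f \<gamma>)) \<and>
       (\<forall>h\<in>algebra_hom (surface_algebra \<Sigma>) (surface_algebra \<Sigma>').
          (\<forall>\<gamma>\<in>reduced_classes \<Sigma>. h (x_elem \<Sigma> \<gamma>) = x_elem \<Sigma>' (class_image \<Sigma> \<Sigma>' f \<gamma>)) \<longrightarrow>
          (\<forall>a\<in>carrier (surface_algebra \<Sigma>). h a = f_alg a))) \<and>
      (\<forall>u\<in>carrier (triangle_group \<Sigma>).
         f_alg (canonical_map \<Sigma> u) = canonical_map \<Sigma>' (f_grp u))"
proof -
  interpret tame_morphism \<Sigma> \<Sigma>' f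
    by (intro tame_morphism.intro is_marked_surface_tame assms)
  let ?G = "reduced_classes \<Sigma>" and ?G' = "reduced_classes \<Sigma>'"
  let ?RT = "triangle_group_relations \<Sigma>" and ?RT' = "triangle_group_relations \<Sigma>'"
  let ?RA = "surface_algebra_relations \<Sigma>" and ?RA' = "surface_algebra_relations \<Sigma>'"
  have m: "image_class ` ?G \<subseteq> ?G'" using class_image_in by blast
  have alg: "algebra_presentation ?G ?RA" "algebra_presentation ?G' ?RA'"
    by (intro algebra_presentation.intro surface_algebra_relations_carrier tame)+
  interpret alg: algebra_presentation_map ?G ?RA ?G' ?RA' image_class
    by (intro algebra_presentation_map.intro algebra_presentation_map_axioms.intro alg m surface_algebra_relations_image)
  define f_grp where "f_grp = group_relabel image_class ?G' ?RT'"
  define f_alg where "f_alg = algebra_relabel image_class ?G' ?RA'"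
  have grp_class: "f_grp (word_class ?G ?RT w) = word_class ?G' ?RT' (relabel image_class w)" if "w \<in> words_over ?G" for w
    unfolding f_grp_def by (rule group_relabel_class[OF m _ that]) (rule triangle_group_relations_image)
  have alg_class: "f_alg (poly_class ?G ?RA p) = poly_class ?G' ?RA' (poly_relabel image_class p)" for p
    unfolding f_alg_def by (rule alg.algebra_relabel_class)
  have grp: "f_grp \<in> hom (triangle_group \<Sigma>) (triangle_group \<Sigma>')"
    unfolding f_grp_def triangle_group_def by (rule group_relabel_hom[OF m]) (rule triangle_group_relations_image)
  have grp_t: "f_grp (t_elem \<Sigma> \<gamma>) = t_elem \<Sigma>' (image_class \<gamma>)" if "\<gamma> \<in> ?G" for \<gamma>
    unfolding t_elem_def using that by (simp add: grp_class words_over_Word)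
  have grp_unique: "h u = f_grp u"
    if "h \<in> hom (triangle_group \<Sigma>) (triangle_group \<Sigma>')"
      "\<forall>\<gamma>\<in>?G. h (t_elem \<Sigma> \<gamma>) = t_elem \<Sigma>' (image_class \<gamma>)" "u \<in> carrier (triangle_group \<Sigma>)" for h u
  proof (rule presented_group_hom_unique[where h = h and h' = f_grp and x = u])
    show "Group.group (triangle_group \<Sigma>')" unfolding triangle_group_def by (rule group_presented_group)
    show "h \<in> hom (presented_group ?G ?RT) (triangle_group \<Sigma>')" "f_grp \<in> hom (presented_group ?G ?RT) (triangle_group \<Sigma>')"
      "u \<in> carrier (presented_group ?G ?RT)"
      using that grp by (simp_all add: triangle_group_def)
    show "h (word_class ?G ?RT (Word [Gen \<gamma>])) = f_grp (word_class ?G ?RT (Word [Gen \<gamma>]))" if "\<gamma> \<in> ?G" for \<gamma>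
      using \<open>\<forall>\<gamma>\<in>?G. h (t_elem \<Sigma> \<gamma>) = t_elem \<Sigma>' (image_class \<gamma>)\<close> grp_t that unfolding t_elem_def by simp
  qed
  have f_alg: "f_alg \<in> algebra_hom (surface_algebra \<Sigma>) (surface_algebra \<Sigma>')"
    unfolding f_alg_def surface_algebra_def by (rule alg.algebra_relabel_hom)
  have alg_x: "f_alg (x_elem \<Sigma> \<gamma>) = x_elem \<Sigma>' (image_class \<gamma>)" for \<gamma>
    unfolding x_elem_def by (simp add: alg_class)
  have alg_unique: "h a = f_alg a"
    if "h \<in> algebra_hom (surface_algebra \<Sigma>) (surface_algebra \<Sigma>')"
      "\<forall>\<gamma>\<in>?G. h (x_elem \<Sigma> \<gamma>) = x_elem \<Sigma>' (image_class \<gamma>)" "a \<in> carrier (surface_algebra \<Sigma>)" for h a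
  proof (rule alg.algebra_hom_unique[where h = h and h' = f_alg and x = a])
    show "h \<in> algebra_hom (presented_algebra ?G ?RA) (presented_algebra ?G' ?RA')"
      "f_alg \<in> algebra_hom (presented_algebra ?G ?RA) (presented_algebra ?G' ?RA')"
      "a \<in> carrier (presented_algebra ?G ?RA)"
      using that f_alg by (simp_all add: surface_algebra_def)
    show "h (poly_class ?G ?RA (monomial [Gen \<gamma>])) = f_alg (poly_class ?G ?RA (monomial [Gen \<gamma>]))" if "\<gamma> \<in> ?G" for \<gamma>
      using \<open>\<forall>\<gamma>\<in>?G. h (x_elem \<Sigma> \<gamma>) = x_elem \<Sigma>' (image_class \<gamma>)\<close> alg_x that unfolding x_elem_def by simp
  qed
  \<comment> \<open>On the class of a word w both ways around the square give the class of the
    monomial of the relabelled word.\<close>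
  have square: "f_alg (canonical_map \<Sigma> u) = canonical_map \<Sigma>' (f_grp u)" if u: "u \<in> carrier (triangle_group \<Sigma>)" for u
  proof -
    obtain w where w: "w \<in> words_over ?G" "u = word_class ?G ?RT w"
      using u unfolding triangle_group_def presented_group_simps by blast
    show ?thesis
      unfolding w(2) canonical_map_class[OF tame(1) w(1)] alg_class grp_class[OF w(1)]
        canonical_map_class[OF tame(2) relabel_words_over[OF m w(1)]] by simp
  qed
  show ?thesis
    by (intro exI[of _ f_grp] exI[of _ f_alg] conjI ballI impI grp grp_t grp_unique f_alg alg_x alg_unique square; blast)
qed

end
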